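(* Let $\mathbb{C},\mathbb{D}$ be 2-multicategories, let $J:\mathbb{D}\to\mathbb{C}$ be a pseudo-multifunctor whose restriction to unary multimorphisms is a 2-functor, and let $T$ be a lax-idempotent strong relative pseudomonad along $J$. Then $T$ is pseudocommutative, with a pseudocommutativity whose components $\gamma_g:g^{ts}\to g^{st}$ (for $g:B_1,\dots,JX,\dots,JY,\dots,B_n\to TZ$, with $s$ denoting strengthening in the argument $JX$ and $t$ in the argument $JY$) are given by the composite $$g^{ts}\xrightarrow{(\tilde s_g)^{ts}}(g^s\circ_s i)^{ts}\xrightarrow{\sim}(g^{st}\circ_s i)^s\xrightarrow{\sigma_{g^{st}}}g^{st},$$ where $\sim$ is the pseudonaturality isomorphism of the strength and $\sigma$ is the counit of the adjunction $(-)^s\dashv -\circ_s i$.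
   Context: **2-multicategories.** A 2-multicategory $\mathbb{C}$ is a multicategory enriched in $\mathrm{Cat}$: it has objects, a hom-category $\mathbb{C}(X_1,\dots,X_n;Y)$ for each $n\ge 0$ and objects $X_1,\dots,X_n,Y$ (its objects are multimorphisms $f:X_1,\dots,X_n\to Y$, its morphisms are 2-cells), identities $1_X\in\mathbb{C}(X;X)$, and composition functors $(f,g_1,\dots,g_n)\mapsto f\circ(g_1,\dots,g_n)$, strictly associative and unital. For $f:X_1,\dots,X_n\to Y$ and $g:W_1,\dots,W_m\to X_j$ write $f\circ_j g:=f\circ(1,\dots,1,g,1,\dots,1)$ ($g$ in position $j$). Restricting to unary multimorphisms gives a 2-category. A unary 2-functor between 2-multicategories is a 2-functor between these underlying 2-categories. **Pseudo-multifunctors.** A pseudo-multifunctor $F:\mathbb{D}\to\mathbb{C}$ between 2-multicategories consists of a function $X\mapsto FX$ on objects; functors $\mathbb{D}(X_1,\dots,X_n;Y)\to\mathbb{C}(FX_1,\dots,FX_n;FY)$, $f\mapsto Ff$; for each $X$ an invertible 2-cell $\tilde F_X:F1_X\Rightarrow 1_{FX}$; and for each $f:X_1,\dots,X_n\to Y$, $1\le i\le n$, $g:W_1,\dots,W_m\to X_i$ an invertible 2-cell $\hat F_{f,g}:F(f\circ_i g)\Rightarrow Ff\circ_i Fg$; such that (1) $Ff=F(1_Y\circ f)\xrightarrow{\hat F_{1,f}}F1_Y\circ Ff\xrightarrow{\tilde F_Y\circ Ff}Ff$ is the identity; (2) $Ff=F(f\circ_i 1_{X_i})\xrightarrow{\hat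 F_{f,1}}Ff\circ_i F1_{X_i}\xrightarrow{Ff\circ_i\tilde F_{X_i}}Ff$ is the identity; (3) for $f:X_1,\dots,X_n\to Y$, $g:W_1,\dots,W_m\to X_i$ and $h:V_1,\dots,V_l\to W_j$, we have $(Ff\circ_i\hat F_{g,h})\cdot\hat F_{f,\,g\circ_j h}=(\hat F_{f,g}\circ_{i+j-1}Fh)\cdot\hat F_{f\circ_i g,\,h}$. **Strong relative pseudomonads.** Let $J:\mathbb{D}\to\mathbb{C}$ be a (unary) 2-functor between 2-multicategories. A strong relative pseudomonad $(T,i,(-)^t;\tilde t,\hat t,\theta)$ along $J$ consists of: - for every object $X$ of $\mathbb{D}$, an object $TX$ of $\mathbb{C}$ and a unit map $i_X:JX\to TX$; - for every $n$, index $1\le j\le n$, objects $B_k$ ($k\ne j$) of $\mathbb{C}$ and objects $X,Y$ of $\mathbb{D}$, a functor (the strength, or strengthening, in the $j$th argument) $$(-)^{t_j}:\mathbb{C}(B_1,\dots,B_{j-1},JX,B_{j+1},\dots,B_n;TY)\to\mathbb{C}(B_1,\dots,B_{j-1},TX,B_{j+1},\dots,B_n;TY),$$ pseudonatural in all arguments; in particular there are (unnamed) invertible 2-cells $(f\circ_k g)^t\cong f^t\circ_k g$ for $g:C_1,\dots,C_m\to B_k$, $k\neq j$; these pseudonaturality isomorphisms are denoted $\sim$; - three natural families of invertible 2-cells, for $f:B_1,\dots,JX,\dots,B_n\to TY$ and $g:C_1,\dots,JW,\dots,C_m\to TX$ ($JX$ in position $j$ and $JW$ in position $k$): $\tilde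 t_f:f\to f^{t_j}\circ_j i_X$, $\ \hat t_{f,g}:(f^{t_j}\circ_j g)^{t_{j+k-1}}\to f^{t_j}\circ_j g^{t_k}$, $\ \theta_X:(i_X)^{t_1}\to 1_{TX}$. When only one argument is being strengthened we write $f^t$ for $f^{t_j}$ and $f^t\circ_t g$ for composition in that strengthened argument; subscripts on $i$ and $\theta$ may be omitted. The data must satisfy: (1) for all $f:B_1,\dots,JX,\dots,B_n\to TY$, $g:C_1,\dots,JW,\dots,C_m\to TX$, $h:D_1,\dots,JV,\dots,D_l\to TW$, the 2-cells $((f^t\circ_t g)^t\circ_t h)^t\to f^t\circ_t g^t\circ_t h^t$ given by "$\hat t_{f^t\circ_t g,\,h}$, then $\hat t_{f,g}\circ_t h^t$" and "$(\hat t_{f,g}\circ_t h)^t$, then $\hat t_{f,\,g^t\circ_t h}$, then $f^t\circ_t\hat t_{g,h}$" are equal; (2) for all $f:B_1,\dots,JX,\dots,B_n\to TY$, the composite $f^t\xrightarrow{(\tilde t_f)^t}(f^t\circ_t i)^t\xrightarrow{\hat t_{f,i}}f^t\circ_t i^t\xrightarrow{f^t\circ_t\theta}f^t$ is the identity. Iterated strengthenings are written as a string read from left to right: $f^{ts}=(f^t)^s$. **Lax-idempotent strong relative pseudomonads.** A strong relative pseudomonad $T$ along $J$ is a lax-idempotent strong relative pseudomonad if for every $1\le j\le n$ and all objects there is an adjunction $(-)^{t_j}\dashv -\circ_j i_X$ between $\mathbb{C}(B_1,\dots,JX,\dots,B_n;TY)$ and $\mathbb{C}(B_1,\dots,TX,\dots,B_n;TY)$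 ($JX$, $TX$ in position $j$) whose unit has components $\tilde t_f:f\to f^{t_j}\circ_j i_X$, the 2-cells of the strong structure. Equivalently, $\tilde t_f$ exhibits $f^{t_j}$ as the left Kan extension of $f$ along $1,\dots,i,\dots,1$. The counit of the adjunction for a strengthening called $(-)^t$ is written $\tau_f:(f\circ_t i)^t\to f$, and for a strengthening called $(-)^s$ (with unit $\tilde s$) it is written $\sigma_f:(f\circ_s i)^s\to f$. **Pseudocommutativity.** A strong relative pseudomonad $T$ is pseudocommutative if for every pair $1\le j<k\le n$ and every $f:B_1,\dots,B_{j-1},JX,B_{j+1},\dots,B_{k-1},JY,B_{k+1},\dots,B_n\to TZ$ there is an invertible 2-cell $\gamma_f:f^{t_kt_j}\to f^{t_jt_k}$, pseudonatural in all arguments, satisfying the five conditions below. Notation: for a map with two designated arguments of the form $J(-)$, $f^s$ denotes strengthening in the leftmost of them (with 2-cells $\tilde s,\hat s$ and composition $\circ_s$ in that argument) and $f^t$ strengthening in the rightmost (with $\tilde t,\hat t,\circ_t$); with three designated arguments the strengthenings are $s,t,u$ from left to right. So $\gamma_f:f^{ts}\to f^{st}$. The strengthening of a map with one designated argument is still written $g^t$. (1) $f^t\xrightarrow{\tilde s_{f^t}}f^{ts}\circ_s i\xrightarrow{\gamma_f\circ_s i}f^{st}\circ_s i\xrightarrow{\sim}(f^s\circ_s i)^t$ equals $(\tilde s_f)^t$. (2) $f^s\xrightarrow{(\tilde t_f)^s}(f^t\circ_t i)^s\xrightarrow{\sim}f^{ts}\circ_t i\xrightarrow{\gamma_f\circ_t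 i}f^{st}\circ_t i$ equals $\tilde t_{f^s}$. (3) For $g:C_1,\dots,JW,\dots,C_m\to TX$: $(f^{ts}\circ_s g)^s\xrightarrow{\hat s_{f^t,g}}f^{ts}\circ_s g^t\xrightarrow{\gamma_f\circ_s g^t}f^{st}\circ_s g^t\xrightarrow{\sim}(f^s\circ_s g^t)^t$ equals $(f^{ts}\circ_s g)^s\xrightarrow{(\gamma_f\circ_s g)^s}(f^{st}\circ_s g)^s\xrightarrow{\sim}(f^s\circ_s g)^{ts}\xrightarrow{\gamma_{f^s\circ_s g}}(f^s\circ_s g)^{st}\xrightarrow{(\hat s_{f,g})^t}(f^s\circ_s g^t)^t$. (4) For $h:D_1,\dots,JV,\dots,D_l\to TY$: $(f^t\circ_t h)^{ts}\xrightarrow{(\hat t_{f,h})^s}(f^t\circ_t h^t)^s\xrightarrow{\sim}f^{ts}\circ_t h^t\xrightarrow{\gamma_f\circ_t h^t}f^{st}\circ_t h^t$ equals $(f^t\circ_t h)^{ts}\xrightarrow{\gamma_{f^t\circ_t h}}(f^t\circ_t h)^{st}\xrightarrow{\sim}(f^{ts}\circ_t h)^t\xrightarrow{(\gamma_f\circ_t h)^t}(f^{st}\circ_t h)^t\xrightarrow{\hat t_{f^s,h}}f^{st}\circ_t h^t$. (5) For $f:B_1,\dots,JW,\dots,JX,\dots,JY,\dots,B_n\to TZ$: $f^{uts}\xrightarrow{(\gamma_f)^s}f^{tus}\xrightarrow{\gamma_{f^t}}f^{tsu}\xrightarrow{(\gamma_f)^u}f^{stu}$ equals $f^{uts}\xrightarrow{\gamma_{f^u}}f^{ust}\xrightarrow{(\gamma_f)^t}f^{sut}\xrightarrow{\gamma_{f^s}}f^{stu}$.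 *)

theory Defs
  imports Main
begin

section \<open>2-multicategories\<close>

text \<open>
  Multimorphisms and 2-cells form sets with explicit (co)domains. The domain of a multimorphism
  is the list of its argument objects; \<open>Comp C f [g\<^sub>1, \<dots>, g\<^sub>n]\<close> is
  \<open>f \<circ> (g\<^sub>1, \<dots>, g\<^sub>n)\<close> and \<open>HComp\<close> is the action of this composition functor on 2-cells.
  \<open>VComp C \<beta> \<alpha>\<close>, written \<open>\<beta> \<cdot> \<alpha>\<close>, is the composite \<^emph>\<open>first \<open>\<alpha>\<close>, then \<open>\<beta>\<close>\<close> in a hom-category.
  Argument positions are counted from \<open>0\<close> throughout.
\<close>

record ('o, 'm, 'c) two_multicat =
  Obj :: "'o set"
  Mor :: "'m set"
  Dom :: "'m \<Rightarrow> 'o list"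
  Cod :: "'m \<Rightarrow> 'o"
  Ide :: "'o \<Rightarrow> 'm"
  Comp :: "'m \<Rightarrow> 'm list \<Rightarrow> 'm"
  Cell :: "'c set"
  Src :: "'c \<Rightarrow> 'm"
  Tgt :: "'c \<Rightarrow> 'm"
  CIde :: "'m \<Rightarrow> 'c"
  VComp :: "'c \<Rightarrow> 'c \<Rightarrow> 'c"  (infixl "\<cdot>\<index>" 60)
  HComp :: "'c \<Rightarrow> 'c list \<Rightarrow> 'c"

definition hom :: "('o, 'm, 'c, 'z) two_multicat_scheme \<Rightarrow> 'o list \<Rightarrow> 'o \<Rightarrow> 'm set" where
  "hom C Xs Y = {f \<in> Mor C. Dom C f = Xs \<and> Cod C f = Y}"

definition hom_at :: "('o, 'm, 'c, 'z) two_multicat_scheme \<Rightarrow> nat \<Rightarrow> 'o \<Rightarrow> 'o \<Rightarrow> 'm set" where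
  "hom_at C j A Y = {f \<in> Mor C. j < length (Dom C f) \<and> Dom C f ! j = A \<and> Cod C f = Y}"

definition cells :: "('o, 'm, 'c, 'z) two_multicat_scheme \<Rightarrow> 'm \<Rightarrow> 'm \<Rightarrow> 'c set" where
  "cells C f g = {\<alpha> \<in> Cell C. Src C \<alpha> = f \<and> Tgt C \<alpha> = g}"

definition composable :: "('o, 'm, 'c, 'z) two_multicat_scheme \<Rightarrow> 'm \<Rightarrow> 'm list \<Rightarrow> bool" where
  "composable C f gs \<longleftrightarrow> f \<in> Mor C \<and> set gs \<subseteq> Mor C \<and> map (Cod C) gs = Dom C f"

definition composable_cells :: "('o, 'm, 'c, 'z) two_multicat_scheme \<Rightarrow> 'c \<Rightarrow> 'c list \<Rightarrow> bool" where
  "composable_cells C \<alpha> \<beta>s \<longleftrightarrow>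
     \<alpha> \<in> Cell C \<and> set \<beta>s \<subseteq> Cell C \<and> composable C (Src C \<alpha>) (map (Src C) \<beta>s)"

locale two_multicategory =
  fixes C :: "('o, 'm, 'c, 'z) two_multicat_scheme" (structure)
  assumes dom_obj: "f \<in> Mor C \<Longrightarrow> set (Dom C f) \<subseteq> Obj C"
    and cod_obj: "f \<in> Mor C \<Longrightarrow> Cod C f \<in> Obj C"
    and ide_hom: "X \<in> Obj C \<Longrightarrow> Ide C X \<in> hom C [X] X"
    and comp_hom:
      "composable C f gs \<Longrightarrow> Comp C f gs \<in> hom C (concat (map (Dom C) gs)) (Cod C f)"
    and comp_ide_left: "f \<in> Mor C \<Longrightarrow> Comp C (Ide C (Cod C f)) [f] = f"
    and comp_ide_right: "f \<in> Mor C \<Longrightarrow> Comp C f (map (Ide C) (Dom C f)) = f"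
    and comp_assoc:
      "\<lbrakk>composable C f gs; list_all2 (composable C) gs hss\<rbrakk>
        \<Longrightarrow> Comp C (Comp C f gs) (concat hss) = Comp C f (map2 (Comp C) gs hss)"
    and src_mor: "\<alpha> \<in> Cell C \<Longrightarrow> Src C \<alpha> \<in> Mor C"
    and tgt_mor: "\<alpha> \<in> Cell C \<Longrightarrow> Tgt C \<alpha> \<in> Mor C"
    and cell_parallel:
      "\<alpha> \<in> Cell C \<Longrightarrow> Dom C (Src C \<alpha>) = Dom C (Tgt C \<alpha>) \<and> Cod C (Src C \<alpha>) = Cod C (Tgt C \<alpha>)"
    and cide_cell: "f \<in> Mor C \<Longrightarrow> CIde C f \<in> cells C f f"
    and vcomp_cell: "\<lbrakk>\<alpha> \<in> cells C f g; \<beta> \<in> cells C g h\<rbrakk> \<Longrightarrow> \<beta> \<cdot> \<alpha> \<in> cells C f h"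
    and vcomp_ide_left: "\<alpha> \<in> Cell C \<Longrightarrow> CIde C (Tgt C \<alpha>) \<cdot> \<alpha> = \<alpha>"
    and vcomp_ide_right: "\<alpha> \<in> Cell C \<Longrightarrow> \<alpha> \<cdot> CIde C (Src C \<alpha>) = \<alpha>"
    and vcomp_assoc:
      "\<lbrakk>\<alpha> \<in> cells C f g; \<beta> \<in> cells C g h; \<delta> \<in> cells C h k\<rbrakk> \<Longrightarrow> \<delta> \<cdot> (\<beta> \<cdot> \<alpha>) = \<delta> \<cdot> \<beta> \<cdot> \<alpha>"
    and hcomp_cell:
      "composable_cells C \<alpha> \<beta>s \<Longrightarrow>
        HComp C \<alpha> \<beta>s \<in> cells C (Comp C (Src C \<alpha>) (map (Src C) \<beta>s)) (Comp C (Tgt C \<alpha>) (map (Tgt C) \<beta>s))"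
    and hcomp_cide:
      "composable C f gs \<Longrightarrow> HComp C (CIde C f) (map (CIde C) gs) = CIde C (Comp C f gs)"
    and interchange:
      "\<lbrakk>composable_cells C \<alpha> \<beta>s; composable_cells C \<alpha>' \<beta>s';
        Src C \<alpha>' = Tgt C \<alpha>; map (Src C) \<beta>s' = map (Tgt C) \<beta>s\<rbrakk>
        \<Longrightarrow> HComp C (\<alpha>' \<cdot> \<alpha>) (map2 (VComp C) \<beta>s' \<beta>s) = HComp C \<alpha>' \<beta>s' \<cdot> HComp C \<alpha> \<beta>s"
    and hcomp_ide_left: "\<alpha> \<in> Cell C \<Longrightarrow> HComp C (CIde C (Ide C (Cod C (Src C \<alpha>)))) [\<alpha>] = \<alpha>"
    and hcomp_ide_right:
      "\<alpha> \<in> Cell C \<Longrightarrow> HComp C \<alpha> (map (\<lambda>X. CIde C (Ide C X)) (Dom C (Src C \<alpha>))) = \<alpha>"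
    and hcomp_assoc:
      "\<lbrakk>composable_cells C \<alpha> \<beta>s; list_all2 (composable_cells C) \<beta>s \<delta>ss\<rbrakk>
        \<Longrightarrow> HComp C (HComp C \<alpha> \<beta>s) (concat \<delta>ss) = HComp C \<alpha> (map2 (HComp C) \<beta>s \<delta>ss)"

text \<open>
  \<open>f \<odot>[j] g\<close> is the partial composite \<open>f \<circ>\<^sub>j g = f \<circ> (1, \<dots>, 1, g, 1, \<dots>, 1)\<close> and \<open>\<alpha> \<boxdot>[j] \<beta>\<close>
  its action on 2-cells; the whiskerings are \<open>\<alpha> \<circ>\<^sub>j g = \<alpha> \<triangleleft>[j] g\<close> and \<open>f \<circ>\<^sub>j \<beta> = f \<triangleright>[j] \<beta>\<close>.
\<close>

definition pcomp :: "('o, 'm, 'c, 'z) two_multicat_scheme \<Rightarrow> 'm \<Rightarrow> nat \<Rightarrow> 'm \<Rightarrow> 'm"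
    ("(_ \<odot>\<index>[_]/ _)" [65, 0, 66] 65) where
  "pcomp C f j g = Comp C f ((map (Ide C) (Dom C f))[j := g])"

definition pcell :: "('o, 'm, 'c, 'z) two_multicat_scheme \<Rightarrow> 'c \<Rightarrow> nat \<Rightarrow> 'c \<Rightarrow> 'c"
    ("(_ \<boxdot>\<index>[_]/ _)" [65, 0, 66] 65) where
  "pcell C \<alpha> j \<beta> = HComp C \<alpha> ((map (\<lambda>X. CIde C (Ide C X)) (Dom C (Src C \<alpha>)))[j := \<beta>])"

abbreviation whisker_right :: "('o, 'm, 'c, 'z) two_multicat_scheme \<Rightarrow> 'c \<Rightarrow> nat \<Rightarrow> 'm \<Rightarrow> 'c"
    ("(_ \<triangleleft>\<index>[_]/ _)" [65, 0, 66] 65) where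
  "whisker_right C \<alpha> j g \<equiv> pcell C \<alpha> j (CIde C g)"

abbreviation whisker_left :: "('o, 'm, 'c, 'z) two_multicat_scheme \<Rightarrow> 'm \<Rightarrow> nat \<Rightarrow> 'c \<Rightarrow> 'c"
    ("(_ \<triangleright>\<index>[_]/ _)" [65, 0, 66] 65) where
  "whisker_left C f j \<beta> \<equiv> pcell C (CIde C f) j \<beta>"

definition inverse_cells :: "('o, 'm, 'c, 'z) two_multicat_scheme \<Rightarrow> 'c \<Rightarrow> 'c \<Rightarrow> bool" where
  "inverse_cells C \<alpha> \<beta> \<longleftrightarrow>
     \<alpha> \<in> Cell C \<and> \<beta> \<in> cells C (Tgt C \<alpha>) (Src C \<alpha>) \<and>
     VComp C \<beta> \<alpha> = CIde C (Src C \<alpha>) \<and> VComp C \<alpha> \<beta> = CIde C (Tgt C \<alpha>)"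

definition inv_cell :: "('o, 'm, 'c, 'z) two_multicat_scheme \<Rightarrow> 'c \<Rightarrow> 'c" where
  "inv_cell C \<alpha> = (THE \<beta>. inverse_cells C \<alpha> \<beta>)"

definition iso_cells :: "('o, 'm, 'c, 'z) two_multicat_scheme \<Rightarrow> 'm \<Rightarrow> 'm \<Rightarrow> 'c set" where
  "iso_cells C f g = {\<alpha> \<in> cells C f g. \<exists>\<beta>. inverse_cells C \<alpha> \<beta>}"

text \<open>
  If an \<open>m\<close>-ary multimorphism is substituted in position \<open>k\<close>, the argument that was in
  position \<open>j \<noteq> k\<close> moves to position \<open>shift k m j\<close>.
\<close>

definition shift :: "nat \<Rightarrow> nat \<Rightarrow> nat \<Rightarrow> nat" where
  "shift k m j = (if k < j then j + m - 1 else j)"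


section \<open>Unary 2-functors and pseudo-multifunctors\<close>

record ('p, 'n, 'd, 'o, 'm, 'c) two_fun =
  on_obj :: "'p \<Rightarrow> 'o"
  on_mor :: "'n \<Rightarrow> 'm"
  on_cell :: "'d \<Rightarrow> 'c"

text \<open>Only the values on unary multimorphisms and on 2-cells between them matter here.\<close>

locale unary_two_functor =
  fixes D :: "('p, 'n, 'd, 'y) two_multicat_scheme"
    and C :: "('o, 'm, 'c, 'z) two_multicat_scheme" (structure)
    and F :: "('p, 'n, 'd, 'o, 'm, 'c, 'x) two_fun_scheme"
  assumes fun_obj: "X \<in> Obj D \<Longrightarrow> on_obj F X \<in> Obj C"
    and fun_mor: "u \<in> hom D [X] Y \<Longrightarrow> on_mor F u \<in> hom C [on_obj F X] (on_obj F Y)"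
    and fun_cell:
      "\<lbrakk>u \<in> hom D [X] Y; \<alpha> \<in> cells D u v\<rbrakk> \<Longrightarrow> on_cell F \<alpha> \<in> cells C (on_mor F u) (on_mor F v)"
    and fun_cide: "u \<in> hom D [X] Y \<Longrightarrow> on_cell F (CIde D u) = CIde C (on_mor F u)"
    and fun_vcomp:
      "\<lbrakk>u \<in> hom D [X] Y; \<alpha> \<in> cells D u v; \<beta> \<in> cells D v w\<rbrakk>
        \<Longrightarrow> on_cell F (\<beta> \<cdot>\<^bsub>D\<^esub> \<alpha>) = on_cell F \<beta> \<cdot> on_cell F \<alpha>"
    and fun_ide: "X \<in> Obj D \<Longrightarrow> on_mor F (Ide D X) = Ide C (on_obj F X)"
    and fun_comp:
      "\<lbrakk>u \<in> hom D [X] Y; v \<in> hom D [Y] Z\<rbrakk> \<Longrightarrow> on_mor F (v \<odot>\<^bsub>D\<^esub>[0] u) = on_mor F v \<odot>[0] on_mor F u"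
    and fun_hcomp:
      "\<lbrakk>u \<in> hom D [X] Y; v \<in> hom D [Y] Z; \<alpha> \<in> cells D u u'; \<beta> \<in> cells D v v'\<rbrakk>
        \<Longrightarrow> on_cell F (\<beta> \<boxdot>\<^bsub>D\<^esub>[0] \<alpha>) = on_cell F \<beta> \<boxdot>[0] on_cell F \<alpha>"

text \<open>\<open>unit_cell F X\<close> is \<open>F1\<^sub>X \<Rightarrow> 1\<^bsub>FX\<^esub>\<close> and \<open>comp_cell F f j g\<close> is \<open>F(f \<circ>\<^sub>j g) \<Rightarrow> Ff \<circ>\<^sub>j Fg\<close>.\<close>

record ('p, 'n, 'd, 'o, 'm, 'c) pseudo_multifun = "('p, 'n, 'd, 'o, 'm, 'c) two_fun" +
  unit_cell :: "'p \<Rightarrow> 'c"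
  comp_cell :: "'n \<Rightarrow> nat \<Rightarrow> 'n \<Rightarrow> 'c"

locale pseudo_multifunctor =
  fixes D :: "('p, 'n, 'd, 'y) two_multicat_scheme"
    and C :: "('o, 'm, 'c, 'z) two_multicat_scheme" (structure)
    and F :: "('p, 'n, 'd, 'o, 'm, 'c, 'x) pseudo_multifun_scheme"
  assumes pmf_obj: "X \<in> Obj D \<Longrightarrow> on_obj F X \<in> Obj C"
    and pmf_mor: "f \<in> hom D Xs Y \<Longrightarrow> on_mor F f \<in> hom C (map (on_obj F) Xs) (on_obj F Y)"
    and pmf_cell: "\<alpha> \<in> cells D f g \<Longrightarrow> on_cell F \<alpha> \<in> cells C (on_mor F f) (on_mor F g)"
    and pmf_cide: "f \<in> Mor D \<Longrightarrow> on_cell F (CIde D f) = CIde C (on_mor F f)"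
    and pmf_vcomp:
      "\<lbrakk>\<alpha> \<in> cells D f g; \<beta> \<in> cells D g h\<rbrakk> \<Longrightarrow> on_cell F (\<beta> \<cdot>\<^bsub>D\<^esub> \<alpha>) = on_cell F \<beta> \<cdot> on_cell F \<alpha>"
    and pmf_unit_cell:
      "X \<in> Obj D \<Longrightarrow> unit_cell F X \<in> iso_cells C (on_mor F (Ide D X)) (Ide C (on_obj F X))"
    and pmf_comp_cell:
      "\<lbrakk>f \<in> hom_at D i A Y; g \<in> hom D Ws A\<rbrakk>
        \<Longrightarrow> comp_cell F f i g \<in> iso_cells C (on_mor F (f \<odot>\<^bsub>D\<^esub>[i] g)) (on_mor F f \<odot>[i] on_mor F g)"
    and pmf_unit_left:
      "f \<in> hom D Xs Y \<Longrightarrow>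
        (unit_cell F Y \<triangleleft>[0] on_mor F f) \<cdot> comp_cell F (Ide D Y) 0 f = CIde C (on_mor F f)"
    and pmf_unit_right:
      "f \<in> hom_at D i A Y \<Longrightarrow>
        (on_mor F f \<triangleright>[i] unit_cell F A) \<cdot> comp_cell F f i (Ide D A) = CIde C (on_mor F f)"
    and pmf_assoc:
      "\<lbrakk>f \<in> hom_at D i A Y; g \<in> hom_at D j B A; h \<in> hom D Vs B\<rbrakk> \<Longrightarrow>
        (on_mor F f \<triangleright>[i] comp_cell F g j h) \<cdot> comp_cell F f i (g \<odot>\<^bsub>D\<^esub>[j] h)
        = (comp_cell F f i g \<triangleleft>[i + j] on_mor F h) \<cdot> comp_cell F (f \<odot>\<^bsub>D\<^esub>[i] g) (i + j) h"

text \<open>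
  The restriction to unary multimorphisms of a pseudo-multifunctor is a pseudofunctor; it is a
  2-functor when its constraint 2-cells are identities.
\<close>

definition restricts_to_two_functor ::
  "('p, 'n, 'd, 'y) two_multicat_scheme \<Rightarrow> ('o, 'm, 'c, 'z) two_multicat_scheme
    \<Rightarrow> ('p, 'n, 'd, 'o, 'm, 'c, 'x) pseudo_multifun_scheme \<Rightarrow> bool" where
  "restricts_to_two_functor D C F \<longleftrightarrow>
     unary_two_functor D C F \<and>
     (\<forall>X \<in> Obj D. unit_cell F X = CIde C (Ide C (on_obj F X))) \<and>
     (\<forall>X Y Z. \<forall>u \<in> hom D [X] Y. \<forall>v \<in> hom D [Y] Z.
        comp_cell F v 0 u = CIde C (on_mor F v \<odot>\<^bsub>C\<^esub>[0] on_mor F u))"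


section \<open>Strong relative pseudomonads\<close>

text \<open>
  Since \<open>J\<close> and \<open>T\<close> need not be injective on objects, all data carry the objects of the source
  explicitly. For \<open>f : B\<^sub>0, \<dots>, JX, \<dots>, B\<^bsub>n-1\<^esub> \<rightarrow> TY\<close> with \<open>JX\<close> in position \<open>j\<close>:

  \<^item> \<open>strength T j X Y f\<close> is the strengthening of \<open>f\<close> in position \<open>j\<close>, and \<open>strength2 T j X Y\<close>
    its action on 2-cells;
  \<^item> \<open>t_tilde T j X Y f\<close> is the 2-cell from \<open>f\<close> to its strengthening restricted along the unit;
  \<^item> \<open>t_hat T j k W X Y f g\<close>, for \<open>g : C\<^sub>0, \<dots>, JW, \<dots>, C\<^bsub>m-1\<^esub> \<rightarrow> TX\<close> with \<open>JW\<close> in position \<open>k\<close>,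
    is the 2-cell called t-hat at \<open>f, g\<close>;
  \<^item> \<open>str_nat T j X Y k f g\<close>, for \<open>k \<noteq> j\<close> and \<open>g : C\<^sub>0, \<dots>, C\<^bsub>m-1\<^esub> \<rightarrow> B\<^sub>k\<close>, is the
    pseudonaturality 2-cell from the strengthening of \<open>f \<circ>\<^sub>k g\<close> to the composite with \<open>g\<close> in
    position \<open>k\<close> of the strengthening of \<open>f\<close>.
\<close>

record ('p, 'o, 'm, 'c) strong_data =
  on_ob :: "'p \<Rightarrow> 'o"
  unit :: "'p \<Rightarrow> 'm"
  strength :: "nat \<Rightarrow> 'p \<Rightarrow> 'p \<Rightarrow> 'm \<Rightarrow> 'm"
  strength2 :: "nat \<Rightarrow> 'p \<Rightarrow> 'p \<Rightarrow> 'c \<Rightarrow> 'c"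
  str_nat :: "nat \<Rightarrow> 'p \<Rightarrow> 'p \<Rightarrow> nat \<Rightarrow> 'm \<Rightarrow> 'm \<Rightarrow> 'c"
  t_tilde :: "nat \<Rightarrow> 'p \<Rightarrow> 'p \<Rightarrow> 'm \<Rightarrow> 'c"
  t_hat :: "nat \<Rightarrow> nat \<Rightarrow> 'p \<Rightarrow> 'p \<Rightarrow> 'p \<Rightarrow> 'm \<Rightarrow> 'm \<Rightarrow> 'c"
  theta :: "'p \<Rightarrow> 'c"

locale strong_data_context =
  fixes D :: "('p, 'n, 'd, 'y) two_multicat_scheme"
    and C :: "('o, 'm, 'c, 'z) two_multicat_scheme" (structure)
    and J :: "('p, 'n, 'd, 'o, 'm, 'c, 'x) two_fun_scheme"
    and T :: "('p, 'o, 'm, 'c, 'w) strong_data_scheme"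
begin

abbreviation "JO \<equiv> on_obj J"
abbreviation "TO \<equiv> on_ob T"
abbreviation "i \<equiv> unit T"
abbreviation "str \<equiv> strength T"
abbreviation "str2 \<equiv> strength2 T"
abbreviation "nat_iso \<equiv> str_nat T"
abbreviation "tilde \<equiv> t_tilde T"
abbreviation "hat \<equiv> t_hat T"
abbreviation "arity f \<equiv> length (Dom C f)"

end

text \<open>
  Pseudonaturality of the strength in an argument \<open>B\<^sub>k\<close> is the structure \<open>str_nat\<close>: naturality
  in both variables, compatibility with identities, with nested substitution and with
  substitution in two different arguments. The families t-tilde and t-hat are natural
  for 2-cells and for substitution of multimorphisms in the remaining arguments.

  Pseudonaturality in the objects \<open>X\<close> and \<open>Y\<close> of \<open>D\<close> refers to the action of \<open>T\<close> on unary maps,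
  which sends \<open>u : X \<rightarrow> X'\<close> to the strengthening of \<open>i \<circ> Ju\<close>. Its structural 2-cells are
  built from t-tilde and t-hat (see \<open>str_nat_arg\<close> and \<open>str_nat_val\<close> below) and their
  coherence follows from the axioms of the locale, so that it contributes no further data.
\<close>

locale strong_relative_pseudomonad =
  strong_data_context D C J T + two_multicategory C + D: two_multicategory D +
  J: unary_two_functor D C J
  for D :: "('p, 'n, 'd, 'y) two_multicat_scheme"
    and C :: "('o, 'm, 'c, 'z) two_multicat_scheme" (structure)
    and J :: "('p, 'n, 'd, 'o, 'm, 'c, 'x) two_fun_scheme"
    and T :: "('p, 'o, 'm, 'c, 'w) strong_data_scheme" +
  assumes T_obj: "X \<in> Obj D \<Longrightarrow> TO X \<in> Obj C"
    and unit_hom: "X \<in> Obj D \<Longrightarrow> i X \<in> hom C [JO X] (TO X)"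
    and str_hom:
      "\<lbrakk>X \<in> Obj D; Y \<in> Obj D; f \<in> hom_at C j (JO X) (TO Y)\<rbrakk>
        \<Longrightarrow> str j X Y f \<in> hom C ((Dom C f)[j := TO X]) (TO Y)"
    and str2_cell:
      "\<lbrakk>X \<in> Obj D; Y \<in> Obj D; f \<in> hom_at C j (JO X) (TO Y); \<alpha> \<in> cells C f f'\<rbrakk>
        \<Longrightarrow> str2 j X Y \<alpha> \<in> cells C (str j X Y f) (str j X Y f')"
    and str2_cide:
      "\<lbrakk>X \<in> Obj D; Y \<in> Obj D; f \<in> hom_at C j (JO X) (TO Y)\<rbrakk>
        \<Longrightarrow> str2 j X Y (CIde C f) = CIde C (str j X Y f)"
    and str2_vcomp:
      "\<lbrakk>X \<in> Obj D; Y \<in> Obj D; f \<in> hom_at C j (JO X) (TO Y);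
        \<alpha> \<in> cells C f f'; \<beta> \<in> cells C f' f''\<rbrakk>
        \<Longrightarrow> str2 j X Y (\<beta> \<cdot> \<alpha>) = str2 j X Y \<beta> \<cdot> str2 j X Y \<alpha>"
    and nat_iso_cell:
      "\<lbrakk>X \<in> Obj D; Y \<in> Obj D; f \<in> hom_at C j (JO X) (TO Y); k < arity f; k \<noteq> j;
        g \<in> hom C Cs (Dom C f ! k)\<rbrakk>
        \<Longrightarrow> nat_iso j X Y k f g
            \<in> iso_cells C (str (shift k (arity g) j) X Y (f \<odot>[k] g)) (str j X Y f \<odot>[k] g)"
    and nat_iso_natural:
      "\<lbrakk>X \<in> Obj D; Y \<in> Obj D; f \<in> hom_at C j (JO X) (TO Y); k < arity f; k \<noteq> j;
        g \<in> hom C Cs (Dom C f ! k); \<alpha> \<in> cells C f f'; \<beta> \<in> cells C g g'\<rbrakk>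
        \<Longrightarrow> nat_iso j X Y k f' g' \<cdot> str2 (shift k (arity g) j) X Y (\<alpha> \<boxdot>[k] \<beta>)
            = (str2 j X Y \<alpha> \<boxdot>[k] \<beta>) \<cdot> nat_iso j X Y k f g"
    and nat_iso_ide:
      "\<lbrakk>X \<in> Obj D; Y \<in> Obj D; f \<in> hom_at C j (JO X) (TO Y); k < arity f; k \<noteq> j\<rbrakk>
        \<Longrightarrow> nat_iso j X Y k f (Ide C (Dom C f ! k)) = CIde C (str j X Y f)"
    and nat_iso_nested:
      "\<lbrakk>X \<in> Obj D; Y \<in> Obj D; f \<in> hom_at C j (JO X) (TO Y); k < arity f; k \<noteq> j;
        g \<in> hom C Cs (Dom C f ! k); l < arity g; h \<in> hom C Ds (Dom C g ! l)\<rbrakk>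
        \<Longrightarrow> nat_iso j X Y k f (g \<odot>[l] h)
            = (nat_iso j X Y k f g \<triangleleft>[k + l] h)
              \<cdot> nat_iso (shift k (arity g) j) X Y (k + l) (f \<odot>[k] g) h"
    and nat_iso_parallel:
      "\<lbrakk>X \<in> Obj D; Y \<in> Obj D; f \<in> hom_at C j (JO X) (TO Y); k < l; l < arity f; k \<noteq> j; l \<noteq> j;
        g \<in> hom C Cs (Dom C f ! k); h \<in> hom C Ds (Dom C f ! l)\<rbrakk>
        \<Longrightarrow> (nat_iso j X Y l f h \<triangleleft>[k] g) \<cdot> nat_iso (shift l (arity h) j) X Y k (f \<odot>[l] h) g
            = (nat_iso j X Y k f g \<triangleleft>[shift k (arity g) l] h)
              \<cdot> nat_iso (shift k (arity g) j) X Y (shift k (arity g) l) (f \<odot>[k] g) h"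
    and tilde_cell:
      "\<lbrakk>X \<in> Obj D; Y \<in> Obj D; f \<in> hom_at C j (JO X) (TO Y)\<rbrakk>
        \<Longrightarrow> tilde j X Y f \<in> iso_cells C f (str j X Y f \<odot>[j] i X)"
    and tilde_natural:
      "\<lbrakk>X \<in> Obj D; Y \<in> Obj D; f \<in> hom_at C j (JO X) (TO Y); \<alpha> \<in> cells C f f'\<rbrakk>
        \<Longrightarrow> tilde j X Y f' \<cdot> \<alpha> = (str2 j X Y \<alpha> \<triangleleft>[j] i X) \<cdot> tilde j X Y f"
    and tilde_subst:
      "\<lbrakk>X \<in> Obj D; Y \<in> Obj D; f \<in> hom_at C j (JO X) (TO Y); k < arity f; k \<noteq> j;
        g \<in> hom C Cs (Dom C f ! k)\<rbrakk>
        \<Longrightarrow> (nat_iso j X Y k f g \<triangleleft>[shift k (arity g) j] i X)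
              \<cdot> tilde (shift k (arity g) j) X Y (f \<odot>[k] g)
            = tilde j X Y f \<triangleleft>[k] g"
    and hat_cell:
      "\<lbrakk>W \<in> Obj D; X \<in> Obj D; Y \<in> Obj D;
        f \<in> hom_at C j (JO X) (TO Y); g \<in> hom_at C k (JO W) (TO X)\<rbrakk>
        \<Longrightarrow> hat j k W X Y f g
            \<in> iso_cells C (str (j + k) W Y (str j X Y f \<odot>[j] g)) (str j X Y f \<odot>[j] str k W X g)"
    and hat_natural:
      "\<lbrakk>W \<in> Obj D; X \<in> Obj D; Y \<in> Obj D;
        f \<in> hom_at C j (JO X) (TO Y); g \<in> hom_at C k (JO W) (TO X);
        \<alpha> \<in> cells C f f'; \<beta> \<in> cells C g g'\<rbrakk>
        \<Longrightarrow> hat j k W X Y f' g' \<cdot> str2 (j + k) W Y (str2 j X Y \<alpha> \<boxdot>[j] \<beta>)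
            = (str2 j X Y \<alpha> \<boxdot>[j] str2 k W X \<beta>) \<cdot> hat j k W X Y f g"
    and hat_subst_outer:
      "\<lbrakk>W \<in> Obj D; X \<in> Obj D; Y \<in> Obj D;
        f \<in> hom_at C j (JO X) (TO Y); g \<in> hom_at C k (JO W) (TO X);
        l < arity f; l \<noteq> j; h \<in> hom C Ds (Dom C f ! l)\<rbrakk>
        \<Longrightarrow> (nat_iso j X Y l f h \<triangleleft>[shift l (arity h) j] str k W X g)
              \<cdot> hat (shift l (arity h) j) k W X Y (f \<odot>[l] h) g
            = (hat j k W X Y f g \<triangleleft>[shift j (arity g) l] h)
              \<cdot> nat_iso (j + k) W Y (shift j (arity g) l) (str j X Y f \<odot>[j] g) h
              \<cdot> str2 (shift l (arity h) j + k) W Y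
                  (nat_iso j X Y l f h \<triangleleft>[shift l (arity h) j] g)"
    and hat_subst_inner:
      "\<lbrakk>W \<in> Obj D; X \<in> Obj D; Y \<in> Obj D;
        f \<in> hom_at C j (JO X) (TO Y); g \<in> hom_at C k (JO W) (TO X);
        l < arity g; l \<noteq> k; h \<in> hom C Ds (Dom C g ! l)\<rbrakk>
        \<Longrightarrow> (str j X Y f \<triangleright>[j] nat_iso k W X l g h)
              \<cdot> hat j (shift l (arity h) k) W X Y f (g \<odot>[l] h)
            = (hat j k W X Y f g \<triangleleft>[j + l] h)
              \<cdot> nat_iso (j + k) W Y (j + l) (str j X Y f \<odot>[j] g) h"
    and theta_cell: "X \<in> Obj D \<Longrightarrow> theta T X \<in> iso_cells C (str 0 X X (i X)) (Ide C (TO X))"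
    and hat_assoc:
      "\<lbrakk>V \<in> Obj D; W \<in> Obj D; X \<in> Obj D; Y \<in> Obj D; f \<in> hom_at C j (JO X) (TO Y);
        g \<in> hom_at C k (JO W) (TO X); h \<in> hom_at C l (JO V) (TO W)\<rbrakk>
        \<Longrightarrow> (hat j k W X Y f g \<triangleleft>[j + k] str l V W h)
              \<cdot> hat (j + k) l V W Y (str j X Y f \<odot>[j] g) h
            = (str j X Y f \<triangleright>[j] hat k l V W X g h)
              \<cdot> hat j (k + l) V X Y f (str k W X g \<odot>[k] h)
              \<cdot> str2 (j + k + l) V Y (hat j k W X Y f g \<triangleleft>[j + k] h)"
    and hat_unit:
      "\<lbrakk>X \<in> Obj D; Y \<in> Obj D; f \<in> hom_at C j (JO X) (TO Y)\<rbrakk>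
        \<Longrightarrow> (str j X Y f \<triangleright>[j] theta T X) \<cdot> hat j 0 X X Y f (i X) \<cdot> str2 j X Y (tilde j X Y f)
            = CIde C (str j X Y f)"

text \<open>
  \<open>\<tau> j X Y f\<close> is the counit component \<open>(f \<circ>\<^sub>j i)\<^sup>t \<Rightarrow> f\<close> at \<open>f : B\<^sub>0, \<dots>, TX, \<dots>, B\<^bsub>n-1\<^esub> \<rightarrow> TY\<close>.
\<close>

locale lax_idempotent_strong_relative_pseudomonad =
  strong_relative_pseudomonad D C J T
  for D :: "('p, 'n, 'd, 'y) two_multicat_scheme"
    and C :: "('o, 'm, 'c, 'z) two_multicat_scheme" (structure)
    and J :: "('p, 'n, 'd, 'o, 'm, 'c, 'x) two_fun_scheme"
    and T :: "('p, 'o, 'm, 'c, 'w) strong_data_scheme" +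
  fixes \<tau> :: "nat \<Rightarrow> 'p \<Rightarrow> 'p \<Rightarrow> 'm \<Rightarrow> 'c"
  assumes counit_cell:
      "\<lbrakk>X \<in> Obj D; Y \<in> Obj D; f \<in> hom_at C j (TO X) (TO Y)\<rbrakk>
        \<Longrightarrow> \<tau> j X Y f \<in> cells C (str j X Y (f \<odot>[j] i X)) f"
    and counit_natural:
      "\<lbrakk>X \<in> Obj D; Y \<in> Obj D; f \<in> hom_at C j (TO X) (TO Y); \<alpha> \<in> cells C f f'\<rbrakk>
        \<Longrightarrow> \<tau> j X Y f' \<cdot> str2 j X Y (\<alpha> \<triangleleft>[j] i X) = \<alpha> \<cdot> \<tau> j X Y f"
    and triangle_str:
      "\<lbrakk>X \<in> Obj D; Y \<in> Obj D; f \<in> hom_at C j (JO X) (TO Y)\<rbrakk>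
        \<Longrightarrow> \<tau> j X Y (str j X Y f) \<cdot> str2 j X Y (tilde j X Y f) = CIde C (str j X Y f)"
    and triangle_unit:
      "\<lbrakk>X \<in> Obj D; Y \<in> Obj D; f \<in> hom_at C j (TO X) (TO Y)\<rbrakk>
        \<Longrightarrow> (\<tau> j X Y f \<triangleleft>[j] i X) \<cdot> tilde j X Y (f \<odot>[j] i X) = CIde C (f \<odot>[j] i X)"


section \<open>Pseudocommutativity\<close>

context strong_data_context
begin

abbreviation T_map :: "'p \<Rightarrow> 'p \<Rightarrow> 'n \<Rightarrow> 'm" where
  "T_map X' X u \<equiv> str 0 X' X (i X \<odot>[0] on_mor J u)"

text \<open>
  Pseudonaturality of the strength in its argument \<open>X\<close> and in its value \<open>Y\<close>:
  \<open>(f \<circ>\<^sub>j Ju)\<^sup>t \<Rightarrow> (f\<^sup>t \<circ>\<^sub>j i \<circ> Ju)\<^sup>t \<Rightarrow> f\<^sup>t \<circ>\<^sub>j Tu\<close> for \<open>u : X' \<rightarrow> X\<close>, and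
  \<open>(Tv \<circ> f)\<^sup>t \<Rightarrow> Tv \<circ> f\<^sup>t\<close> for \<open>v : Y \<rightarrow> Y'\<close>.
\<close>

abbreviation str_nat_arg :: "nat \<Rightarrow> 'p \<Rightarrow> 'p \<Rightarrow> 'p \<Rightarrow> 'm \<Rightarrow> 'n \<Rightarrow> 'c" where
  "str_nat_arg j X' X Y f u \<equiv>
     hat j 0 X' X Y f (i X \<odot>[0] on_mor J u) \<cdot> str2 j X' Y (tilde j X Y f \<triangleleft>[j] on_mor J u)"

abbreviation str_nat_val :: "nat \<Rightarrow> 'p \<Rightarrow> 'p \<Rightarrow> 'p \<Rightarrow> 'n \<Rightarrow> 'm \<Rightarrow> 'c" where
  "str_nat_val j X Y Y' v f \<equiv> hat 0 j X Y Y' (i Y' \<odot>[0] on_mor J v) f"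

end

text \<open>
  \<open>bihom C j A k B Y\<close>: multimorphisms to \<open>Y\<close> with \<open>A\<close> in position \<open>j\<close> and \<open>B\<close> in position
  \<open>k > j\<close>. In \<open>\<gamma> j k X Y Z f\<close> the strengthening \<open>s\<close> is the one in position \<open>j\<close> (object \<open>JX\<close>) and
  \<open>t\<close> the one in position \<open>k\<close> (object \<open>JY\<close>).
\<close>

definition bihom ::
  "('o, 'm, 'c, 'z) two_multicat_scheme \<Rightarrow> nat \<Rightarrow> 'o \<Rightarrow> nat \<Rightarrow> 'o \<Rightarrow> 'o \<Rightarrow> 'm set" where
  "bihom C j A k B Y = (if j < k then hom_at C j A Y \<inter> hom_at C k B Y else {})"

locale pseudocommutativity =
  strong_relative_pseudomonad D C J T
  for D :: "('p, 'n, 'd, 'y) two_multicat_scheme"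
    and C :: "('o, 'm, 'c, 'z) two_multicat_scheme" (structure)
    and J :: "('p, 'n, 'd, 'o, 'm, 'c, 'x) two_fun_scheme"
    and T :: "('p, 'o, 'm, 'c, 'w) strong_data_scheme" +
  fixes \<gamma> :: "nat \<Rightarrow> nat \<Rightarrow> 'p \<Rightarrow> 'p \<Rightarrow> 'p \<Rightarrow> 'm \<Rightarrow> 'c"
  assumes gamma_cell:
      "\<lbrakk>X \<in> Obj D; Y \<in> Obj D; Z \<in> Obj D; f \<in> bihom C j (JO X) k (JO Y) (TO Z)\<rbrakk>
        \<Longrightarrow> \<gamma> j k X Y Z f
            \<in> iso_cells C (str j X Z (str k Y Z f)) (str k Y Z (str j X Z f))"
    and gamma_natural:
      "\<lbrakk>X \<in> Obj D; Y \<in> Obj D; Z \<in> Obj D; f \<in> bihom C j (JO X) k (JO Y) (TO Z);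
        \<alpha> \<in> cells C f f'\<rbrakk>
        \<Longrightarrow> \<gamma> j k X Y Z f' \<cdot> str2 j X Z (str2 k Y Z \<alpha>)
            = str2 k Y Z (str2 j X Z \<alpha>) \<cdot> \<gamma> j k X Y Z f"
    and gamma_subst:
      "\<lbrakk>X \<in> Obj D; Y \<in> Obj D; Z \<in> Obj D; f \<in> bihom C j (JO X) k (JO Y) (TO Z);
        l < arity f; l \<noteq> j; l \<noteq> k; g \<in> hom C Cs (Dom C f ! l);
        j' = shift l (arity g) j; k' = shift l (arity g) k\<rbrakk>
        \<Longrightarrow> nat_iso k Y Z l (str j X Z f) g \<cdot> str2 k' Y Z (nat_iso j X Z l f g)
              \<cdot> \<gamma> j' k' X Y Z (f \<odot>[l] g)
            = (\<gamma> j k X Y Z f \<triangleleft>[l] g)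
              \<cdot> nat_iso j X Z l (str k Y Z f) g \<cdot> str2 j' X Z (nat_iso k Y Z l f g)"
    and gamma_nat_X:
      "\<lbrakk>X \<in> Obj D; Y \<in> Obj D; Z \<in> Obj D; f \<in> bihom C j (JO X) k (JO Y) (TO Z);
        u \<in> hom D [X'] X\<rbrakk>
        \<Longrightarrow> nat_iso k Y Z j (str j X Z f) (T_map X' X u) \<cdot> str2 k Y Z (str_nat_arg j X' X Z f u)
              \<cdot> \<gamma> j k X' Y Z (f \<odot>[j] on_mor J u)
            = (\<gamma> j k X Y Z f \<triangleleft>[j] T_map X' X u)
              \<cdot> str_nat_arg j X' X Z (str k Y Z f) u \<cdot> str2 j X' Z (nat_iso k Y Z j f (on_mor J u))"
    and gamma_nat_Y:
      "\<lbrakk>X \<in> Obj D; Y \<in> Obj D; Z \<in> Obj D; f \<in> bihom C j (JO X) k (JO Y) (TO Z);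
        u \<in> hom D [Y'] Y\<rbrakk>
        \<Longrightarrow> str_nat_arg k Y' Y Z (str j X Z f) u \<cdot> str2 k Y' Z (nat_iso j X Z k f (on_mor J u))
              \<cdot> \<gamma> j k X Y' Z (f \<odot>[k] on_mor J u)
            = (\<gamma> j k X Y Z f \<triangleleft>[k] T_map Y' Y u)
              \<cdot> nat_iso j X Z k (str k Y Z f) (T_map Y' Y u) \<cdot> str2 j X Z (str_nat_arg k Y' Y Z f u)"
    and gamma_nat_Z:
      "\<lbrakk>X \<in> Obj D; Y \<in> Obj D; Z \<in> Obj D; f \<in> bihom C j (JO X) k (JO Y) (TO Z);
        v \<in> hom D [Z] Z'\<rbrakk>
        \<Longrightarrow> str_nat_val k Y Z Z' v (str j X Z f) \<cdot> str2 k Y Z' (str_nat_val j X Z Z' v f)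
              \<cdot> \<gamma> j k X Y Z' (T_map Z Z' v \<odot>[0] f)
            = (T_map Z Z' v \<triangleright>[0] \<gamma> j k X Y Z f)
              \<cdot> str_nat_val j X Z Z' v (str k Y Z f) \<cdot> str2 j X Z' (str_nat_val k Y Z Z' v f)"
    and gamma_tilde_s:
      "\<lbrakk>X \<in> Obj D; Y \<in> Obj D; Z \<in> Obj D; f \<in> bihom C j (JO X) k (JO Y) (TO Z)\<rbrakk>
        \<Longrightarrow> inv_cell C (nat_iso k Y Z j (str j X Z f) (i X))
              \<cdot> (\<gamma> j k X Y Z f \<triangleleft>[j] i X) \<cdot> tilde j X Z (str k Y Z f)
            = str2 k Y Z (tilde j X Z f)"
    and gamma_tilde_t:
      "\<lbrakk>X \<in> Obj D; Y \<in> Obj D; Z \<in> Obj D; f \<in> bihom C j (JO X) k (JO Y) (TO Z)\<rbrakk>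
        \<Longrightarrow> (\<gamma> j k X Y Z f \<triangleleft>[k] i Y)
              \<cdot> nat_iso j X Z k (str k Y Z f) (i Y) \<cdot> str2 j X Z (tilde k Y Z f)
            = tilde k Y Z (str j X Z f)"
    and gamma_hat_s:
      "\<lbrakk>W \<in> Obj D; X \<in> Obj D; Y \<in> Obj D; Z \<in> Obj D;
        f \<in> bihom C j (JO X) k (JO Y) (TO Z); g \<in> hom_at C l (JO W) (TO X);
        k' = shift j (arity g) k\<rbrakk>
        \<Longrightarrow> inv_cell C (nat_iso k Y Z j (str j X Z f) (str l W X g))
              \<cdot> (\<gamma> j k X Y Z f \<triangleleft>[j] str l W X g) \<cdot> hat j l W X Z (str k Y Z f) g
            = str2 k' Y Z (hat j l W X Z f g)
              \<cdot> \<gamma> (j + l) k' W Y Z (str j X Z f \<odot>[j] g)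
              \<cdot> str2 (j + l) W Z (inv_cell C (nat_iso k Y Z j (str j X Z f) g))
              \<cdot> str2 (j + l) W Z (\<gamma> j k X Y Z f \<triangleleft>[j] g)"
    and gamma_hat_t:
      "\<lbrakk>V \<in> Obj D; X \<in> Obj D; Y \<in> Obj D; Z \<in> Obj D;
        f \<in> bihom C j (JO X) k (JO Y) (TO Z); h \<in> hom_at C l (JO V) (TO Y)\<rbrakk>
        \<Longrightarrow> (\<gamma> j k X Y Z f \<triangleleft>[k] str l V Y h)
              \<cdot> nat_iso j X Z k (str k Y Z f) (str l V Y h) \<cdot> str2 j X Z (hat k l V Y Z f h)
            = hat k l V Y Z (str j X Z f) h
              \<cdot> str2 (k + l) V Z (\<gamma> j k X Y Z f \<triangleleft>[k] h)
              \<cdot> str2 (k + l) V Z (nat_iso j X Z k (str k Y Z f) h)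
              \<cdot> \<gamma> j (k + l) X V Z (str k Y Z f \<odot>[k] h)"
    and gamma_braid:
      "\<lbrakk>W \<in> Obj D; X \<in> Obj D; Y \<in> Obj D; Z \<in> Obj D;
        f \<in> bihom C j (JO W) k (JO X) (TO Z); f \<in> bihom C k (JO X) l (JO Y) (TO Z)\<rbrakk>
        \<Longrightarrow> str2 l Y Z (\<gamma> j k W X Z f) \<cdot> \<gamma> j l W Y Z (str k X Z f)
              \<cdot> str2 j W Z (\<gamma> k l X Y Z f)
            = \<gamma> k l X Y Z (str j W Z f) \<cdot> str2 k X Z (\<gamma> j l W Y Z f)
              \<cdot> \<gamma> j k W X Z (str l Y Z f)"

end

theory Submission
  imports Defs
begin

text \<open>
  The adjunction \<open>(-)\<^sup>s \<stileturn> - \<circ>\<^sub>s i\<close> makes a 2-cell \<open>\<alpha> : f\<^sup>s \<Rightarrow> h\<close> determined by its transpose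
  \<open>(\<alpha> \<circ>\<^sub>s i) \<cdot> s-tilde\<close>, called \<open>restr \<alpha>\<close> below. The transpose of \<open>\<gamma>\<^sub>f\<close> is the strengthening of
  s-tilde followed by a pseudonaturality 2-cell, and the transpose of t-hat at \<open>f, g\<close> is \<open>f\<^sup>t \<circ> t-tilde\<^sub>g\<close>;
  transposing both sides of an axiom for \<open>\<gamma>\<close> reduces it to a coherence axiom of the strength. The
  formula for \<open>\<gamma>\<close> makes sense for any two distinct positions, and \<open>\<gamma>\<close> with the positions exchanged is
  its inverse, because transposing twice turns both composites into the same 2-cell.
\<close>

text \<open>The adjunction enters through two facts: \<open>str_ext\<close>, by which a 2-cell out
  of a strengthening is determined by its transpose, and \<open>restr_gam\<close>, which computes
  the transpose of \<open>gam\<close>. The rest is calculation in the strong structure, for which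
  the transposes of its constituents must be known. For t-hat this is not an axiom: the axioms tie
  it to the unit only through theta, and \<open>hat_tilde\<close> has to be extracted from them
  first. Transposing in position \<open>j\<close> replaces the outer strengthening by substitution
  of the unit. What is then needed is usually a law for substituting the unit into something
  strengthened in the other position: in a parallel argument, in an outer or inner argument of
  t-hat, or nested inside a composite. For the condition on three arguments it is the compatibility
  of gamma itself with that substitution. The order of the two positions is given up because the
  inverse of gamma is gamma with the positions exchanged. A substitution may then move either
  position, which is why \<open>shift\<close> also occurs where \<open>j < k\<close> would make it
  trivial.\<close>

section \<open>Partial composition in multicategories\<close>

text \<open>Partial composition obeys the same laws for multimorphisms and for 2-cells: under
  \<open>HComp\<close> the 2-cells of a 2-multicategory again form a multicategory on the same
  objects, a 2-cell being typed by its source. Isolating this structure lets each law be proved once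
  and read off for both \<odot> and \<boxdot>.\<close>

locale multicategory =
  fixes Ob :: "'o set" and M :: "'m set" and dm :: "'m \<Rightarrow> 'o list" and cd :: "'m \<Rightarrow> 'o"
    and unt :: "'o \<Rightarrow> 'm" and cmp :: "'m \<Rightarrow> 'm list \<Rightarrow> 'm"
  assumes dm_ob: "f \<in> M \<Longrightarrow> set (dm f) \<subseteq> Ob"
    and cd_ob: "f \<in> M \<Longrightarrow> cd f \<in> Ob"
    and unt_type: "X \<in> Ob \<Longrightarrow> unt X \<in> M \<and> dm (unt X) = [X] \<and> cd (unt X) = X"
    and cmp_type: "\<lbrakk>f \<in> M; set gs \<subseteq> M; map cd gs = dm f\<rbrakk>
      \<Longrightarrow> cmp f gs \<in> M \<and> dm (cmp f gs) = concat (map dm gs) \<and> cd (cmp f gs) = cd f"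
    and cmp_unt_left: "f \<in> M \<Longrightarrow> cmp (unt (cd f)) [f] = f"
    and cmp_unt_right: "f \<in> M \<Longrightarrow> cmp f (map unt (dm f)) = f"
    and cmp_assoc: "\<lbrakk>f \<in> M; set gs \<subseteq> M; map cd gs = dm f;
        list_all2 (\<lambda>g hs. g \<in> M \<and> set hs \<subseteq> M \<and> map cd hs = dm g) gs hss\<rbrakk>
      \<Longrightarrow> cmp (cmp f gs) (concat hss) = cmp f (map2 cmp gs hss)"
begin

definition pcmp :: "'m \<Rightarrow> nat \<Rightarrow> 'm \<Rightarrow> 'm" where
  "pcmp f j g = cmp f ((map unt (dm f))[j := g])"

lemma unit_unit: "X \<in> Ob \<Longrightarrow> cmp (unt X) [unt X] = unt X"
  using cmp_unt_left[of "unt X"] unt_type by auto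

text \<open>A partial composite is a full composite padded with identities. These are the side
  conditions and the results of \<open>cmp_assoc\<close> on such blocks of padding.\<close>

lemma unit_list:
  assumes "set xs \<subseteq> Ob"
  shows "map cd (map unt xs) = xs" "\<And>x. x \<in> set xs \<Longrightarrow> unt x \<in> M" "concat (map dm (map unt xs)) = xs"
    "list_all2 (\<lambda>g hs. g \<in> M \<and> set hs \<subseteq> M \<and> map cd hs = dm g) (map unt xs) (map (\<lambda>X. [unt X]) xs)"
    "concat (map (\<lambda>X. [unt X]) xs) = map unt xs"
    "map2 cmp (map unt xs) (map (\<lambda>X. [unt X]) xs) = map unt xs"
  using assms by (induction xs) (auto simp: unt_type unit_unit)

text \<open>Cutting the domain at the substituted argument turns the list update in
  \<open>pcmp\<close> into a concatenation, the shape \<open>cmp_assoc\<close> asks for; the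
  position becomes the length of the prefix.\<close>

lemma pcmp_split:
  assumes "f \<in> M" "dm f = xs @ cd g # ys" "g \<in> M"
  shows "pcmp f (length xs) g = cmp f (map unt xs @ g # map unt ys)"
    "pcmp f (length xs) g \<in> M" "dm (pcmp f (length xs) g) = xs @ dm g @ ys"
    "cd (pcmp f (length xs) g) = cd f"
proof -
  show e: "pcmp f (length xs) g = cmp f (map unt xs @ g # map unt ys)"
    unfolding pcmp_def using assms by (simp add: list_update_append)
  have o: "set xs \<subseteq> Ob" "set ys \<subseteq> Ob" using dm_ob[OF assms(1)] assms(2) by auto
  have "cmp f (map unt xs @ g # map unt ys) \<in> M \<and>
     dm (cmp f (map unt xs @ g # map unt ys)) = concat (map dm (map unt xs @ g # map unt ys)) \<and>
     cd (cmp f (map unt xs @ g # map unt ys)) = cd f"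
    using assms unit_list[OF o(1)] unit_list[OF o(2)] by (intro cmp_type) auto
  then show "pcmp f (length xs) g \<in> M" "dm (pcmp f (length xs) g) = xs @ dm g @ ys"
    "cd (pcmp f (length xs) g) = cd f"
    using e unit_list(3)[OF o(1)] unit_list(3)[OF o(2)] by auto
qed

lemma split_dm:
  assumes "j < length xs" "xs ! j = A"
  obtains us vs where "xs = us @ A # vs" "length us = j"
  using id_take_nth_drop[OF assms(1)] assms that[of "take j xs" "drop (Suc j) xs"] by auto

lemma pcmp_type:
  assumes "f \<in> M" "j < length (dm f)" "dm f ! j = cd g" "g \<in> M"
  shows "pcmp f j g \<in> M" "dm (pcmp f j g) = take j (dm f) @ dm g @ drop (Suc j) (dm f)"
    "cd (pcmp f j g) = cd f"
proof -
  obtain xs ys where e: "dm f = xs @ cd g # ys" "length xs = j" by (rule split_dm[OF assms(2,3)])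
  show "pcmp f j g \<in> M" "dm (pcmp f j g) = take j (dm f) @ dm g @ drop (Suc j) (dm f)"
    "cd (pcmp f j g) = cd f"
    using pcmp_split[OF assms(1) e(1) assms(4)] e by auto
qed

lemma pcmp_nested:
  assumes f: "f \<in> M" "j < length (dm f)" "dm f ! j = cd g"
    and g: "g \<in> M" "l < length (dm g)" "dm g ! l = cd h" and h: "h \<in> M"
  shows "pcmp f j (pcmp g l h) = pcmp (pcmp f j g) (j + l) h"
proof -
  obtain xs ys where fe: "dm f = xs @ cd g # ys" "length xs = j" by (rule split_dm[OF f(2,3)])
  obtain us vs where ge: "dm g = us @ cd h # vs" "length us = l" by (rule split_dm[OF g(2,3)])
  note fg = pcmp_split[OF f(1) fe(1) g(1)]
  note gh = pcmp_split[OF g(1) ge(1) h]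
  have o: "set xs \<subseteq> Ob" "set ys \<subseteq> Ob" "set us \<subseteq> Ob" "set vs \<subseteq> Ob"
    using dm_ob[OF f(1)] fe(1) dm_ob[OF g(1)] ge(1) by auto
  note u = unit_list[OF o(1)] unit_list[OF o(2)] unit_list[OF o(3)] unit_list[OF o(4)]
  let ?gs = "map unt xs @ g # map unt ys"
  \<comment> \<open>The second layer substitutes \<open>h\<close> into \<open>g\<close> and single
    identities everywhere else, so one use of associativity is enough.\<close>
  let ?hss = "map (\<lambda>X. [unt X]) xs @ (map unt us @ h # map unt vs) # map (\<lambda>X. [unt X]) ys"
  have "pcmp (pcmp f j g) (length (xs @ us)) h
      = cmp (pcmp f j g) (map unt (xs @ us) @ h # map unt (vs @ ys))"
    using fg fe ge h by (intro pcmp_split(1)) auto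
  also have "\<dots> = cmp (cmp f ?gs) (concat ?hss)"
    using fg(1) fe u by simp
  also have "\<dots> = cmp f (map2 cmp ?gs ?hss)"
    using f g h fe ge u by (intro cmp_assoc) (auto intro!: list_all2_appendI)
  also have "map2 cmp ?gs ?hss = map unt xs @ pcmp g l h # map unt ys"
    using gh(1) ge u by simp
  also have "cmp f \<dots> = pcmp f j (pcmp g l h)"
    using pcmp_split(1)[of f xs "pcmp g l h" ys] f fe gh ge by simp
  finally show ?thesis using fe ge by simp
qed

lemma pcmp_parallel_less:
  assumes f: "f \<in> M" "j < k" "k < length (dm f)" "dm f ! j = cd g" "dm f ! k = cd h"
    and g: "g \<in> M" and h: "h \<in> M"
  shows "pcmp (pcmp f k h) j g = pcmp (pcmp f j g) (k + length (dm g) - 1) h"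
proof -
  obtain xs rs where fe: "dm f = xs @ cd g # rs" "length xs = j" 
    by (rule split_dm[of j "dm f" "cd g"]) (use f in auto)
  obtain ys zs where re: "rs = ys @ cd h # zs" "length ys = k - Suc j"
    by (rule split_dm[of "k - Suc j" rs "cd h"]) (use f fe in \<open>auto simp: nth_append\<close>)
  have ke: "k = length (xs @ cd g # ys)" using fe re f by auto
  have fe1: "dm f = xs @ cd g # (ys @ cd h # zs)" and fe2: "dm f = (xs @ cd g # ys) @ cd h # zs"
    using fe re by auto
  note fg = pcmp_split[OF f(1) fe1 g]
  note fh = pcmp_split[OF f(1) fe2 h]
  have o: "set xs \<subseteq> Ob" "set ys \<subseteq> Ob" "set zs \<subseteq> Ob" "cd g \<in> Ob" "set (dm g) \<subseteq> Ob" "cd h \<in> Ob"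
     "set (dm h) \<subseteq> Ob"
    using dm_ob[OF f(1)] fe1 dm_ob g h by auto
  note u = unit_list[OF o(1)] unit_list[OF o(2)] unit_list[OF o(3)] unit_list[OF o(5)] unit_list[OF o(7)]
    cmp_unt_left[OF g] cmp_unt_left[OF h] cmp_unt_right[OF g] cmp_unt_right[OF h]
    unt_type[OF o(4)] unt_type[OF o(6)]
  let ?s = "\<lambda>X. [unt X]"
  \<comment> \<open>Two factorisations of one composite: the layer \<open>?gs\<close> performs
    \<open>h\<close> and leaves \<open>g\<close> to \<open>?hss\<close>, while \<open>?gs'\<close>
    performs \<open>g\<close> and leaves \<open>h\<close> to \<open>?hss'\<close>. Entrywise both
    give the same list, since identities cancel on the left and on the right of \<open>g\<close> and
    of \<open>h\<close>.\<close>
  let ?gs = "map unt xs @ unt (cd g) # map unt ys @ h # map unt zs"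
  let ?gs' = "map unt xs @ g # map unt ys @ unt (cd h) # map unt zs"
  let ?hss = "map ?s xs @ [g] # map ?s ys @ map unt (dm h) # map ?s zs"
  let ?hss' = "map ?s xs @ map unt (dm g) # map ?s ys @ [h] # map ?s zs"
  have "pcmp (pcmp f k h) (length xs) g
      = cmp (pcmp f k h) (map unt xs @ g # map unt (ys @ dm h @ zs))"
    using fh ke g by (intro pcmp_split(1)) auto
  also have "\<dots> = cmp (cmp f ?gs) (concat ?hss)"
    using fh(1) ke u by simp
  also have "\<dots> = cmp f (map2 cmp ?gs ?hss)"
    using f g h fe1 u by (intro cmp_assoc) (auto intro!: list_all2_appendI)
  also have "map2 cmp ?gs ?hss = map2 cmp ?gs' ?hss'"
    using u by simp
  also have "cmp f \<dots> = cmp (cmp f ?gs') (concat ?hss')"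
    using f g h fe1 u by (intro cmp_assoc[symmetric]) (auto intro!: list_all2_appendI)
  also have "\<dots> = cmp (pcmp f j g) (map unt (xs @ dm g @ ys) @ h # map unt zs)"
    using fg(1) fe u by simp
  also have "\<dots> = pcmp (pcmp f j g) (length (xs @ dm g @ ys)) h"
    using fg fe h by (intro pcmp_split(1)[symmetric]) auto
  \<comment> \<open>As \<open>j < k\<close>, the position \<open>k\<close> is positive, so the
    truncated subtraction is exact even for a \<open>g\<close> without arguments.\<close>
  also have "length (xs @ dm g @ ys) = k + length (dm g) - 1"
    using ke by simp
  finally show ?thesis using fe by simp
qed

text \<open>\<open>shift\<close> fixes positions to the left of a substitution and moves those to
  the right, so both orders of \<open>j\<close> and \<open>k\<close> are instances of one symmetric
  equation. This is what later allows positions to be merely distinct.\<close>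

lemma pcmp_parallel:
  assumes "f \<in> M" "j < length (dm f)" "k < length (dm f)" "j \<noteq> k" "dm f ! j = cd g" "dm f ! k = cd h"
    "g \<in> M" "h \<in> M"
  shows "pcmp (pcmp f j g) (shift j (length (dm g)) k) h
    = pcmp (pcmp f k h) (shift k (length (dm h)) j) g"
  using pcmp_parallel_less[of f j k g h] pcmp_parallel_less[of f k j h g] assms
  by (cases "j < k") (auto simp: shift_def)

end

text \<open>Units, maps \<open>J u\<close> and maps \<open>T u\<close> are unary and move no
  position; with this rule the index arithmetic disappears for substitutions along them.\<close>

lemma shift_one [simp]: "shift k (Suc 0) j = j"
  by (simp add: shift_def)

lemma shift_neq: "\<lbrakk>j \<noteq> k; j \<noteq> l; k \<noteq> l\<rbrakk> \<Longrightarrow> shift l m j \<noteq> shift l m k"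
  by (auto simp: shift_def)

section \<open>The calculus of 2-cells: whiskering, interchange and inverses\<close>

context two_multicategory
begin

lemma multicategory_mor: "multicategory (Obj C) (Mor C) (Dom C) (Cod C) (Ide C) (Comp C)"
proof
  show "Comp C (Comp C f gs) (concat hss) = Comp C f (map2 (Comp C) gs hss)"
    if "f \<in> Mor C" "set gs \<subseteq> Mor C" "map (Cod C) gs = Dom C f"
      "list_all2 (\<lambda>g hs. g \<in> Mor C \<and> set hs \<subseteq> Mor C \<and> map (Cod C) hs = Dom C g) gs hss" for f gs hss
    using comp_assoc[of f gs hss] that unfolding composable_def by simp
qed (use dom_obj cod_obj ide_hom comp_hom comp_ide_left comp_ide_right in \<open>auto simp: hom_def composable_def\<close>)

lemma composable_cells_iff:
  "composable_cells C \<alpha> \<beta>s \<longleftrightarrow>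
    \<alpha> \<in> Cell C \<and> set \<beta>s \<subseteq> Cell C \<and> map (\<lambda>\<beta>. Cod C (Src C \<beta>)) \<beta>s = Dom C (Src C \<alpha>)"
  using src_mor by (auto simp: composable_cells_def composable_def comp_def)

lemma multicategory_cell:
  "multicategory (Obj C) (Cell C) (\<lambda>\<alpha>. Dom C (Src C \<alpha>)) (\<lambda>\<alpha>. Cod C (Src C \<alpha>))
     (\<lambda>X. CIde C (Ide C X)) (HComp C)"
proof
  show "HComp C (HComp C f gs) (concat hss) = HComp C f (map2 (HComp C) gs hss)"
    if "f \<in> Cell C" "set gs \<subseteq> Cell C" "map (\<lambda>\<alpha>. Cod C (Src C \<alpha>)) gs = Dom C (Src C f)"
      "list_all2 (\<lambda>g hs. g \<in> Cell C \<and> set hs \<subseteq> Cell C \<and>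
         map (\<lambda>\<alpha>. Cod C (Src C \<alpha>)) hs = Dom C (Src C g)) gs hss" for f gs hss
    using hcomp_assoc[of f gs hss] that
    by (simp add: composable_cells_iff cong: list.rel_cong)
next
  fix f gs
  assume h: "f \<in> Cell C" "set gs \<subseteq> Cell C" "map (\<lambda>\<alpha>. Cod C (Src C \<alpha>)) gs = Dom C (Src C f)"
  then have c: "composable_cells C f gs" by (simp add: composable_cells_iff)
  then have "composable C (Src C f) (map (Src C) gs)" by (simp add: composable_cells_def)
  from comp_hom[OF this] hcomp_cell[OF c] h
  show "HComp C f gs \<in> Cell C \<and> Dom C (Src C (HComp C f gs)) = concat (map (\<lambda>\<alpha>. Dom C (Src C \<alpha>)) gs)
    \<and> Cod C (Src C (HComp C f gs)) = Cod C (Src C f)"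
    by (simp add: cells_def hom_def comp_def)
qed (use dom_obj cod_obj ide_hom src_mor cide_cell hcomp_ide_left hcomp_ide_right
    in \<open>auto simp: hom_def cells_def\<close>)

interpretation mm: multicategory "Obj C" "Mor C" "Dom C" "Cod C" "Ide C" "Comp C"
  by (rule multicategory_mor)

interpretation cc: multicategory "Obj C" "Cell C" "\<lambda>\<alpha>. Dom C (Src C \<alpha>)" "\<lambda>\<alpha>. Cod C (Src C \<alpha>)"
  "\<lambda>X. CIde C (Ide C X)" "HComp C"
  by (rule multicategory_cell)

lemma mm_pcmp: "mm.pcmp = pcomp C"
  by (intro ext) (simp add: mm.pcmp_def pcomp_def)

lemma cc_pcmp: "cc.pcmp = pcell C"
  by (intro ext) (simp add: cc.pcmp_def pcell_def)

lemma cellsD: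
  assumes "\<alpha> \<in> cells C f g"
  shows "\<alpha> \<in> Cell C" "Src C \<alpha> = f" "Tgt C \<alpha> = g" "f \<in> Mor C" "g \<in> Mor C"
    "Dom C g = Dom C f" "Cod C g = Cod C f"
  using assms src_mor tgt_mor cell_parallel by (auto simp: cells_def)

lemma hom_atD:
  assumes "f \<in> hom_at C j A Y"
  shows "f \<in> Mor C" "j < length (Dom C f)" "Dom C f ! j = A" "Cod C f = Y"
  using assms by (auto simp: hom_at_def)

lemma cells_hom_at:
  "\<lbrakk>\<alpha> \<in> cells C f g; f \<in> hom_at C j A Y\<rbrakk> \<Longrightarrow> g \<in> hom_at C j A Y"
  using cellsD by (auto simp: hom_at_def)

lemma pcomp_type:
  assumes "f \<in> hom_at C j (Cod C g) Y" "g \<in> Mor C"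
  shows "f \<odot>[j] g \<in> Mor C" "Dom C (f \<odot>[j] g) = take j (Dom C f) @ Dom C g @ drop (Suc j) (Dom C f)"
    "Cod C (f \<odot>[j] g) = Y"
  using mm.pcmp_type[of f j g] assms by (auto simp: mm_pcmp hom_at_def)

lemma pcomp_hom_at_inner:
  assumes "f \<in> hom_at C j A Y" "g \<in> hom_at C l B A"
  shows "f \<odot>[j] g \<in> hom_at C (j + l) B Y"
  using pcomp_type[of f j g Y] assms by (auto simp: hom_at_def nth_append)

lemma pcomp_hom_at_outer:
  assumes "f \<in> hom_at C j (Cod C g) Y" "f \<in> hom_at C k B Y" "j \<noteq> k" "g \<in> Mor C"
  shows "f \<odot>[j] g \<in> hom_at C (shift j (length (Dom C g)) k) B Y"
  using pcomp_type[of f j g Y] assms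
  by (auto simp: hom_at_def nth_append shift_def min_def)

lemma pcomp_nested:
  assumes "f \<in> hom_at C j A Y" "g \<in> hom_at C l (Cod C h) A" "h \<in> Mor C"
  shows "f \<odot>[j] (g \<odot>[l] h) = (f \<odot>[j] g) \<odot>[j + l] h"
  using mm.pcmp_nested[of f j g l h] assms by (auto simp: mm_pcmp hom_at_def)

lemma pcomp_parallel:
  assumes "f \<in> hom_at C j (Cod C g) Y" "f \<in> hom_at C k (Cod C h) Y" "j \<noteq> k" "g \<in> Mor C" "h \<in> Mor C"
  shows "(f \<odot>[j] g) \<odot>[shift j (length (Dom C g)) k] h = (f \<odot>[k] h) \<odot>[shift k (length (Dom C h)) j] g"
  using mm.pcmp_parallel[of f j k g h] assms by (auto simp: mm_pcmp hom_at_def)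

lemma pcell_nested:
  assumes "\<alpha> \<in> cells C f f'" "\<beta> \<in> cells C g g'" "\<delta> \<in> cells C h h'"
    "f \<in> hom_at C j A Y" "g \<in> hom_at C l (Cod C h) A"
  shows "\<alpha> \<boxdot>[j] (\<beta> \<boxdot>[l] \<delta>) = (\<alpha> \<boxdot>[j] \<beta>) \<boxdot>[j + l] \<delta>"
  using cc.pcmp_nested[of \<alpha> j \<beta> l \<delta>] assms by (auto simp: cc_pcmp hom_at_def cellsD)

lemma pcell_parallel:
  assumes "\<alpha> \<in> cells C f f'" "\<beta> \<in> cells C g g'" "\<delta> \<in> cells C h h'"
    "f \<in> hom_at C j (Cod C g) Y" "f \<in> hom_at C k (Cod C h) Y" "j \<noteq> k"
  shows "(\<alpha> \<boxdot>[j] \<beta>) \<boxdot>[shift j (length (Dom C g)) k] \<delta>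
    = (\<alpha> \<boxdot>[k] \<delta>) \<boxdot>[shift k (length (Dom C h)) j] \<beta>"
  using cc.pcmp_parallel[of \<alpha> j k \<beta> \<delta>] assms by (auto simp: cc_pcmp hom_at_def cellsD)

lemma map_list_update_comp: "map F ((map G xs)[j := x]) = (map (\<lambda>y. F (G y)) xs)[j := F x]"
  by (simp add: map_update comp_def)

lemma cide_src_tgt [simp]:
  assumes "f \<in> Mor C"
  shows "CIde C f \<in> Cell C" "Src C (CIde C f) = f" "Tgt C (CIde C f) = f"
  using cide_cell[OF assms] by (auto simp: cells_def)

lemma cide_vcomp_cide [simp]: "f \<in> Mor C \<Longrightarrow> CIde C f \<cdot> CIde C f = CIde C f"
  using vcomp_ide_left[of "CIde C f"] by simp

lemma pcell_composable:
  assumes "\<alpha> \<in> cells C f f'" "\<beta> \<in> cells C g g'" "f \<in> hom_at C j (Cod C g) Y"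
  shows "composable_cells C \<alpha> ((map (\<lambda>X. CIde C (Ide C X)) (Dom C f))[j := \<beta>])"
proof -
  note a = cellsD[OF assms(1)] and b = cellsD[OF assms(2)]
  have o: "X \<in> Obj C" if "X \<in> set (Dom C f)" for X using dom_obj a that by auto
  have i: "CIde C (Ide C X) \<in> Cell C \<and> Cod C (Src C (CIde C (Ide C X))) = X" if "X \<in> set (Dom C f)" for X
    using ide_hom[OF o[OF that]] by (simp add: hom_def)
  have "map (\<lambda>X. Cod C (Src C (CIde C (Ide C X)))) (Dom C f) = Dom C f"
    using i by (intro map_idI) auto
  then show ?thesis
    using a b i hom_atD[OF assms(3)]
    by (auto simp: composable_cells_iff map_list_update_comp list_update_same_conv
        dest!: subsetD[OF set_update_subset_insert])
qed

lemma pcell_cell: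
  assumes "\<alpha> \<in> cells C f f'" "\<beta> \<in> cells C g g'" "f \<in> hom_at C j (Cod C g) Y"
  shows "\<alpha> \<boxdot>[j] \<beta> \<in> cells C (f \<odot>[j] g) (f' \<odot>[j] g')"
proof -
  note a = cellsD[OF assms(1)] and b = cellsD[OF assms(2)]
  have o: "Ide C X \<in> Mor C" if "X \<in> set (Dom C f)" for X using dom_obj a that ide_hom by (auto simp: hom_def)
  show ?thesis
    using hcomp_cell[OF pcell_composable[OF assms]] a b o
    by (simp add: pcell_def pcomp_def map_list_update_comp cong: map_cong)
qed

lemma pcell_vcomp:
  assumes "\<alpha> \<in> cells C f f'" "\<alpha>' \<in> cells C f' f''" "\<beta> \<in> cells C g g'" "\<beta>' \<in> cells C g' g''"
    "f \<in> hom_at C j (Cod C g) Y"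
  shows "(\<alpha>' \<cdot> \<alpha>) \<boxdot>[j] (\<beta>' \<cdot> \<beta>) = (\<alpha>' \<boxdot>[j] \<beta>') \<cdot> (\<alpha> \<boxdot>[j] \<beta>)"
proof -
  note a = cellsD[OF assms(1)] cellsD[OF assms(2)] cellsD[OF vcomp_cell[OF assms(1,2)]]
    and b = cellsD[OF assms(3)] cellsD[OF assms(4)]
  let ?e = "\<lambda>X. CIde C (Ide C X)"
  have o: "Ide C X \<in> Mor C" if "X \<in> set (Dom C f)" for X using dom_obj a that ide_hom by (auto simp: hom_def)
  have f': "f' \<in> hom_at C j (Cod C g') Y" using cells_hom_at[OF assms(1,5)] b by simp
  note c = pcell_composable[OF assms(1,3,5)] pcell_composable[OF assms(2,4) f']
  have m: "?e X \<cdot> ?e X = ?e X" if "X \<in> set (Dom C f)" for X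
    using o[OF that] by simp
  \<comment> \<open>Away from position \<open>j\<close> both lists carry the same identity 2-cells,
    which are idempotent for vertical composition.\<close>
  have "map2 (VComp C) ((map ?e (Dom C f))[j := \<beta>']) ((map ?e (Dom C f))[j := \<beta>])
    = (map ?e (Dom C f))[j := \<beta>' \<cdot> \<beta>]"
    by (intro nth_equalityI) (use hom_atD[OF assms(5)] in \<open>auto simp: nth_list_update m\<close>)
  then show ?thesis
    using interchange[OF c] a b o unfolding pcell_def
    by (simp add: map_list_update_comp cong: map_cong)
qed

lemma pcell_cide:
  assumes "f \<in> hom_at C j (Cod C g) Y" "g \<in> Mor C"
  shows "f \<triangleright>[j] CIde C g = CIde C (f \<odot>[j] g)"
proof -
  note f = hom_atD[OF assms(1)]
  have o: "Ide C X \<in> Mor C \<and> Cod C (Ide C X) = X" if "X \<in> set (Dom C f)" for X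
    using dom_obj f that ide_hom by (auto simp: hom_def)
  have "map (\<lambda>X. Cod C (Ide C X)) (Dom C f) = Dom C f" using o by (intro map_idI) auto
  then have "composable C f ((map (Ide C) (Dom C f))[j := g])"
    using f o assms(2) by (auto simp: composable_def map_list_update_comp list_update_same_conv
        dest!: subsetD[OF set_update_subset_insert])
  from hcomp_cide[OF this] f show ?thesis
    by (simp add: pcell_def pcomp_def map_list_update_comp)
qed

lemma vcomp_Cell:
  assumes "\<alpha> \<in> Cell C" "\<beta> \<in> Cell C" "Tgt C \<alpha> = Src C \<beta>"
  shows "\<beta> \<cdot> \<alpha> \<in> Cell C" "Src C (\<beta> \<cdot> \<alpha>) = Src C \<alpha>" "Tgt C (\<beta> \<cdot> \<alpha>) = Tgt C \<beta>"
  using vcomp_cell[of \<alpha> "Src C \<alpha>" "Tgt C \<alpha>" \<beta> "Tgt C \<beta>"] assms by (auto simp: cells_def)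

text \<open>With sources and targets in place of named endpoints, every side condition can be
  computed from the factors by \<open>vcomp_Cell\<close>; this makes associativity usable as a
  normalisation of long composites.\<close>

lemma vcomp_assoc':
  assumes "\<alpha> \<in> Cell C" "\<beta> \<in> Cell C" "\<delta> \<in> Cell C" "Tgt C \<alpha> = Src C \<beta>" "Tgt C \<beta> = Src C \<delta>"
  shows "\<delta> \<cdot> \<beta> \<cdot> \<alpha> = \<delta> \<cdot> (\<beta> \<cdot> \<alpha>)"
  using vcomp_assoc[of \<alpha> "Src C \<alpha>" "Tgt C \<alpha>" \<beta> "Tgt C \<beta>" \<delta> "Tgt C \<delta>"] assms by (auto simp: cells_def)

lemma vcomp_cideL [simp]: "\<alpha> \<in> cells C f g \<Longrightarrow> CIde C g \<cdot> \<alpha> = \<alpha>"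
  using vcomp_ide_left[of \<alpha>] by (auto simp: cells_def)

lemma vcomp_cideR [simp]: "\<alpha> \<in> cells C f g \<Longrightarrow> \<alpha> \<cdot> CIde C f = \<alpha>"
  using vcomp_ide_right[of \<alpha>] by (auto simp: cells_def)

lemma whisker_right_cell:
  "\<lbrakk>\<alpha> \<in> cells C f f'; f \<in> hom_at C j (Cod C g) Y; g \<in> Mor C\<rbrakk> \<Longrightarrow> \<alpha> \<triangleleft>[j] g \<in> cells C (f \<odot>[j] g) (f' \<odot>[j] g)"
  by (rule pcell_cell) (auto intro: cide_cell)

lemma whisker_left_cell:
  "\<lbrakk>\<beta> \<in> cells C g g'; f \<in> hom_at C j (Cod C g) Y\<rbrakk> \<Longrightarrow> f \<triangleright>[j] \<beta> \<in> cells C (f \<odot>[j] g) (f \<odot>[j] g')"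
  by (rule pcell_cell) (auto intro: cide_cell dest: hom_atD)

lemma whisker_right_vcomp:
  assumes "\<alpha> \<in> cells C f f'" "\<alpha>' \<in> cells C f' f''" "f \<in> hom_at C j (Cod C g) Y" "g \<in> Mor C"
  shows "(\<alpha>' \<cdot> \<alpha>) \<triangleleft>[j] g = (\<alpha>' \<triangleleft>[j] g) \<cdot> (\<alpha> \<triangleleft>[j] g)"
  using pcell_vcomp[OF assms(1,2) cide_cell cide_cell assms(3)] assms(4) cide_cell by simp

lemma whisker_left_vcomp:
  assumes "\<beta> \<in> cells C g g'" "\<beta>' \<in> cells C g' g''" "f \<in> hom_at C j (Cod C g) Y"
  shows "f \<triangleright>[j] (\<beta>' \<cdot> \<beta>) = (f \<triangleright>[j] \<beta>') \<cdot> (f \<triangleright>[j] \<beta>)"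
  using pcell_vcomp[OF cide_cell cide_cell assms] hom_atD[OF assms(3)] cide_cell by simp

lemma whisker_exchange:
  assumes "\<alpha> \<in> cells C f f'" "\<beta> \<in> cells C g g'" "f \<in> hom_at C j (Cod C g) Y"
  shows "(\<alpha> \<triangleleft>[j] g') \<cdot> (f \<triangleright>[j] \<beta>) = \<alpha> \<boxdot>[j] \<beta>" "(f' \<triangleright>[j] \<beta>) \<cdot> (\<alpha> \<triangleleft>[j] g) = \<alpha> \<boxdot>[j] \<beta>"
  using pcell_vcomp[OF cide_cell assms(1,2) cide_cell assms(3)]
    pcell_vcomp[OF assms(1) cide_cell cide_cell assms(2,3)] cellsD[OF assms(1)] cellsD[OF assms(2)] assms
  by simp_all

lemma inverse_cells_unique:
  assumes "inverse_cells C \<alpha> \<beta>" "inverse_cells C \<alpha> \<beta>'"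
  shows "\<beta> = \<beta>'"
proof -
  let ?f = "Src C \<alpha>" and ?g = "Tgt C \<alpha>"
  have a: "\<alpha> \<in> cells C ?f ?g" "\<beta> \<in> cells C ?g ?f" "\<beta>' \<in> cells C ?g ?f"
    using assms by (auto simp: inverse_cells_def cells_def)
  have "\<beta> = \<beta> \<cdot> (\<alpha> \<cdot> \<beta>')" using a assms by (simp add: inverse_cells_def)
  also have "\<dots> = (\<beta> \<cdot> \<alpha>) \<cdot> \<beta>'" using vcomp_assoc a by blast
  also have "\<dots> = \<beta>'" using a assms by (simp add: inverse_cells_def)
  finally show ?thesis .
qed

lemma iso_cellsD:
  assumes "\<alpha> \<in> iso_cells C f g"
  shows "\<alpha> \<in> cells C f g" "inv_cell C \<alpha> \<in> cells C g f"
    "inv_cell C \<alpha> \<cdot> \<alpha> = CIde C f" "\<alpha> \<cdot> inv_cell C \<alpha> = CIde C g"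
proof -
  obtain \<beta> where b: "inverse_cells C \<alpha> \<beta>" and a: "\<alpha> \<in> cells C f g"
    using assms by (auto simp: iso_cells_def)
  then have e: "inv_cell C \<alpha> = \<beta>"
    unfolding inv_cell_def using inverse_cells_unique by (intro the_equality) auto
  show "\<alpha> \<in> cells C f g" "inv_cell C \<alpha> \<in> cells C g f"
    "inv_cell C \<alpha> \<cdot> \<alpha> = CIde C f" "\<alpha> \<cdot> inv_cell C \<alpha> = CIde C g"
    using a b unfolding e by (auto simp: inverse_cells_def cells_def)
qed

lemma iso_cellsI:
  assumes "\<alpha> \<in> cells C f g" "\<beta> \<in> cells C g f" "\<beta> \<cdot> \<alpha> = CIde C f" "\<alpha> \<cdot> \<beta> = CIde C g"
  shows "\<alpha> \<in> iso_cells C f g"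
  using assms by (auto simp: iso_cells_def inverse_cells_def cells_def intro!: exI[of _ \<beta>])

text \<open>Some conditions on gamma contain the inverse of a pseudonaturality 2-cell. This moves it
  to the other side, where the coherence axioms of the strength, stated for the 2-cell itself,
  apply.\<close>

lemma inv_cell_vcomp_eq_iff:
  assumes "\<alpha> \<in> iso_cells C g h" "\<beta> \<in> cells C f h" "\<delta> \<in> cells C f g"
  shows "inv_cell C \<alpha> \<cdot> \<beta> = \<delta> \<longleftrightarrow> \<beta> = \<alpha> \<cdot> \<delta>"
proof -
  note a = iso_cellsD[OF assms(1)]
  have "inv_cell C \<alpha> \<cdot> (\<alpha> \<cdot> \<delta>) = \<delta>" "\<alpha> \<cdot> (inv_cell C \<alpha> \<cdot> \<beta>) = \<beta>"
    using vcomp_assoc[OF assms(3) a(1,2)] vcomp_assoc[OF assms(2) a(2,1)] a assms by auto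
  then show ?thesis by auto
qed

lemma iso_cells_cancel_left:
  assumes "\<alpha> \<in> iso_cells C g h" "\<beta> \<in> cells C f g" "\<delta> \<in> cells C f g" "\<alpha> \<cdot> \<beta> = \<alpha> \<cdot> \<delta>"
  shows "\<beta> = \<delta>"
proof -
  note v = vcomp_cell[OF assms(2) iso_cellsD(1)[OF assms(1)]]
  have "inv_cell C \<alpha> \<cdot> (\<alpha> \<cdot> \<beta>) = \<beta>" using inv_cell_vcomp_eq_iff[OF assms(1) v assms(2)] by simp
  moreover have "inv_cell C \<alpha> \<cdot> (\<alpha> \<cdot> \<beta>) = \<delta>"
    using inv_cell_vcomp_eq_iff[OF assms(1) v assms(3)] assms(4) by simp
  ultimately show ?thesis by simp
qed

lemma pcell_ide_right:
  assumes "\<alpha> \<in> cells C f f'" "f \<in> hom_at C j A Y"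
  shows "\<alpha> \<triangleleft>[j] Ide C A = \<alpha>"
proof -
  have "(map (\<lambda>X. CIde C (Ide C X)) (Dom C f))[j := CIde C (Ide C A)] = map (\<lambda>X. CIde C (Ide C X)) (Dom C f)"
    using hom_atD[OF assms(2)] by (intro nth_equalityI) (auto simp: nth_list_update)
  then show ?thesis
    using hcomp_ide_right[of \<alpha>] cellsD[OF assms(1)] by (simp add: pcell_def)
qed

lemma pcomp_ide_right:
  assumes "f \<in> hom_at C j A Y"
  shows "f \<odot>[j] Ide C A = f"
proof -
  have "(map (Ide C) (Dom C f))[j := Ide C A] = map (Ide C) (Dom C f)"
    using hom_atD[OF assms] by (intro nth_equalityI) (auto simp: nth_list_update)
  then show ?thesis
    using comp_ide_right[of f] hom_atD[OF assms] by (simp add: pcomp_def)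
qed

lemma iso_cells_vcomp:
  assumes "\<alpha> \<in> iso_cells C f g" "\<beta> \<in> iso_cells C g h"
  shows "\<beta> \<cdot> \<alpha> \<in> iso_cells C f h"
proof -
  note a = iso_cellsD[OF assms(1)] and b = iso_cellsD[OF assms(2)]
  let ?i = "inv_cell C \<alpha> \<cdot> inv_cell C \<beta>"
  have "?i \<cdot> (\<beta> \<cdot> \<alpha>) = inv_cell C \<alpha> \<cdot> (inv_cell C \<beta> \<cdot> (\<beta> \<cdot> \<alpha>))"
    using a(1,2) b(1,2) by (metis vcomp_assoc vcomp_cell)
  also have "inv_cell C \<beta> \<cdot> (\<beta> \<cdot> \<alpha>) = \<alpha>"
    using vcomp_assoc[OF a(1) b(1,2)] b(3) vcomp_cideL[OF a(1)] by simp
  finally have 1: "?i \<cdot> (\<beta> \<cdot> \<alpha>) = CIde C f" using a by simp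
  have "(\<beta> \<cdot> \<alpha>) \<cdot> ?i = \<beta> \<cdot> (\<alpha> \<cdot> ?i)"
    using a(1,2) b(1,2) by (metis vcomp_assoc vcomp_cell)
  also have "\<alpha> \<cdot> ?i = inv_cell C \<beta>"
    using vcomp_assoc[OF b(2) a(2,1)] a(4) vcomp_cideL[OF b(2)] by simp
  finally have 2: "(\<beta> \<cdot> \<alpha>) \<cdot> ?i = CIde C h" using b by simp
  show ?thesis
    using 1 2 a b by (blast intro: iso_cellsI vcomp_cell)
qed

lemma whisker_left_iso:
  assumes "\<beta> \<in> iso_cells C g g'" "f \<in> hom_at C j (Cod C g) Y"
  shows "f \<triangleright>[j] \<beta> \<in> iso_cells C (f \<odot>[j] g) (f \<odot>[j] g')"
proof -
  note b = iso_cellsD[OF assms(1)]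
  note g = cellsD[OF b(1)]
  have f: "f \<in> hom_at C j (Cod C g') Y" using assms g by simp
  show ?thesis
  proof (rule iso_cellsI)
    show "(f \<triangleright>[j] inv_cell C \<beta>) \<cdot> (f \<triangleright>[j] \<beta>) = CIde C (f \<odot>[j] g)"
      using whisker_left_vcomp[OF b(1,2) assms(2)] b pcell_cide[OF assms(2)] g by simp
    show "(f \<triangleright>[j] \<beta>) \<cdot> (f \<triangleright>[j] inv_cell C \<beta>) = CIde C (f \<odot>[j] g')"
      using whisker_left_vcomp[OF b(2,1) f] b pcell_cide[OF f] g by simp
  qed (use whisker_left_cell b assms f in auto)
qed

end

section \<open>Transposition along the unit\<close>

context strong_relative_pseudomonad
begin

section \<open>Typing of strengthenings, and symmetric forms of the axioms\<close>

lemma unit_type: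
  assumes "X \<in> Obj D"
  shows "i X \<in> Mor C" "Dom C (i X) = [JO X]" "Cod C (i X) = TO X" "i X \<in> hom_at C 0 (JO X) (TO X)"
  using unit_hom[OF assms] by (auto simp: hom_def hom_at_def)

lemma str_type:
  assumes "X \<in> Obj D" "Y \<in> Obj D" "f \<in> hom_at C j (JO X) (TO Y)"
  shows "str j X Y f \<in> Mor C" "Dom C (str j X Y f) = (Dom C f)[j := TO X]"
    "Cod C (str j X Y f) = TO Y" "str j X Y f \<in> hom_at C j (TO X) (TO Y)"
  using str_hom[OF assms] assms(3) by (auto simp: hom_def hom_at_def)

lemma str_hom_at_other:
  assumes "X \<in> Obj D" "Y \<in> Obj D" "f \<in> hom_at C j (JO X) (TO Y)" "f \<in> hom_at C k B (TO Y)" "k \<noteq> j"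
  shows "str j X Y f \<in> hom_at C k B (TO Y)"
  using str_type[OF assms(1-3)] assms(4,5) by (auto simp: hom_at_def)

text \<open>The laws of partial composition express the type of the substituted argument as
  \<open>Cod C g\<close>; this supplies that form when the substituted map is a unit.\<close>

lemma unit_pcomp_cong:
  assumes "X \<in> Obj D" "f \<in> hom_at C j (TO X) Y"
  shows "f \<in> hom_at C j (Cod C (i X)) Y"
  using assms unit_type by simp

lemma hom_at_unit:
  assumes "X \<in> Obj D" "f \<in> hom_at C j (TO X) Y"
  shows "f \<odot>[j] i X \<in> hom_at C j (JO X) Y"
  using pcomp_hom_at_inner[OF assms(2) unit_type(4)[OF assms(1)]] by simp

lemma hom_at_unit_other:
  assumes "X \<in> Obj D" "f \<in> hom_at C j (TO X) Y" "f \<in> hom_at C k B Y" "j \<noteq> k"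
  shows "f \<odot>[j] i X \<in> hom_at C k B Y"
  using pcomp_hom_at_outer[OF unit_pcomp_cong[OF assms(1,2)] assms(3,4)] unit_type[OF assms(1)] by simp

text \<open>The primed variants replace the bound on \<open>k\<close> and the explicit list of
  argument objects by a second membership in \<open>hom_at\<close>, which is the form in which types
  of strengthenings and composites are derived.\<close>

lemma nat_iso_cell':
  assumes "X \<in> Obj D" "Y \<in> Obj D" "f \<in> hom_at C j (JO X) (TO Y)" "f \<in> hom_at C k (Cod C g) (TO Y)"
    "k \<noteq> j" "g \<in> Mor C"
  shows "nat_iso j X Y k f g
    \<in> iso_cells C (str (shift k (arity g) j) X Y (f \<odot>[k] g)) (str j X Y f \<odot>[k] g)"
  using nat_iso_cell[OF assms(1-3) _ assms(5), of g "Dom C g"] assms(4,6)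
  by (auto simp: hom_at_def hom_def)

lemmas nat_cell = iso_cellsD(1)[OF nat_iso_cell']
lemmas tilde_cell' = iso_cellsD(1)[OF tilde_cell]
lemmas hat_cell' = iso_cellsD(1)[OF hat_cell]

lemma nat_unit_iso:
  assumes "X \<in> Obj D" "Y \<in> Obj D" "U \<in> Obj D" "f \<in> hom_at C j (JO X) (TO Y)" "f \<in> hom_at C k (TO U) (TO Y)"
    "k \<noteq> j"
  shows "nat_iso j X Y k f (i U) \<in> iso_cells C (str j X Y (f \<odot>[k] i U)) (str j X Y f \<odot>[k] i U)"
  using nat_iso_cell'[OF assms(1,2,4) unit_pcomp_cong[OF assms(3,5)] assms(6)] unit_type[OF assms(3)] by simp

lemmas nat_unit_cell = iso_cellsD(1)[OF nat_unit_iso]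

lemma nat_iso_natural':
  assumes "X \<in> Obj D" "Y \<in> Obj D" "f \<in> hom_at C j (JO X) (TO Y)" "f \<in> hom_at C k (Cod C g) (TO Y)"
    "k \<noteq> j" "\<alpha> \<in> cells C f f'" "\<beta> \<in> cells C g g'"
  shows "nat_iso j X Y k f' g' \<cdot> str2 (shift k (arity g) j) X Y (\<alpha> \<boxdot>[k] \<beta>)
            = (str2 j X Y \<alpha> \<boxdot>[k] \<beta>) \<cdot> nat_iso j X Y k f g"
  using nat_iso_natural[OF assms(1-3) _ assms(5) _ assms(6,7), of "Dom C g"] assms(4) cellsD[OF assms(7)]
  by (auto simp: hom_at_def hom_def)

lemma nat_iso_nested':
  assumes "X \<in> Obj D" "Y \<in> Obj D" "f \<in> hom_at C j (JO X) (TO Y)" "f \<in> hom_at C k (Cod C g) (TO Y)"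
    "k \<noteq> j" "g \<in> hom_at C l (Cod C h) (Cod C g)" "h \<in> Mor C"
  shows "nat_iso j X Y k f (g \<odot>[l] h)
            = (nat_iso j X Y k f g \<triangleleft>[k + l] h)
              \<cdot> nat_iso (shift k (arity g) j) X Y (k + l) (f \<odot>[k] g) h"
  using nat_iso_nested[OF assms(1-3) _ assms(5), of g "Dom C g" l h "Dom C h"] assms(4,6,7)
  by (auto simp: hom_at_def hom_def)

text \<open>The axiom assumes \<open>k < l\<close>. Read from right to left with the two
  substitutions exchanged, it covers \<open>l < k\<close> as well, and \<open>shift\<close> gives
  both cases the same shape.\<close>

lemma nat_iso_parallel':
  assumes "X \<in> Obj D" "Y \<in> Obj D" "f \<in> hom_at C j (JO X) (TO Y)" "f \<in> hom_at C k (Cod C g) (TO Y)"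
    "f \<in> hom_at C l (Cod C h) (TO Y)" "k \<noteq> j" "l \<noteq> j" "k \<noteq> l" "g \<in> Mor C" "h \<in> Mor C"
  shows "(nat_iso j X Y l f h \<triangleleft>[shift l (arity h) k] g)
       \<cdot> nat_iso (shift l (arity h) j) X Y (shift l (arity h) k) (f \<odot>[l] h) g
     = (nat_iso j X Y k f g \<triangleleft>[shift k (arity g) l] h)
       \<cdot> nat_iso (shift k (arity g) j) X Y (shift k (arity g) l) (f \<odot>[k] g) h"
proof (cases "k < l")
  case True
  then show ?thesis
    using nat_iso_parallel[OF assms(1-3) True _ assms(6,7), of g "Dom C g" h "Dom C h"] assms
    by (auto simp: hom_at_def hom_def shift_def)
next
  case False
  then have "l < k" using assms by simp
  then show ?thesis
    using nat_iso_parallel[OF assms(1-3) \<open>l < k\<close> _ assms(7,6), of h "Dom C h" g "Dom C g"] assms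
    by (auto simp: hom_at_def hom_def shift_def)
qed

lemma tilde_subst':
  assumes "X \<in> Obj D" "Y \<in> Obj D" "f \<in> hom_at C j (JO X) (TO Y)" "f \<in> hom_at C k (Cod C g) (TO Y)"
    "k \<noteq> j" "g \<in> Mor C"
  shows "(nat_iso j X Y k f g \<triangleleft>[shift k (arity g) j] i X)
              \<cdot> tilde (shift k (arity g) j) X Y (f \<odot>[k] g)
            = tilde j X Y f \<triangleleft>[k] g"
  using tilde_subst[OF assms(1-3) _ assms(5), of g "Dom C g"] assms(4,6)
  by (auto simp: hom_at_def hom_def)

section \<open>The transpose and its compatibility with the strong structure\<close>

text \<open>Formed from the unit t-tilde alone, the transpose makes sense in every strong relative
  pseudomonad, and its values on pseudonaturality and on t-hat are computed at that level. The
  adjunction later makes it injective.\<close>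

definition restr :: "nat \<Rightarrow> 'p \<Rightarrow> 'p \<Rightarrow> 'm \<Rightarrow> 'c \<Rightarrow> 'c" where
  "restr j X Y f \<alpha> = (\<alpha> \<triangleleft>[j] i X) \<cdot> tilde j X Y f"

lemma str_whisker_unit_cell:
  assumes "X \<in> Obj D" "Y \<in> Obj D" "f \<in> hom_at C j (JO X) (TO Y)" "\<alpha> \<in> cells C (str j X Y f) h"
  shows "\<alpha> \<triangleleft>[j] i X \<in> cells C (str j X Y f \<odot>[j] i X) (h \<odot>[j] i X)"
  using whisker_right_cell[OF assms(4) unit_pcomp_cong] str_type[OF assms(1-3)] unit_type assms(1) by blast

lemma restr_cell:
  assumes "X \<in> Obj D" "Y \<in> Obj D" "f \<in> hom_at C j (JO X) (TO Y)" "\<alpha> \<in> cells C (str j X Y f) h"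
  shows "restr j X Y f \<alpha> \<in> cells C f (h \<odot>[j] i X)"
  unfolding restr_def
  using vcomp_cell[OF tilde_cell' str_whisker_unit_cell] assms by blast

lemma restr_cide:
  assumes "X \<in> Obj D" "Y \<in> Obj D" "f \<in> hom_at C j (JO X) (TO Y)"
  shows "restr j X Y f (CIde C (str j X Y f)) = tilde j X Y f"
  unfolding restr_def
  using pcell_cide[OF unit_pcomp_cong] str_type[OF assms] unit_type[OF assms(1)] assms(1)
    vcomp_cideL[OF tilde_cell'[OF assms]] by simp

lemma restr_vcomp:
  assumes "X \<in> Obj D" "Y \<in> Obj D" "f \<in> hom_at C j (JO X) (TO Y)"
    "\<alpha> \<in> cells C (str j X Y f) h" "\<beta> \<in> cells C h h'"
  shows "restr j X Y f (\<beta> \<cdot> \<alpha>) = (\<beta> \<triangleleft>[j] i X) \<cdot> restr j X Y f \<alpha>"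
proof -
  have h: "str j X Y f \<in> hom_at C j (Cod C (i X)) (TO Y)"
    using str_type[OF assms(1-3)] unit_type[OF assms(1)] by simp
  then have h': "h \<in> hom_at C j (Cod C (i X)) (TO Y)" using cells_hom_at assms(4) by blast
  note u = unit_type(1)[OF assms(1)]
  show ?thesis
    unfolding restr_def whisker_right_vcomp[OF assms(4,5) h u]
    by (rule vcomp_assoc[symmetric, OF tilde_cell'[OF assms(1-3)]
          whisker_right_cell[OF assms(4) h u] whisker_right_cell[OF assms(5) h' u]])
qed

text \<open>By naturality of t-tilde a strengthened 2-cell applied first leaves the transpose
  unstrengthened. Together with \<open>restr_vcomp\<close>, which treats the target side, this is
  naturality of transposition in both variables.\<close>

lemma restr_str2:
  assumes "X \<in> Obj D" "Y \<in> Obj D" "f \<in> hom_at C j (JO X) (TO Y)"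
    "\<phi> \<in> cells C f f'" "\<alpha> \<in> cells C (str j X Y f') h"
  shows "restr j X Y f (\<alpha> \<cdot> str2 j X Y \<phi>) = restr j X Y f' \<alpha> \<cdot> \<phi>"
proof -
  have f': "f' \<in> hom_at C j (JO X) (TO Y)" using assms cells_hom_at by blast
  note s = str2_cell[OF assms(1-4)]
  have "restr j X Y f (\<alpha> \<cdot> str2 j X Y \<phi>)
      = (\<alpha> \<triangleleft>[j] i X) \<cdot> ((str2 j X Y \<phi> \<triangleleft>[j] i X) \<cdot> tilde j X Y f)"
    using restr_vcomp[OF assms(1-3) s assms(5)] by (simp add: restr_def)
  also have "\<dots> = (\<alpha> \<triangleleft>[j] i X) \<cdot> (tilde j X Y f' \<cdot> \<phi>)"
    using tilde_natural[OF assms(1-4)] by simp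
  also have "\<dots> = restr j X Y f' \<alpha> \<cdot> \<phi>"
    unfolding restr_def
    by (rule vcomp_assoc[OF assms(4) tilde_cell'[OF assms(1,2) f'] str_whisker_unit_cell[OF assms(1,2) f' assms(5)]])
  finally show ?thesis .
qed

text \<open>\<open>tilde_subst\<close> identifies the transpose of the pseudonaturality 2-cell, and
  whiskerings in two different arguments commute. Hence transposition in position \<open>j\<close>
  commutes with substitution in position \<open>l\<close>.\<close>

lemma restr_nat:
  assumes "X \<in> Obj D" "Y \<in> Obj D" "f \<in> hom_at C j (JO X) (TO Y)" "f \<in> hom_at C l (Cod C g) (TO Y)"
    "l \<noteq> j" "g \<in> Mor C" "\<alpha> \<in> cells C (str j X Y f) h"
  shows "restr (shift l (arity g) j) X Y (f \<odot>[l] g) ((\<alpha> \<triangleleft>[l] g) \<cdot> nat_iso j X Y l f g)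
    = restr j X Y f \<alpha> \<triangleleft>[l] g"
proof -
  let ?j = "shift l (arity g) j"
  have fg: "f \<odot>[l] g \<in> hom_at C ?j (JO X) (TO Y)"
    using pcomp_hom_at_outer assms by blast
  have s: "str j X Y f \<in> hom_at C l (Cod C g) (TO Y)" "str j X Y f \<in> hom_at C j (Cod C (i X)) (TO Y)"
    using str_hom_at_other str_type assms unit_type by auto
  note n = nat_cell[OF assms(1-6)]
  note u = cide_cell[OF unit_type(1)[OF assms(1)]] and g = cide_cell[OF assms(6)]
  have "restr ?j X Y (f \<odot>[l] g) ((\<alpha> \<triangleleft>[l] g) \<cdot> nat_iso j X Y l f g)
      = ((\<alpha> \<triangleleft>[l] g) \<triangleleft>[?j] i X) \<cdot> (tilde j X Y f \<triangleleft>[l] g)"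
    using restr_vcomp[OF assms(1,2) fg n whisker_right_cell[OF assms(7) s(1) assms(6)]]
      tilde_subst'[OF assms(1-6)] by (simp add: restr_def)
  also have "(\<alpha> \<triangleleft>[l] g) \<triangleleft>[?j] i X = (\<alpha> \<triangleleft>[j] i X) \<triangleleft>[l] g"
    using pcell_parallel[OF assms(7) g u s assms(5)] unit_type[OF assms(1)] by simp
  also have "\<dots> \<cdot> (tilde j X Y f \<triangleleft>[l] g) = restr j X Y f \<alpha> \<triangleleft>[l] g"
    unfolding restr_def
    using whisker_right_vcomp[OF tilde_cell'[OF assms(1-3)] str_whisker_unit_cell[OF assms(1-3,7)] assms(4,6)]
    by simp
  finally show ?thesis .
qed

text \<open>Naturality of t-tilde expresses t-tilde after \<alpha> through
  \<open>str2 j X Y \<alpha>\<close>, and an invertible 2-cell can be cancelled.\<close>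

lemma str2_faithful:
  assumes "X \<in> Obj D" "Y \<in> Obj D" "f \<in> hom_at C j (JO X) (TO Y)"
    "\<alpha> \<in> cells C f f'" "\<beta> \<in> cells C f f'" "str2 j X Y \<alpha> = str2 j X Y \<beta>"
  shows "\<alpha> = \<beta>"
  using iso_cells_cancel_left[OF tilde_cell[OF assms(1,2) cells_hom_at[OF assms(4,3)]] assms(4,5)]
    tilde_natural[OF assms(1-4)] tilde_natural[OF assms(1-3,5)] assms(6) by simp

text \<open>
  By \<open>hat_assoc\<close> with the unit as third map and two uses of \<open>hat_unit\<close>, the strengthenings of both
  sides agree after composition with one and the same invertible 2-cell; strengthening is faithful
  because t-tilde is invertible.
\<close>

lemma hat_tilde:
  assumes W: "W \<in> Obj D" and X: "X \<in> Obj D" and Y: "Y \<in> Obj D"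
    and f: "f \<in> hom_at C j (JO X) (TO Y)" and g: "g \<in> hom_at C k (JO W) (TO X)"
  shows "restr (j + k) W Y (str j X Y f \<odot>[j] g) (hat j k W X Y f g) = str j X Y f \<triangleright>[j] tilde k W X g"
proof -
  let ?f = "str j X Y f" and ?g = "str k W X g" and ?p = "j + k"
  let ?F = "?f \<odot>[j] g" and ?u = "i W" and ?v = "str 0 W W (i W)"
  note u = unit_type[OF W]
  note sf = str_type[OF X Y f] and sg = str_type[OF W X g]
  have F: "?F \<in> hom_at C ?p (JO W) (TO Y)" by (rule pcomp_hom_at_inner[OF sf(4) g])
  have gu: "?g \<odot>[k] ?u \<in> hom_at C k (JO W) (TO X)" by (rule hom_at_unit[OF W sg(4)])
  note sF = str_type[OF W Y F] and sv = str_type[OF W W u(4)]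
  have fc: "?f \<in> hom_at C j (Cod C h) (TO Y)" if "Cod C h = TO X" for h using sf that by simp
  have gc: "?g \<in> hom_at C k (Cod C h) (TO X)" if "Cod C h = TO W" for h using sg that by simp
  have nest: "(?f \<odot>[j] ?g) \<odot>[?p] h = ?f \<odot>[j] (?g \<odot>[k] h)" if "h \<in> Mor C" "Cod C h = TO W" for h
    using pcomp_nested[OF sf(4) gc that(1)] that by simp
  note th = iso_cellsD(1)[OF theta_cell[OF W]]
  let ?H1 = "hat j k W X Y f g" and ?H2 = "hat ?p 0 W W Y ?F ?u"
    and ?h = "hat k 0 W W X g ?u" and ?H4 = "hat j k W X Y f (?g \<odot>[k] ?u)"
  let ?H3 = "?f \<triangleright>[j] ?h" and ?th = "?g \<triangleright>[k] theta T W"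
  let ?Th = "?f \<triangleright>[j] ?th"
  let ?A = "restr ?p W Y ?F ?H1" and ?B = "?f \<triangleright>[j] tilde k W X g"
  have H1: "?H1 \<in> cells C (str ?p W Y ?F) (?f \<odot>[j] ?g)" by (rule hat_cell'[OF W X Y f g])
  have H2: "?H2 \<in> cells C (str ?p W Y (str ?p W Y ?F \<odot>[?p] ?u)) (str ?p W Y ?F \<odot>[?p] ?v)"
    using hat_cell'[OF W W Y F u(4)] by simp
  have h: "?h \<in> iso_cells C (str k W X (?g \<odot>[k] ?u)) (?g \<odot>[k] ?v)"
    using hat_cell[OF W W X g u(4)] by simp
  have H4: "?H4 \<in> iso_cells C (str ?p W Y (?f \<odot>[j] (?g \<odot>[k] ?u))) (?f \<odot>[j] str k W X (?g \<odot>[k] ?u))"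
    using hat_cell[OF W X Y f gu] by simp
  have gv: "?g \<odot>[k] ?v \<in> Mor C" "Cod C (?g \<odot>[k] ?v) = TO X"
    using pcomp_type[OF gc[OF sv(3)] sv(1)] by auto
  have sgu: "str k W X (?g \<odot>[k] ?u) \<in> Mor C" "Cod C (str k W X (?g \<odot>[k] ?u)) = TO X"
    using str_type[OF W X gu] by auto
  have H3: "?H3 \<in> iso_cells C (?f \<odot>[j] str k W X (?g \<odot>[k] ?u)) (?f \<odot>[j] (?g \<odot>[k] ?v))"
    by (rule whisker_left_iso[OF h fc[OF sgu(2)]])
  have thc: "?th \<in> iso_cells C (?g \<odot>[k] ?v) ?g"
    using whisker_left_iso[OF theta_cell[OF W] gc[OF sv(3)]] pcomp_ide_right[OF sg(4)] by simp
  have Th: "?Th \<in> iso_cells C (?f \<odot>[j] (?g \<odot>[k] ?v)) (?f \<odot>[j] ?g)"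
    by (rule whisker_left_iso[OF thc fc[OF gv(2)]])
  have A: "?A \<in> cells C ?F (?f \<odot>[j] (?g \<odot>[k] ?u))"
    using restr_cell[OF W Y F H1] nest[OF u(1,3)] by simp
  have B: "?B \<in> cells C ?F (?f \<odot>[j] (?g \<odot>[k] ?u))"
    by (rule whisker_left_cell[OF tilde_cell'[OF W X g]]) (use g sf in \<open>simp add: hom_at_def\<close>)
  note sA = str2_cell[OF W Y F A] and sB = str2_cell[OF W Y F B]
  note tF = tilde_cell'[OF W Y F]
  note st = str2_cell[OF W Y F tF]
  note H1u = whisker_right_cell[OF H1 unit_pcomp_cong[OF W sF(4)] u(1)]
  have H1v: "?H1 \<triangleleft>[?p] ?v \<in> cells C (str ?p W Y ?F \<odot>[?p] ?v) (?f \<odot>[j] (?g \<odot>[k] ?v))"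
    using whisker_right_cell[OF H1 _ sv(1), of ?p "TO Y"] sF(4) sv(3) nest[OF sv(1,3)] by simp
  note s1 = str2_cell[OF W Y hom_at_unit[OF W sF(4)] H1u, unfolded nest[OF u(1,3)]]
  \<comment> \<open>The common invertible factor: t-hat at \<open>f\<close> and the restriction of
    the strengthened \<open>g\<close>, then t-hat at \<open>g\<close> and the unit, then theta, the
    last two whiskered by the strengthened \<open>f\<close>. It is chosen so that both candidates
    for the transpose, strengthened and followed by \<open>?K\<close>, give
    \<open>?H1\<close>.\<close>
  let ?K = "?Th \<cdot> (?H3 \<cdot> ?H4)"
  have K: "?K \<in> iso_cells C (str ?p W Y (?f \<odot>[j] (?g \<odot>[k] ?u))) (?f \<odot>[j] ?g)"
    by (rule iso_cells_vcomp[OF iso_cells_vcomp[OF H4 H3] Th])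
  note h3 = iso_cellsD(1)[OF H3] and h4 = iso_cellsD(1)[OF H4] and tt = iso_cellsD(1)[OF Th]
  note ty = cellsD(1-3)[OF H1] cellsD(1-3)[OF H2] cellsD(1-3)[OF h3] cellsD(1-3)[OF h4] cellsD(1-3)[OF tt]
    cellsD(1-3)[OF sA] cellsD(1-3)[OF sB] cellsD(1-3)[OF st] cellsD(1-3)[OF H1v] cellsD(1-3)[OF s1]
  have sA': "str2 ?p W Y ?A = str2 ?p W Y (?H1 \<triangleleft>[?p] ?u) \<cdot> str2 ?p W Y (tilde ?p W Y ?F)"
    unfolding restr_def by (rule str2_vcomp[OF W Y F tF H1u])
  have ax: "(?H1 \<triangleleft>[?p] ?v) \<cdot> ?H2 = ?H3 \<cdot> ?H4 \<cdot> str2 ?p W Y (?H1 \<triangleleft>[?p] ?u)"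
    using hat_assoc[OF W W X Y f g u(4)] by simp
  \<comment> \<open>Theta acts on the inner argument and \<open>?H1\<close> on the outer map, so
    interchange moves theta in front of \<open>?H1\<close>; whiskering \<open>?H1\<close> by the
    identity of \<open>TO W\<close> then changes nothing.\<close>
  have ThH: "?Th \<cdot> (?H1 \<triangleleft>[?p] ?v) = ?H1 \<cdot> (str ?p W Y ?F \<triangleright>[?p] theta T W)"
  proof -
    have "?Th = (?f \<odot>[j] ?g) \<triangleright>[?p] theta T W"
      using pcell_nested[OF cide_cell[OF sf(1)] cide_cell[OF sg(1)] th sf(4) gc[OF sv(3)]]
        pcell_cide[OF fc[OF sg(3)] sg(1)] by simp
    then show ?thesis
      using whisker_exchange[OF H1 th, of ?p "TO Y"] sF(4) sv(3) pcell_ide_right[OF H1 sF(4)] by simp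
  qed
  have thF: "str ?p W Y ?F \<triangleright>[?p] theta T W \<in> cells C (str ?p W Y ?F \<odot>[?p] ?v) (str ?p W Y ?F)"
    using whisker_left_cell[OF th, of "str ?p W Y ?F" ?p "TO Y"] sF(4) sv(3) pcomp_ide_right[OF sF(4)] by simp
  note ty = ty cellsD(1-3)[OF thF]
  have "?K \<cdot> str2 ?p W Y ?A = ?Th \<cdot> ((?H3 \<cdot> ?H4 \<cdot> str2 ?p W Y (?H1 \<triangleleft>[?p] ?u)) \<cdot> str2 ?p W Y (tilde ?p W Y ?F))"
    unfolding sA' using ty by (simp add: vcomp_assoc' vcomp_Cell)
  also have "\<dots> = ?Th \<cdot> (?H1 \<triangleleft>[?p] ?v) \<cdot> (?H2 \<cdot> str2 ?p W Y (tilde ?p W Y ?F))"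
    unfolding ax[symmetric] using ty by (simp add: vcomp_assoc' vcomp_Cell)
  also have "\<dots> = ?H1 \<cdot> ((str ?p W Y ?F \<triangleright>[?p] theta T W) \<cdot> ?H2 \<cdot> str2 ?p W Y (tilde ?p W Y ?F))"
    unfolding ThH using ty by (simp add: vcomp_assoc' vcomp_Cell)
  \<comment> \<open>Here \<open>hat_unit\<close> is applied to the composite \<open>?F\<close>; in
    the second chain it is applied to \<open>g\<close>, after naturality of t-hat in its inner
    variable.\<close>
  also have "\<dots> = ?H1"
    using hat_unit[OF W Y F] H1 by simp
  finally have KA: "?K \<cdot> str2 ?p W Y ?A = ?H1" .
  have gt: "str2 k W X (tilde k W X g) \<in> cells C ?g (str k W X (?g \<odot>[k] ?u))"
    by (rule str2_cell[OF W X g tilde_cell'[OF W X g]])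
  have nat: "?H4 \<cdot> str2 ?p W Y ?B = (?f \<triangleright>[j] str2 k W X (tilde k W X g)) \<cdot> ?H1"
    using hat_natural[OF W X Y f g cide_cell[OF hom_atD(1)[OF f]] tilde_cell'[OF W X g]]
      str2_cide[OF X Y f] by simp
  note fgt = whisker_left_cell[OF gt fc[OF sg(3)]]
  note ty = ty cellsD(1-3)[OF fgt]
  note hi = iso_cellsD(1)[OF h] and ti = iso_cellsD(1)[OF thc]
  have "?K \<cdot> str2 ?p W Y ?B = ?Th \<cdot> (?H3 \<cdot> (?H4 \<cdot> str2 ?p W Y ?B))"
    using ty by (simp add: vcomp_assoc' vcomp_Cell)
  also have "\<dots> = (?Th \<cdot> (?H3 \<cdot> (?f \<triangleright>[j] str2 k W X (tilde k W X g)))) \<cdot> ?H1"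
    unfolding nat using ty by (simp add: vcomp_assoc' vcomp_Cell)
  also have "?Th \<cdot> (?H3 \<cdot> (?f \<triangleright>[j] str2 k W X (tilde k W X g)))
      = ?f \<triangleright>[j] (?th \<cdot> (?h \<cdot> str2 k W X (tilde k W X g)))"
    using whisker_left_vcomp[OF gt hi fc[OF sg(3)]]
      whisker_left_vcomp[OF vcomp_cell[OF gt hi] ti fc[OF sg(3)]] by simp
  also have "?th \<cdot> (?h \<cdot> str2 k W X (tilde k W X g)) = CIde C ?g"
    using hat_unit[OF W X g] vcomp_assoc[OF gt hi ti] by simp
  also have "?f \<triangleright>[j] CIde C ?g = CIde C (?f \<odot>[j] ?g)"
    by (rule pcell_cide[OF fc[OF sg(3)] sg(1)])
  finally have KB: "?K \<cdot> str2 ?p W Y ?B = ?H1" using H1 by simp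
  show ?thesis
    using iso_cells_cancel_left[OF K sA sB] KA KB str2_faithful[OF W Y F A B] by simp
qed

text \<open>Both \<alpha> and \<beta> are kept general because gamma meets t-hat on either side: as
  \<alpha> in \<open>gam_hat_s\<close> and \<open>gam_nat_X\<close>, as \<beta> in
  \<open>gam_nat_Z\<close>.\<close>

lemma restr_hat:
  assumes W: "W \<in> Obj D" and X: "X \<in> Obj D" and Y: "Y \<in> Obj D"
    and f: "f \<in> hom_at C j (JO X) (TO Y)" and g: "g \<in> hom_at C k (JO W) (TO X)"
    and a: "\<alpha> \<in> cells C (str j X Y f) h" and b: "\<beta> \<in> cells C (str k W X g) g'"
  shows "restr (j + k) W Y (str j X Y f \<odot>[j] g) ((\<alpha> \<boxdot>[j] \<beta>) \<cdot> hat j k W X Y f g)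
    = \<alpha> \<boxdot>[j] restr k W X g \<beta>"
proof -
  note sf = str_type[OF X Y f] and sg = str_type[OF W X g]
  have F: "str j X Y f \<odot>[j] g \<in> hom_at C (j + k) (JO W) (TO Y)" by (rule pcomp_hom_at_inner[OF sf(4) g])
  have c: "str j X Y f \<in> hom_at C j (Cod C (str k W X g)) (TO Y)" "str j X Y f \<in> hom_at C j (Cod C g) (TO Y)"
    using sf sg g by (auto simp: hom_at_def)
  have "restr (j + k) W Y (str j X Y f \<odot>[j] g) ((\<alpha> \<boxdot>[j] \<beta>) \<cdot> hat j k W X Y f g)
     = ((\<alpha> \<boxdot>[j] \<beta>) \<triangleleft>[j + k] i W) \<cdot> (str j X Y f \<triangleright>[j] tilde k W X g)"
    using restr_vcomp[OF W Y F hat_cell'[OF W X Y f g] pcell_cell[OF a b c(1)]]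
      hat_tilde[OF W X Y f g] by simp
  also have "(\<alpha> \<boxdot>[j] \<beta>) \<triangleleft>[j + k] i W = \<alpha> \<boxdot>[j] (\<beta> \<triangleleft>[k] i W)"
    using pcell_nested[OF a b cide_cell[OF unit_type(1)[OF W]] sf(4) unit_pcomp_cong[OF W sg(4)]] by simp
  also have "\<dots> \<cdot> (str j X Y f \<triangleright>[j] tilde k W X g) = \<alpha> \<boxdot>[j] restr k W X g \<beta>"
    unfolding restr_def
    using pcell_vcomp[OF cide_cell[OF sf(1)] a tilde_cell'[OF W X g] str_whisker_unit_cell[OF W X g b] c(2)]
      vcomp_cideR[OF a] by simp
  finally show ?thesis .
qed

section \<open>Types of the unary maps \<open>J u\<close> and \<open>T u\<close>\<close>

lemma J_hom:
  assumes "u \<in> hom D [X'] X"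
  shows "X' \<in> Obj D" "X \<in> Obj D" "on_mor J u \<in> Mor C" "Dom C (on_mor J u) = [JO X']"
    "Cod C (on_mor J u) = JO X" "on_mor J u \<in> hom_at C 0 (JO X') (JO X)"
  using J.fun_mor[OF assms] D.dom_obj[of u] D.cod_obj[of u] assms by (auto simp: hom_def hom_at_def)

lemma unit_J:
  assumes "u \<in> hom D [X'] X"
  shows "i X \<odot>[0] on_mor J u \<in> hom_at C 0 (JO X') (TO X)" "i X \<odot>[0] on_mor J u \<in> Mor C"
    "Dom C (i X \<odot>[0] on_mor J u) = [JO X']" "Cod C (i X \<odot>[0] on_mor J u) = TO X"
    "T_map X' X u \<in> hom_at C 0 (TO X') (TO X)" "T_map X' X u \<in> Mor C"
    "Dom C (T_map X' X u) = [TO X']" "Cod C (T_map X' X u) = TO X"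
proof -
  note u = J_hom[OF assms]
  note i = unit_type[OF u(2)]
  show 1: "i X \<odot>[0] on_mor J u \<in> hom_at C 0 (JO X') (TO X)"
    using pcomp_hom_at_inner[OF i(4) u(6)] by simp
  show "i X \<odot>[0] on_mor J u \<in> Mor C" "Cod C (i X \<odot>[0] on_mor J u) = TO X" using hom_atD[OF 1] by auto
  show 2: "Dom C (i X \<odot>[0] on_mor J u) = [JO X']"
    using pcomp_type[of "i X" 0 "on_mor J u" "TO X"] i u by simp
  note str_type[OF u(1,2) 1]
  then show "T_map X' X u \<in> hom_at C 0 (TO X') (TO X)" "T_map X' X u \<in> Mor C"
    "Dom C (T_map X' X u) = [TO X']" "Cod C (T_map X' X u) = TO X"
    using 2 by auto
qed

end

section \<open>The pseudocommutativity\<close>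

context lax_idempotent_strong_relative_pseudomonad
begin

text \<open>A 2-cell is recovered from its transpose by strengthening it and composing with the
  counit: naturality of the counit moves the 2-cell out, and the triangle identity for the
  strengthening removes the rest.\<close>

lemma str_ext:
  assumes "X \<in> Obj D" "Y \<in> Obj D" "f \<in> hom_at C j (JO X) (TO Y)"
    "\<alpha> \<in> cells C (str j X Y f) h" "\<beta> \<in> cells C (str j X Y f) h"
    "restr j X Y f \<alpha> = restr j X Y f \<beta>"
  shows "\<alpha> = \<beta>"
proof -
  have *: "\<delta> = \<tau> j X Y h \<cdot> str2 j X Y (restr j X Y f \<delta>)" if d: "\<delta> \<in> cells C (str j X Y f) h" for \<delta>
  proof -
    note sf = str_type[OF assms(1-3)] and t = tilde_cell'[OF assms(1-3)]
    note h = cells_hom_at[OF d sf(4)]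
    note f' = hom_at_unit[OF assms(1) sf(4)]
    note du = str_whisker_unit_cell[OF assms(1-3) d]
    note sd = str2_cell[OF assms(1,2) f' du] and st = str2_cell[OF assms(1-3) t]
      and ch = counit_cell[OF assms(1,2) h] and cs = counit_cell[OF assms(1,2) sf(4)]
    have "\<tau> j X Y h \<cdot> str2 j X Y (restr j X Y f \<delta>)
        = \<tau> j X Y h \<cdot> (str2 j X Y (\<delta> \<triangleleft>[j] i X) \<cdot> str2 j X Y (tilde j X Y f))"
      unfolding restr_def using str2_vcomp[OF assms(1-3) t du] by simp
    also have "\<dots> = \<tau> j X Y h \<cdot> str2 j X Y (\<delta> \<triangleleft>[j] i X) \<cdot> str2 j X Y (tilde j X Y f)"
      by (rule vcomp_assoc[OF st sd ch])
    also have "\<tau> j X Y h \<cdot> str2 j X Y (\<delta> \<triangleleft>[j] i X) = \<delta> \<cdot> \<tau> j X Y (str j X Y f)"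
      by (rule counit_natural[OF assms(1,2) sf(4) d])
    also have "\<dots> \<cdot> str2 j X Y (tilde j X Y f) = \<delta> \<cdot> (\<tau> j X Y (str j X Y f) \<cdot> str2 j X Y (tilde j X Y f))"
      by (rule vcomp_assoc[OF st cs d, symmetric])
    also have "\<dots> = \<delta>" using triangle_str[OF assms(1-3)] d by simp
    finally show ?thesis by simp
  qed
  show ?thesis using *[OF assms(4)] *[OF assms(5)] assms(6) by simp
qed

section \<open>The candidate for gamma, its transpose and its inverse\<close>

text \<open>This is the inverse transpose of pseudonaturality after the strengthened t-tilde. The
  strengthening of that composite is split into two factors to agree with the prescribed
  formula.\<close>

definition gam :: "nat \<Rightarrow> nat \<Rightarrow> 'p \<Rightarrow> 'p \<Rightarrow> 'p \<Rightarrow> 'm \<Rightarrow> 'c" where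
  "gam j k X Y Z f = \<tau> j X Z (str k Y Z (str j X Z f))
     \<cdot> str2 j X Z (nat_iso k Y Z j (str j X Z f) (i X)) \<cdot> str2 j X Z (str2 k Y Z (tilde j X Z f))"

text \<open>The triangle identity on the restricted side turns the formula into a characterisation
  by the transpose. The later lemmas use \<open>gam\<close> through it, and the formula returns only
  when the final statement is read off.\<close>

lemma gam_cell_restr:
  assumes X: "X \<in> Obj D" and Y: "Y \<in> Obj D" and Z: "Z \<in> Obj D"
    and f: "f \<in> hom_at C j (JO X) (TO Z)" "f \<in> hom_at C k (JO Y) (TO Z)" and jk: "j \<noteq> k"
  shows "gam j k X Y Z f \<in> cells C (str j X Z (str k Y Z f)) (str k Y Z (str j X Z f))"
    "restr j X Z (str k Y Z f) (gam j k X Y Z f)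
      = nat_iso k Y Z j (str j X Z f) (i X) \<cdot> str2 k Y Z (tilde j X Z f)"
proof -
  note s = str_type(4)[OF X Z f(1)] str_hom_at_other[OF X Z f jk[symmetric]]
  note t = str_type(4)[OF Y Z f(2)] str_hom_at_other[OF Y Z f(2,1) jk]
  have st: "str k Y Z (str j X Z f) \<in> hom_at C j (TO X) (TO Z)"
    by (rule str_hom_at_other[OF Y Z s(2,1) jk])
  note n = nat_unit_cell[OF Y Z X s(2,1) jk]
  note tt = str2_cell[OF Y Z f(2) tilde_cell'[OF X Z f(1)]]
  let ?\<phi> = "nat_iso k Y Z j (str j X Z f) (i X) \<cdot> str2 k Y Z (tilde j X Z f)"
  have \<phi>: "?\<phi> \<in> cells C (str k Y Z f) (str k Y Z (str j X Z f) \<odot>[j] i X)"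
    by (rule vcomp_cell[OF tt n])
  note c = counit_cell[OF X Z st]
  have u: "str k Y Z (str j X Z f \<odot>[j] i X) \<in> hom_at C j (JO X) (TO Z)"
    by (rule cells_hom_at[OF tt t(2)])
  note s1 = str2_cell[OF X Z t(2) tt] and s2 = str2_cell[OF X Z u n]
  have e: "gam j k X Y Z f = \<tau> j X Z (str k Y Z (str j X Z f)) \<cdot> str2 j X Z ?\<phi>"
    unfolding gam_def str2_vcomp[OF X Z t(2) tt n] by (rule vcomp_assoc[OF s1 s2 c, symmetric])
  show "gam j k X Y Z f \<in> cells C (str j X Z (str k Y Z f)) (str k Y Z (str j X Z f))"
    unfolding e by (rule vcomp_cell[OF str2_cell[OF X Z t(2) \<phi>] c])
  show "restr j X Z (str k Y Z f) (gam j k X Y Z f) = ?\<phi>"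
    unfolding e restr_str2[OF X Z t(2) \<phi> c]
    using triangle_unit[OF X Z st] \<phi> by (simp add: restr_def)
qed

lemmas gam_cell = gam_cell_restr(1)
lemmas restr_gam = gam_cell_restr(2)

text \<open>Many of the conditions contain gamma followed by a 2-cell strengthened in position
  \<open>k\<close>. Pseudonaturality at the unit is natural in the strengthened map, so
  transposition in position \<open>j\<close> passes through gamma and acts on \<alpha> underneath
  the strengthening in position \<open>k\<close>.\<close>

lemma restr_str2_gam:
  assumes X: "X \<in> Obj D" and Y: "Y \<in> Obj D" and Z: "Z \<in> Obj D"
    and f: "f \<in> hom_at C j (JO X) (TO Z)" "f \<in> hom_at C k (JO Y) (TO Z)" and jk: "j \<noteq> k"
    and a: "\<alpha> \<in> cells C (str j X Z f) h"
  shows "restr j X Z (str k Y Z f) (str2 k Y Z \<alpha> \<cdot> gam j k X Y Z f)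
    = nat_iso k Y Z j h (i X) \<cdot> str2 k Y Z (restr j X Z f \<alpha>)"
proof -
  note s = str_type(4)[OF X Z f(1)] str_hom_at_other[OF X Z f jk[symmetric]]
  note t = str_type(4)[OF Y Z f(2)] str_hom_at_other[OF Y Z f(2,1) jk]
  note h = cells_hom_at[OF a s(1)] cells_hom_at[OF a s(2)]
  note n = nat_unit_cell[OF Y Z X s(2,1) jk] and nh = nat_unit_cell[OF Y Z X h(2,1) jk]
  note tl = tilde_cell'[OF X Z f(1)] and au = str_whisker_unit_cell[OF X Z f(1) a]
  note tt = str2_cell[OF Y Z f(2) tl]
  note sa = str2_cell[OF Y Z s(2) a] and sau = str2_cell[OF Y Z hom_at_unit_other[OF X s jk] au]
  have sh: "str k Y Z (str j X Z f) \<in> hom_at C j (TO X) (TO Z)"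
    by (rule str_hom_at_other[OF Y Z s(2,1) jk])
  note sau' = whisker_right_cell[OF sa unit_pcomp_cong[OF X sh] unit_type(1)[OF X]]
  have nat: "nat_iso k Y Z j h (i X) \<cdot> str2 k Y Z (\<alpha> \<triangleleft>[j] i X)
      = (str2 k Y Z \<alpha> \<triangleleft>[j] i X) \<cdot> nat_iso k Y Z j (str j X Z f) (i X)"
    using nat_iso_natural'[OF Y Z s(2) unit_pcomp_cong[OF X s(1)] jk a cide_cell] unit_type[OF X] by simp
  have "restr j X Z (str k Y Z f) (str2 k Y Z \<alpha> \<cdot> gam j k X Y Z f)
      = (str2 k Y Z \<alpha> \<triangleleft>[j] i X) \<cdot> (nat_iso k Y Z j (str j X Z f) (i X) \<cdot> str2 k Y Z (tilde j X Z f))"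
    using restr_vcomp[OF X Z t(2) gam_cell[OF X Y Z f jk] sa] restr_gam[OF X Y Z f jk] by simp
  also have "\<dots> = nat_iso k Y Z j h (i X) \<cdot> str2 k Y Z (\<alpha> \<triangleleft>[j] i X) \<cdot> str2 k Y Z (tilde j X Z f)"
    unfolding nat by (rule vcomp_assoc[OF tt n sau'])
  also have "\<dots> = nat_iso k Y Z j h (i X) \<cdot> str2 k Y Z (restr j X Z f \<alpha>)"
    unfolding restr_def str2_vcomp[OF Y Z f(2) tl au]
    by (rule vcomp_assoc[OF tt sau nh, symmetric])
  finally show ?thesis .
qed

lemma restr_nat_iso_unit:
  assumes X: "X \<in> Obj D" and Y: "Y \<in> Obj D" and Z: "Z \<in> Obj D"
    and f: "f \<in> hom_at C j (JO X) (TO Z)" "f \<in> hom_at C k (TO Y) (TO Z)" and jk: "j \<noteq> k"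
  shows "restr j X Z (f \<odot>[k] i Y) (nat_iso j X Z k f (i Y)) = tilde j X Z f \<triangleleft>[k] i Y"
  unfolding restr_def
  using tilde_subst'[OF X Z f(1) unit_pcomp_cong[OF Y f(2)] jk[symmetric]] unit_type[OF Y] by simp

text \<open>The transpose in position \<open>j\<close> is again a 2-cell out of a strengthening, now
  in position \<open>k\<close>, and can be transposed once more. What remains starts at
  \<open>f\<close>, where the two unit 2-cells can be introduced in either order.\<close>

lemma gam_gam:
  assumes X: "X \<in> Obj D" and Y: "Y \<in> Obj D" and Z: "Z \<in> Obj D"
    and f: "f \<in> hom_at C j (JO X) (TO Z)" "f \<in> hom_at C k (JO Y) (TO Z)" and jk: "j \<noteq> k"
  shows "gam k j Y X Z f \<cdot> gam j k X Y Z f = CIde C (str j X Z (str k Y Z f))"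
proof -
  let ?s = "str j X Z f" and ?t = "str k Y Z f" and ?d = "gam k j Y X Z f" and ?g = "gam j k X Y Z f"
  note kj = jk[symmetric]
  note s = str_type(4)[OF X Z f(1)] str_hom_at_other[OF X Z f kj]
  note t = str_type(4)[OF Y Z f(2)] str_hom_at_other[OF Y Z f(2,1) jk]
  have st: "str k Y Z ?s \<in> hom_at C j (TO X) (TO Z)" by (rule str_hom_at_other[OF Y Z s(2,1) jk])
  note ts = str_type[OF X Z t(2)]
  note g = gam_cell[OF X Y Z f jk] and d = gam_cell[OF Y X Z f(2,1) kj]
  note tl = tilde_cell'[OF X Z f(1)] and tl2 = tilde_cell'[OF Y Z f(2)]
  note n = nat_unit_cell[OF Y Z X s(2,1) jk] and n2 = nat_unit_cell[OF X Z Y t(2,1) kj]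
  note tt = str2_cell[OF Y Z f(2) tl]
  let ?n = "nat_iso k Y Z j ?s (i X)"
  note du = whisker_right_cell[OF d unit_pcomp_cong[OF X st] unit_type(1)[OF X]]
  have "restr j X Z ?t (?d \<cdot> ?g) = (?d \<triangleleft>[j] i X) \<cdot> (?n \<cdot> str2 k Y Z (tilde j X Z f))"
    using restr_vcomp[OF X Z t(2) g d] restr_gam[OF X Y Z f jk] by simp
  also have "\<dots> = (?d \<triangleleft>[j] i X) \<cdot> ?n \<cdot> str2 k Y Z (tilde j X Z f)" (is "_ = ?E")
    by (rule vcomp_assoc[OF tt n du])
  also have "\<dots> = tilde j X Z ?t"
  proof (rule str_ext[OF Y Z f(2)])
    show "?E \<in> cells C ?t (str j X Z ?t \<odot>[j] i X)" by (rule vcomp_cell[OF tt vcomp_cell[OF n du]])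
    show "tilde j X Z ?t \<in> cells C ?t (str j X Z ?t \<odot>[j] i X)" by (rule tilde_cell'[OF X Z t(2)])
    have rd: "restr k Y Z (?s \<odot>[j] i X) ((?d \<triangleleft>[j] i X) \<cdot> ?n) = restr k Y Z ?s ?d \<triangleleft>[j] i X"
      using restr_nat[OF Y Z s(2) unit_pcomp_cong[OF X s(1)] jk unit_type(1)[OF X] d] unit_type[OF X] by simp
    have "restr k Y Z f ?E = restr k Y Z (?s \<odot>[j] i X) ((?d \<triangleleft>[j] i X) \<cdot> ?n) \<cdot> tilde j X Z f"
      by (rule restr_str2[OF Y Z f(2) tl vcomp_cell[OF n du]])
    \<comment> \<open>The transpose of \<open>?d\<close> starts at the strengthening of
      \<open>f\<close> in position \<open>j\<close>. Whiskered by \<open>i X\<close> and composed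
      with t-tilde it is thus a transpose in position \<open>j\<close>, and the roles of the two
      positions have been exchanged.\<close>
    also have "\<dots> = restr j X Z f (restr k Y Z ?s ?d)"
      unfolding rd by (simp add: restr_def[of j])
    also have "restr k Y Z ?s ?d = nat_iso j X Z k ?t (i Y) \<cdot> str2 j X Z (tilde k Y Z f)"
      by (rule restr_gam[OF Y X Z f(2,1) kj])
    also have "restr j X Z f \<dots> = restr j X Z (?t \<odot>[k] i Y) (nat_iso j X Z k ?t (i Y)) \<cdot> tilde k Y Z f"
      by (rule restr_str2[OF X Z f(1) tl2 n2])
    also have "\<dots> = restr k Y Z f (tilde j X Z ?t)"
      using restr_nat_iso_unit[OF X Y Z t(2,1) jk] by (simp add: restr_def)
    finally show "restr k Y Z f ?E = restr k Y Z f (tilde j X Z ?t)" .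
  qed
  also have "\<dots> = restr j X Z ?t (CIde C (str j X Z ?t))"
    by (rule restr_cide[OF X Z t(2), symmetric])
  finally show ?thesis
    using str_ext[OF X Z t(2) vcomp_cell[OF g d] cide_cell[OF ts(1)]] by simp
qed

lemma gam_iso:
  assumes "X \<in> Obj D" "Y \<in> Obj D" "Z \<in> Obj D"
    and "f \<in> hom_at C j (JO X) (TO Z)" "f \<in> hom_at C k (JO Y) (TO Z)" "j \<noteq> k"
  shows "gam j k X Y Z f \<in> iso_cells C (str j X Z (str k Y Z f)) (str k Y Z (str j X Z f))"
  using iso_cellsI[OF gam_cell[OF assms] gam_cell gam_gam[OF assms] gam_gam] assms by blast

section \<open>Naturality of gamma and substitution in a third argument\<close>

text \<open>Both transposes are pseudonaturality after the strengthening in position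
  \<open>k\<close> of one 2-cell, t-tilde after \<alpha>; naturality of t-tilde identifies the two
  forms of it.\<close>

lemma gam_natural:
  assumes X: "X \<in> Obj D" and Y: "Y \<in> Obj D" and Z: "Z \<in> Obj D"
    and f: "f \<in> hom_at C j (JO X) (TO Z)" "f \<in> hom_at C k (JO Y) (TO Z)" and jk: "j \<noteq> k"
    and a: "\<alpha> \<in> cells C f f'"
  shows "gam j k X Y Z f' \<cdot> str2 j X Z (str2 k Y Z \<alpha>) = str2 k Y Z (str2 j X Z \<alpha>) \<cdot> gam j k X Y Z f"
proof -
  note kj = jk[symmetric]
  note s = str_type(4)[OF X Z f(1)] str_hom_at_other[OF X Z f kj]
  note t = str_type(4)[OF Y Z f(2)] str_hom_at_other[OF Y Z f(2,1) jk]
  note f' = cells_hom_at[OF a f(1)] cells_hom_at[OF a f(2)]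
  note s' = str_type(4)[OF X Z f'(1)] str_hom_at_other[OF X Z f' kj]
  note ta = str2_cell[OF Y Z f(2) a] and sa = str2_cell[OF X Z f(1) a]
  note g = gam_cell[OF X Y Z f jk] and g' = gam_cell[OF X Y Z f' jk]
  note tl' = tilde_cell'[OF X Z f'(1)]
  note n = nat_unit_cell[OF Y Z X s'(2,1) jk]
  note st = str2_cell[OF Y Z f'(2) tl']
  have "restr j X Z (str k Y Z f) (gam j k X Y Z f' \<cdot> str2 j X Z (str2 k Y Z \<alpha>))
      = nat_iso k Y Z j (str j X Z f') (i X) \<cdot> str2 k Y Z (tilde j X Z f') \<cdot> str2 k Y Z \<alpha>"
    using restr_str2[OF X Z t(2) ta g'] restr_gam[OF X Y Z f' jk] by simp
  also have "\<dots> = nat_iso k Y Z j (str j X Z f') (i X) \<cdot> (str2 k Y Z (tilde j X Z f') \<cdot> str2 k Y Z \<alpha>)"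
    by (rule vcomp_assoc[OF ta st n, symmetric])
  also have "str2 k Y Z (tilde j X Z f') \<cdot> str2 k Y Z \<alpha> = str2 k Y Z (tilde j X Z f' \<cdot> \<alpha>)"
    by (rule str2_vcomp[OF Y Z f(2) a tl', symmetric])
  also have "tilde j X Z f' \<cdot> \<alpha> = restr j X Z f (str2 j X Z \<alpha>)"
    unfolding restr_def by (rule tilde_natural[OF X Z f(1) a])
  also have "nat_iso k Y Z j (str j X Z f') (i X) \<cdot> str2 k Y Z (restr j X Z f (str2 j X Z \<alpha>))
     = restr j X Z (str k Y Z f) (str2 k Y Z (str2 j X Z \<alpha>) \<cdot> gam j k X Y Z f)"
    by (rule restr_str2_gam[OF X Y Z f jk sa, symmetric])
  finally show ?thesis
    using str_ext[OF X Z t(2) vcomp_cell[OF str2_cell[OF X Z t(2) ta] g'] vcomp_cell[OF g str2_cell[OF Y Z s(2) sa]]]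
    by simp
qed

text \<open>After transposition the unit is substituted in position \<open>j\<close> and
  \<open>g\<close> in position \<open>l\<close>. The claim becomes independence of the order of
  these substitutions, together with naturality of pseudonaturality along t-tilde.\<close>

lemma gam_subst:
  assumes X: "X \<in> Obj D" and Y: "Y \<in> Obj D" and Z: "Z \<in> Obj D"
    and f: "f \<in> hom_at C j (JO X) (TO Z)" "f \<in> hom_at C k (JO Y) (TO Z)" and jk: "j \<noteq> k"
    and fl: "f \<in> hom_at C l (Cod C g) (TO Z)" and l: "l \<noteq> j" "l \<noteq> k" and g: "g \<in> Mor C"
    and j': "j' = shift l (arity g) j" and k': "k' = shift l (arity g) k"
  shows "nat_iso k Y Z l (str j X Z f) g \<cdot> str2 k' Y Z (nat_iso j X Z l f g) \<cdot> gam j' k' X Y Z (f \<odot>[l] g)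
    = (gam j k X Y Z f \<triangleleft>[l] g) \<cdot> nat_iso j X Z l (str k Y Z f) g \<cdot> str2 j' X Z (nat_iso k Y Z l f g)"
proof -
  let ?s = "str j X Z f" and ?t = "str k Y Z f" and ?fg = "f \<odot>[l] g"
  let ?N = "nat_iso k Y Z l ?s g" and ?S = "nat_iso j X Z l f g" and ?G = "gam j' k' X Y Z ?fg"
  let ?g = "gam j k X Y Z f" and ?P = "nat_iso j X Z l ?t g" and ?M = "nat_iso k Y Z l f g"
  let ?u = "nat_iso k Y Z j ?s (i X)" and ?x = "tilde j X Z f"
  have j'k': "j' \<noteq> k'" unfolding j' k' using shift_neq jk l by metis
  note kj = jk[symmetric] and iX = unit_type[OF X]
  note s = str_type(4)[OF X Z f(1)] str_hom_at_other[OF X Z f kj] str_hom_at_other[OF X Z f(1) fl l(1)]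
  note t = str_type(4)[OF Y Z f(2)] str_hom_at_other[OF Y Z f(2,1) jk] str_hom_at_other[OF Y Z f(2) fl l(2)]
  note fg = pcomp_hom_at_outer[OF fl f(1) l(1) g, folded j'] pcomp_hom_at_outer[OF fl f(2) l(2) g, folded k']
  note tfg = str_hom_at_other[OF Y Z fg(2,1) j'k']
  note sfg = str_hom_at_other[OF X Z fg j'k'[symmetric]]
  note sg = pcomp_hom_at_outer[OF s(3,1) l(1) g, folded j'] pcomp_hom_at_outer[OF s(3,2) l(2) g, folded k']
  note cS = nat_cell[OF X Z f(1) fl l(1) g, folded j'] and cM = nat_cell[OF Y Z f(2) fl l(2) g, folded k']
  note cN = nat_cell[OF Y Z s(2,3) l(2) g, folded k'] and cP = nat_cell[OF X Z t(2,3) l(1) g, folded j']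
  note cG = gam_cell[OF X Y Z fg j'k'] and cg = gam_cell[OF X Y Z f jk]
  note cSS = str2_cell[OF Y Z sfg cS] and cMM = str2_cell[OF X Z tfg cM]
  have ts: "str j X Z ?t \<in> hom_at C l (Cod C g) (TO Z)" by (rule str_hom_at_other[OF X Z t(2,3) l(1)])
  note cgg = whisker_right_cell[OF cg ts g]
  note cx = tilde_cell'[OF X Z f(1)] note cxt = str2_cell[OF Y Z f(2) cx]
  note cu = nat_unit_cell[OF Y Z X s(2,1) jk]
  have su: "?s \<odot>[j] i X \<in> hom_at C l (Cod C g) (TO Z)" "?s \<odot>[j] i X \<in> hom_at C k (JO Y) (TO Z)"
    using hom_at_unit_other[OF X s(1,3) l(1)[symmetric]] hom_at_unit_other[OF X s(1,2) jk] by auto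
  have su1: "str k Y Z (?s \<odot>[j] i X) \<in> hom_at C l (Cod C g) (TO Z)"
    by (rule str_hom_at_other[OF Y Z su(2,1) l(2)])
  note cug = whisker_right_cell[OF cu su1 g]
  note cxg = whisker_right_cell[OF cx fl g] and cxtg = whisker_right_cell[OF cxt t(3) g]
  have par: "(?s \<odot>[j] i X) \<odot>[l] g = (?s \<odot>[l] g) \<odot>[j'] i X"
    using pcomp_parallel[OF s(3) unit_pcomp_cong[OF X s(1)] l(1) g iX(1)] j' iX by simp
  note csxg = str2_cell[OF Y Z fg(2) cxg[unfolded par]]
  have cn1: "nat_iso k' Y Z j' (?s \<odot>[l] g) (i X)
      \<in> cells C (str k' Y Z ((?s \<odot>[l] g) \<odot>[j'] i X)) (str k' Y Z (?s \<odot>[l] g) \<odot>[j'] i X)"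
    by (rule nat_unit_cell[OF Y Z X sg(2,1) j'k'])
  note cn2 = nat_cell[OF Y Z su(2,1) l(2) g, folded k', unfolded par]
  have ksg: "str k' Y Z (?s \<odot>[l] g) \<in> hom_at C j' (Cod C (i X)) (TO Z)"
    unfolding iX(3) by (rule str_hom_at_other[OF Y Z sg(2,1) j'k'])
  note cNi = whisker_right_cell[OF cN ksg iX(1)]
  note ty = cellsD(1-3)[OF cN] cellsD(1-3)[OF cSS] cellsD(1-3)[OF cG] cellsD(1-3)[OF cgg] cellsD(1-3)[OF cP]
    cellsD(1-3)[OF cMM] cellsD(1-3)[OF cug] cellsD(1-3)[OF cxtg] cellsD(1-3)[OF cM] cellsD(1-3)[OF cn1]
    cellsD(1-3)[OF cn2] cellsD(1-3)[OF cNi] cellsD(1-3)[OF csxg]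
  \<comment> \<open>This is the parallel axiom for the strengthening in position \<open>k\<close>,
    with the unit and \<open>g\<close> in the two remaining arguments.\<close>
  have pn: "(?N \<triangleleft>[j'] i X) \<cdot> nat_iso k' Y Z j' (?s \<odot>[l] g) (i X)
      = (?u \<triangleleft>[l] g) \<cdot> nat_iso k Y Z l (?s \<odot>[j] i X) g"
    using nat_iso_parallel'[OF Y Z s(2) unit_pcomp_cong[OF X s(1)] s(3) jk l(2) l(1)[symmetric] iX(1) g]
    by (simp add: iX j' k')
  have nn: "nat_iso k Y Z l (?s \<odot>[j] i X) g \<cdot> str2 k' Y Z (?x \<triangleleft>[l] g) = (str2 k Y Z ?x \<triangleleft>[l] g) \<cdot> ?M"
    unfolding k' by (rule nat_iso_natural'[OF Y Z f(2) fl l(2) cx cide_cell[OF g]])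
  have "restr j' X Z (str k' Y Z ?fg) (?N \<cdot> str2 k' Y Z ?S \<cdot> ?G)
      = restr j' X Z (str k' Y Z ?fg) (?N \<cdot> (str2 k' Y Z ?S \<cdot> ?G))"
    using ty by (simp add: vcomp_assoc')
  also have "\<dots> = (?N \<triangleleft>[j'] i X) \<cdot> (nat_iso k' Y Z j' (?s \<odot>[l] g) (i X) \<cdot> str2 k' Y Z (?x \<triangleleft>[l] g))"
    unfolding restr_vcomp[OF X Z tfg vcomp_cell[OF cG cSS] cN] restr_str2_gam[OF X Y Z fg j'k' cS]
    using tilde_subst'[OF X Z f(1) fl l(1) g] by (simp add: restr_def j')
  also have "\<dots> = (?N \<triangleleft>[j'] i X) \<cdot> nat_iso k' Y Z j' (?s \<odot>[l] g) (i X) \<cdot> str2 k' Y Z (?x \<triangleleft>[l] g)"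
    using ty by (simp add: vcomp_assoc')
  also have "\<dots> = (?u \<triangleleft>[l] g) \<cdot> (nat_iso k Y Z l (?s \<odot>[j] i X) g \<cdot> str2 k' Y Z (?x \<triangleleft>[l] g))"
    unfolding pn using ty by (simp add: vcomp_assoc')
  also have "\<dots> = (?u \<triangleleft>[l] g) \<cdot> (str2 k Y Z ?x \<triangleleft>[l] g) \<cdot> ?M"
    unfolding nn using ty by (simp add: vcomp_assoc')
  also have "\<dots> = (restr j X Z ?t ?g \<triangleleft>[l] g) \<cdot> ?M"
    unfolding restr_gam[OF X Y Z f jk] whisker_right_vcomp[OF cxt cu t(3) g] ..
  also have "\<dots> = restr j' X Z (str k' Y Z ?fg) ((?g \<triangleleft>[l] g) \<cdot> ?P \<cdot> str2 j' X Z ?M)"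
    unfolding restr_str2[OF X Z tfg cM vcomp_cell[OF cP cgg]]
    using restr_nat[OF X Z t(2,3) l(1) g cg] j' by simp
  finally show ?thesis
    by (rule str_ext[OF X Z tfg vcomp_cell[OF cG vcomp_cell[OF cSS cN]] vcomp_cell[OF cMM vcomp_cell[OF cP cgg]]])
qed

section \<open>Compatibility of gamma with t-tilde, with t-hat and with a third
  strengthening\<close>

text \<open>Once the inverse is moved to the other side, the left-hand side is the transpose of
  gamma, and the equation is \<open>restr_gam\<close>.\<close>

lemma gam_tilde_s:
  assumes X: "X \<in> Obj D" and Y: "Y \<in> Obj D" and Z: "Z \<in> Obj D"
    and f: "f \<in> hom_at C j (JO X) (TO Z)" "f \<in> hom_at C k (JO Y) (TO Z)" and jk: "j \<noteq> k"
  shows "inv_cell C (nat_iso k Y Z j (str j X Z f) (i X))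
      \<cdot> (gam j k X Y Z f \<triangleleft>[j] i X) \<cdot> tilde j X Z (str k Y Z f)
    = str2 k Y Z (tilde j X Z f)"
proof -
  note kj = jk[symmetric]
  note s = str_type(4)[OF X Z f(1)] str_hom_at_other[OF X Z f kj]
  note t = str_hom_at_other[OF Y Z f(2,1) jk]
  note u = nat_unit_iso[OF Y Z X s(2,1) jk] and g = gam_cell[OF X Y Z f jk]
  note x = str2_cell[OF Y Z f(2) tilde_cell'[OF X Z f(1)]]
  have "inv_cell C (nat_iso k Y Z j (str j X Z f) (i X)) \<cdot> restr j X Z (str k Y Z f) (gam j k X Y Z f)
      = str2 k Y Z (tilde j X Z f)"
    using inv_cell_vcomp_eq_iff[OF u restr_cell[OF X Z t g] x] restr_gam[OF X Y Z f jk] by blast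
  then show ?thesis
    unfolding restr_def
    using vcomp_assoc[OF tilde_cell'[OF X Z t] str_whisker_unit_cell[OF X Z t g] iso_cellsD(2)[OF u]] by simp
qed

text \<open>Restriction along \<open>i Y\<close> commutes with transposition in position
  \<open>j\<close>. The transpose of the left-hand side is therefore the transpose in position
  \<open>k\<close> of the transpose of gamma, and the symmetry of the two unit 2-cells used in
  \<open>gam_gam\<close> finishes.\<close>

lemma gam_tilde_t:
  assumes X: "X \<in> Obj D" and Y: "Y \<in> Obj D" and Z: "Z \<in> Obj D"
    and f: "f \<in> hom_at C j (JO X) (TO Z)" "f \<in> hom_at C k (JO Y) (TO Z)" and jk: "j \<noteq> k"
  shows "(gam j k X Y Z f \<triangleleft>[k] i Y) \<cdot> nat_iso j X Z k (str k Y Z f) (i Y) \<cdot> str2 j X Z (tilde k Y Z f)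
    = tilde k Y Z (str j X Z f)"
proof -
  let ?s = "str j X Z f" and ?t = "str k Y Z f" and ?g = "gam j k X Y Z f"
  note kj = jk[symmetric]
  note s = str_type(4)[OF X Z f(1)] str_hom_at_other[OF X Z f kj]
  note t = str_type(4)[OF Y Z f(2)] str_hom_at_other[OF Y Z f(2,1) jk]
  note ts = str_hom_at_other[OF X Z t(2,1) kj]
  note g = gam_cell[OF X Y Z f jk] and x = tilde_cell'[OF X Z f(1)] and y = tilde_cell'[OF Y Z f(2)]
  note n = nat_unit_cell[OF X Z Y t(2,1) kj] and u = nat_unit_cell[OF Y Z X s(2,1) jk]
  note gi = whisker_right_cell[OF g unit_pcomp_cong[OF Y ts] unit_type(1)[OF Y]]
  note sy = str2_cell[OF X Z f(1) y]
  have "restr j X Z f ((?g \<triangleleft>[k] i Y) \<cdot> nat_iso j X Z k ?t (i Y) \<cdot> str2 j X Z (tilde k Y Z f))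
      = restr j X Z (?t \<odot>[k] i Y) ((?g \<triangleleft>[k] i Y) \<cdot> nat_iso j X Z k ?t (i Y)) \<cdot> tilde k Y Z f"
    by (rule restr_str2[OF X Z f(1) y vcomp_cell[OF n gi]])
  also have "\<dots> = restr k Y Z f (restr j X Z ?t ?g)"
    using restr_nat[OF X Z t(2) unit_pcomp_cong[OF Y t(1)] kj unit_type(1)[OF Y] g] unit_type[OF Y]
    by (simp add: restr_def[of k])
  also have "\<dots> = restr k Y Z (?s \<odot>[j] i X) (nat_iso k Y Z j ?s (i X)) \<cdot> tilde j X Z f"
    unfolding restr_gam[OF X Y Z f jk] by (rule restr_str2[OF Y Z f(2) x u])
  also have "\<dots> = restr j X Z f (tilde k Y Z ?s)"
    unfolding restr_nat_iso_unit[OF Y X Z s(2,1) kj] by (simp add: restr_def)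
  finally show ?thesis
    by (rule str_ext[OF X Z f(1) vcomp_cell[OF sy vcomp_cell[OF n gi]] tilde_cell'[OF Y Z s(2)]])
qed

text \<open>The strengthened argument of t-hat is the one transposed, so t-hat turns into t-tilde at
  \<open>g\<close>. It remains to carry this t-tilde through the pseudonaturality of the other
  strengthening, by its naturality and its law for nested substitution.\<close>

lemma gam_hat_s:
  assumes W: "W \<in> Obj D" and X: "X \<in> Obj D" and Y: "Y \<in> Obj D" and Z: "Z \<in> Obj D"
    and f: "f \<in> hom_at C j (JO X) (TO Z)" "f \<in> hom_at C k (JO Y) (TO Z)" and jk: "j \<noteq> k"
    and g: "g \<in> hom_at C l (JO W) (TO X)" and k': "k' = shift j (arity g) k"
  shows "inv_cell C (nat_iso k Y Z j (str j X Z f) (str l W X g))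
              \<cdot> (gam j k X Y Z f \<triangleleft>[j] str l W X g) \<cdot> hat j l W X Z (str k Y Z f) g
            = str2 k' Y Z (hat j l W X Z f g)
              \<cdot> gam (j + l) k' W Y Z (str j X Z f \<odot>[j] g)
              \<cdot> str2 (j + l) W Z (inv_cell C (nat_iso k Y Z j (str j X Z f) g))
              \<cdot> str2 (j + l) W Z (gam j k X Y Z f \<triangleleft>[j] g)"
proof -
  let ?s = "str j X Z f" and ?t = "str k Y Z f" and ?g = "gam j k X Y Z f" and ?gs = "str l W X g"
  let ?p = "j + l" and ?F = "str j X Z f \<odot>[j] g" and ?H = "hat j l W X Z f g"
  let ?n = "nat_iso k Y Z j ?s g" and ?N = "nat_iso k Y Z j ?s ?gs" and ?z = "tilde l W X g"
  let ?st = "str k Y Z ?s" and ?ts = "str j X Z ?t" and ?G = "gam ?p k' W Y Z ?F"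
  note kj = jk[symmetric] and iW = unit_type[OF W]
  \<comment> \<open>Position \<open>j + l\<close> lies inside the block of arguments contributed by
    \<open>g\<close>, and \<open>k'\<close> lies outside it on either side.\<close>
  have pk: "?p \<noteq> k'" using jk g by (auto simp: k' shift_def hom_at_def)
  note g' = hom_atD[OF g]
  note s = str_type(4)[OF X Z f(1)] str_hom_at_other[OF X Z f kj]
  note t = str_type(4)[OF Y Z f(2)] str_hom_at_other[OF Y Z f(2,1) jk]
  have st: "?st \<in> hom_at C j (TO X) (TO Z)" by (rule str_hom_at_other[OF Y Z s(2,1) jk])
  note ts = str_type(4)[OF X Z t(2)]
  note gs = str_type[OF W X g]
  have ags: "arity ?gs = arity g" using gs(2) by simp
  have cg: "h \<in> hom_at C j (Cod C g) (TO Z)" if "h \<in> hom_at C j (TO X) (TO Z)" for h using that g' by simp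
  have cgs: "h \<in> hom_at C j (Cod C ?gs) (TO Z)" if "h \<in> hom_at C j (TO X) (TO Z)" for h using that gs by simp
  have F: "?F \<in> hom_at C ?p (JO W) (TO Z)" "?F \<in> hom_at C k' (JO Y) (TO Z)"
    using pcomp_hom_at_inner[OF s(1) g] pcomp_hom_at_outer[OF cg[OF s(1)] s(2) jk g'(1)] k' by auto
  have E: "?ts \<odot>[j] g \<in> hom_at C ?p (JO W) (TO Z)" by (rule pcomp_hom_at_inner[OF ts g])
  have FF: "?s \<odot>[j] ?gs \<in> hom_at C ?p (TO W) (TO Z)" "?s \<odot>[j] ?gs \<in> hom_at C k' (JO Y) (TO Z)"
    using pcomp_hom_at_inner[OF s(1) gs(4)] pcomp_hom_at_outer[OF cgs[OF s(1)] s(2) jk gs(1)] k' ags by auto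
  note tF = str_hom_at_other[OF Y Z F(2,1) pk] and sF = str_hom_at_other[OF W Z F pk[symmetric]]
  note z = tilde_cell'[OF W X g]
  have nI: "?n \<in> iso_cells C (str k' Y Z ?F) (?st \<odot>[j] g)"
    using nat_iso_cell'[OF Y Z s(2) cg[OF s(1)] jk g'(1)] k' by simp
  have NI: "?N \<in> iso_cells C (str k' Y Z (?s \<odot>[j] ?gs)) (?st \<odot>[j] ?gs)"
    using nat_iso_cell'[OF Y Z s(2) cgs[OF s(1)] jk gs(1)] k' ags by simp
  note n = iso_cellsD[OF nI] and N = iso_cellsD[OF NI]
  note c = gam_cell[OF X Y Z f jk] and G = gam_cell[OF W Y Z F pk]
  note cgg = whisker_right_cell[OF c cg[OF ts] g'(1)] and cggs = whisker_right_cell[OF c cgs[OF ts] gs(1)]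
  note H = hat_cell'[OF W X Z f(1) g] and H' = hat_cell'[OF W X Z t(2) g]
  note HH = str2_cell[OF Y Z sF H]
  \<comment> \<open>The two factors applied first on the right-hand side are strengthenings of a
    composable pair. As the strengthening of a single 2-cell they leave the transpose in one use of
    \<open>restr_str2\<close>.\<close>
  let ?\<phi> = "inv_cell C ?n \<cdot> (?g \<triangleleft>[j] g)"
  have \<phi>: "?\<phi> \<in> cells C (?ts \<odot>[j] g) (str k' Y Z ?F)" by (rule vcomp_cell[OF cgg n(2)])
  have s\<phi>: "str2 ?p W Z ?\<phi> = str2 ?p W Z (inv_cell C ?n) \<cdot> str2 ?p W Z (?g \<triangleleft>[j] g)"
    by (rule str2_vcomp[OF W Z E cgg n(2)])
  have stF: "?st \<odot>[j] g \<in> hom_at C ?p (JO W) (TO Z)" by (rule pcomp_hom_at_inner[OF st g])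
  note i1 = str2_cell[OF W Z E cgg] and i2 = str2_cell[OF W Z stF n(2)]
  let ?R = "str2 k' Y Z ?H \<cdot> ?G \<cdot> str2 ?p W Z ?\<phi>"
  have R: "?R \<in> cells C (str ?p W Z (?ts \<odot>[j] g)) (str k' Y Z (?s \<odot>[j] ?gs))"
    by (rule vcomp_cell[OF str2_cell[OF W Z E \<phi>] vcomp_cell[OF G HH]])
  note NHG = vcomp_cell[OF vcomp_cell[OF G HH] N(1)]
  let ?sz = "?s \<triangleright>[j] ?z" and ?K = "nat_iso k' Y Z ?p (?s \<odot>[j] ?gs) (i W)"
  have sz: "?sz \<in> cells C ?F (?s \<odot>[j] (?gs \<odot>[l] i W))" by (rule whisker_left_cell[OF z cg[OF s(1)]])
  have nest: "?s \<odot>[j] (?gs \<odot>[l] i W) = (?s \<odot>[j] ?gs) \<odot>[?p] i W"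
    by (rule pcomp_nested[OF s(1) unit_pcomp_cong[OF W gs(4)] iW(1)])
  have K: "?K \<in> cells C (str k' Y Z ((?s \<odot>[j] ?gs) \<odot>[?p] i W)) (str k' Y Z (?s \<odot>[j] ?gs) \<odot>[?p] i W)"
    by (rule nat_unit_cell[OF Y Z W FF(2,1) pk])
  note tsz = str2_cell[OF Y Z F(2) sz, unfolded nest]
  have Ni: "?N \<triangleleft>[?p] i W \<in> cells C (str k' Y Z (?s \<odot>[j] ?gs) \<odot>[?p] i W) ((?st \<odot>[j] ?gs) \<odot>[?p] i W)"
    by (rule whisker_right_cell[OF N(1) unit_pcomp_cong[OF W str_hom_at_other[OF Y Z FF(2,1) pk]] iW(1)])
  \<comment> \<open>The restriction of the strengthened \<open>g\<close> is substituted in two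
    stages, the strengthening first and the unit second; the second stage is the factor
    \<open>?K\<close> that transposing gamma at \<open>?F\<close> produces.\<close>
  have Nn: "nat_iso k Y Z j ?s (?gs \<odot>[l] i W) = (?N \<triangleleft>[?p] i W) \<cdot> ?K"
    using nat_iso_nested'[OF Y Z s(2) cgs[OF s(1)] jk _ iW(1), of l] gs iW ags k' by simp
  have nz: "nat_iso k Y Z j ?s (?gs \<odot>[l] i W) \<cdot> str2 k' Y Z ?sz = (?st \<triangleright>[j] ?z) \<cdot> ?n"
    using nat_iso_natural'[OF Y Z s(2) cg[OF s(1)] jk cide_cell[OF hom_atD(1)[OF s(1)]] z]
      str2_cide[OF Y Z s(2)] k' by simp
  note stz = whisker_left_cell[OF z cg[OF st]]
  have "restr ?p W Z (?ts \<odot>[j] g) ((?g \<triangleleft>[j] ?gs) \<cdot> hat j l W X Z ?t g) = ?g \<boxdot>[j] ?z"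
    using restr_hat[OF W X Z t(2) g c cide_cell[OF gs(1)]] restr_cide[OF W X g] by simp
  \<comment> \<open>Gamma and t-tilde act on different factors of the composite and may be
    interchanged. With gamma first, it is whiskered by \<open>g\<close> itself, as on the right-hand
    side of the condition.\<close>
  also have "\<dots> = (?st \<triangleright>[j] ?z) \<cdot> (?g \<triangleleft>[j] g)"
    by (rule whisker_exchange(2)[OF c z cg[OF ts], symmetric])
  also have "?g \<triangleleft>[j] g = ?n \<cdot> ?\<phi>"
    using inv_cell_vcomp_eq_iff[OF nI cgg \<phi>] by simp
  also have "(?st \<triangleright>[j] ?z) \<cdot> (?n \<cdot> ?\<phi>) = (?st \<triangleright>[j] ?z) \<cdot> ?n \<cdot> ?\<phi>"
    by (rule vcomp_assoc[OF \<phi> n(1) stz])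
  also have "\<dots> = (?N \<triangleleft>[?p] i W) \<cdot> (?K \<cdot> str2 k' Y Z ?sz) \<cdot> ?\<phi>"
    unfolding nz[symmetric] Nn using vcomp_assoc[OF tsz K Ni] by simp
  also have "?K \<cdot> str2 k' Y Z ?sz = restr ?p W Z (str k' Y Z ?F) (str2 k' Y Z ?H \<cdot> ?G)"
    unfolding restr_str2_gam[OF W Y Z F pk H] hat_tilde[OF W X Z f(1) g] ..
  also have "(?N \<triangleleft>[?p] i W) \<cdot> \<dots> = restr ?p W Z (str k' Y Z ?F) (?N \<cdot> (str2 k' Y Z ?H \<cdot> ?G))"
    by (rule restr_vcomp[OF W Z tF vcomp_cell[OF G HH] N(1), symmetric])
  also have "\<dots> \<cdot> ?\<phi> = restr ?p W Z (?ts \<odot>[j] g) (?N \<cdot> (str2 k' Y Z ?H \<cdot> ?G) \<cdot> str2 ?p W Z ?\<phi>)"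
    by (rule restr_str2[OF W Z E \<phi> NHG, symmetric])
  also have "?N \<cdot> (str2 k' Y Z ?H \<cdot> ?G) \<cdot> str2 ?p W Z ?\<phi> = ?N \<cdot> ?R"
    by (rule vcomp_assoc[OF str2_cell[OF W Z E \<phi>] vcomp_cell[OF G HH] N(1), symmetric])
  finally have "(?g \<triangleleft>[j] ?gs) \<cdot> hat j l W X Z ?t g = ?N \<cdot> ?R"
    by (rule str_ext[OF W Z E vcomp_cell[OF H' cggs] vcomp_cell[OF R N(1)]])
  then have "inv_cell C ?N \<cdot> ((?g \<triangleleft>[j] ?gs) \<cdot> hat j l W X Z ?t g) = ?R"
    using inv_cell_vcomp_eq_iff[OF NI vcomp_cell[OF H' cggs] R] by simp
  then show ?thesis
    unfolding s\<phi> vcomp_assoc[OF H' cggs N(2)] using vcomp_assoc[OF i1 i2 vcomp_cell[OF G HH]] by simp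
qed

text \<open>Here t-hat strengthens position \<open>k\<close> while transposition takes place in
  position \<open>j\<close>, an argument of its outer map. Hence \<open>hat_subst_outer\<close> at
  the unit is the coherence needed, instead of the transpose of t-hat.\<close>

lemma gam_hat_t:
  assumes V: "V \<in> Obj D" and X: "X \<in> Obj D" and Y: "Y \<in> Obj D" and Z: "Z \<in> Obj D"
    and f: "f \<in> hom_at C j (JO X) (TO Z)" "f \<in> hom_at C k (JO Y) (TO Z)" and jk: "j \<noteq> k"
    and h: "h \<in> hom_at C l (JO V) (TO Y)" and j': "j' = shift k (arity h) j"
  shows "(gam j k X Y Z f \<triangleleft>[k] str l V Y h)
              \<cdot> nat_iso j X Z k (str k Y Z f) (str l V Y h) \<cdot> str2 j' X Z (hat k l V Y Z f h)
            = hat k l V Y Z (str j X Z f) h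
              \<cdot> str2 (k + l) V Z (gam j k X Y Z f \<triangleleft>[k] h)
              \<cdot> str2 (k + l) V Z (nat_iso j X Z k (str k Y Z f) h)
              \<cdot> gam j' (k + l) X V Z (str k Y Z f \<odot>[k] h)"
proof -
  let ?s = "str j X Z f" and ?t = "str k Y Z f" and ?g = "gam j k X Y Z f" and ?ht = "str l V Y h"
  let ?p = "k + l" and ?F = "str k Y Z f \<odot>[k] h" and ?H = "hat k l V Y Z f h" and ?H' = "hat k l V Y Z ?s h"
  let ?st = "str k Y Z ?s" and ?ts = "str j X Z ?t" and ?G = "gam j' ?p X V Z ?F"
  let ?m = "nat_iso j X Z k ?t h" and ?M = "nat_iso j X Z k ?t ?ht"
  let ?u = "nat_iso k Y Z j ?s (i X)" and ?x = "tilde j X Z f"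
  note kj = jk[symmetric] and iX = unit_type[OF X]
  have pk: "j' \<noteq> ?p" using jk h by (auto simp: j' shift_def hom_at_def)
  note h' = hom_atD[OF h]
  note s = str_type(4)[OF X Z f(1)] str_hom_at_other[OF X Z f kj]
  note t = str_type(4)[OF Y Z f(2)] str_hom_at_other[OF Y Z f(2,1) jk]
  have st: "?st \<in> hom_at C j (TO X) (TO Z)" by (rule str_hom_at_other[OF Y Z s(2,1) jk])
  note st2 = str_type(4)[OF Y Z s(2)]
  have ts: "?ts \<in> hom_at C k (TO Y) (TO Z)" by (rule str_hom_at_other[OF X Z t(2,1) kj])
  note ht = str_type[OF V Y h]
  have aht: "arity ?ht = arity h" using ht(2) by simp
  have ch: "q \<in> hom_at C k (Cod C h) (TO Z)" if "q \<in> hom_at C k (TO Y) (TO Z)" for q using that h' by simp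
  have cht: "q \<in> hom_at C k (Cod C ?ht) (TO Z)" if "q \<in> hom_at C k (TO Y) (TO Z)" for q using that ht by simp
  have F: "?F \<in> hom_at C j' (JO X) (TO Z)" "?F \<in> hom_at C ?p (JO V) (TO Z)"
    using pcomp_hom_at_inner[OF t(1) h] pcomp_hom_at_outer[OF ch[OF t(1)] t(2) kj h'(1)] j' by auto
  note tF = str_hom_at_other[OF V Z F(2,1) pk] and sF = str_hom_at_other[OF X Z F pk[symmetric]]
  note H = hat_cell'[OF V Y Z f(2) h] and H' = hat_cell'[OF V Y Z s(2) h]
  have m: "?m \<in> cells C (str j' X Z ?F) (?ts \<odot>[k] h)"
    using nat_cell[OF X Z t(2) ch[OF t(1)] kj h'(1)] j' by simp
  have M: "?M \<in> cells C (str j' X Z (?t \<odot>[k] ?ht)) (?ts \<odot>[k] ?ht)"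
    using nat_cell[OF X Z t(2) cht[OF t(1)] kj ht(1)] j' aht by simp
  note c = gam_cell[OF X Y Z f jk] and G = gam_cell[OF X V Z F pk]
  note ghh = whisker_right_cell[OF c ch[OF ts] h'(1)] and ghht = whisker_right_cell[OF c cht[OF ts] ht(1)]
  note sH = str2_cell[OF X Z tF H]
  have ghF: "?st \<odot>[k] h \<in> hom_at C ?p (JO V) (TO Z)" by (rule pcomp_hom_at_inner[OF st2 h])
  have tsh: "?ts \<odot>[k] h \<in> hom_at C ?p (JO V) (TO Z)" by (rule pcomp_hom_at_inner[OF ts h])
  note a1 = str2_cell[OF V Z tsh ghh] and a2 = str2_cell[OF V Z sF m]
  let ?A = "(?g \<triangleleft>[k] h) \<cdot> ?m"
  note A = vcomp_cell[OF m ghh]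
  have sA: "str2 ?p V Z ?A = str2 ?p V Z (?g \<triangleleft>[k] h) \<cdot> str2 ?p V Z ?m"
    by (rule str2_vcomp[OF V Z sF m ghh])
  note AA = str2_cell[OF V Z sF A]
  note x = tilde_cell'[OF X Z f(1)] note xt = str2_cell[OF Y Z f(2) x]
  note u = nat_unit_cell[OF Y Z X s(2,1) jk]
  have su: "?s \<odot>[j] i X \<in> hom_at C k (JO Y) (TO Z)" by (rule hom_at_unit_other[OF X s jk])
  note tsu = str_type(4)[OF Y Z su]
  have ug: "?u \<triangleleft>[k] ?ht \<in> cells C (str k Y Z (?s \<odot>[j] i X) \<odot>[k] ?ht) ((?st \<odot>[j] i X) \<odot>[k] ?ht)"
    by (rule whisker_right_cell[OF u cht[OF tsu] ht(1)])
  have ugh: "?u \<triangleleft>[k] h \<in> cells C (str k Y Z (?s \<odot>[j] i X) \<odot>[k] h) ((?st \<odot>[j] i X) \<odot>[k] h)"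
    by (rule whisker_right_cell[OF u ch[OF tsu] h'(1)])
  note xg = whisker_right_cell[OF xt cht[OF t(1)] ht(1)] and xgh = whisker_right_cell[OF xt ch[OF t(1)] h'(1)]
  note Hu = hat_cell'[OF V Y Z su h]
  note sxgh = str2_cell[OF V Z F(2) xgh] 
  have tsuh: "str k Y Z (?s \<odot>[j] i X) \<odot>[k] h \<in> hom_at C ?p (JO V) (TO Z)" by (rule pcomp_hom_at_inner[OF tsu h])
  note sugh = str2_cell[OF V Z tsuh ugh]
  have par: "(?st \<odot>[j] i X) \<odot>[k] h = (?st \<odot>[k] h) \<odot>[j'] i X"
    using pcomp_parallel[OF unit_pcomp_cong[OF X st] ch[OF st2] jk iX(1) h'(1)] j' iX by simp
  have par2: "(?st \<odot>[j] i X) \<odot>[k] ?ht = (?st \<odot>[k] ?ht) \<odot>[j'] i X"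
    using pcomp_parallel[OF unit_pcomp_cong[OF X st] cht[OF st2] jk iX(1) ht(1)] j' iX aht by simp
  have sth: "?st \<odot>[k] h \<in> hom_at C j' (TO X) (TO Z)"
    using pcomp_hom_at_outer[OF ch[OF st2] st kj h'(1)] j' by simp
  have P: "nat_iso ?p V Z j' (?st \<odot>[k] h) (i X)
      \<in> cells C (str ?p V Z ((?st \<odot>[k] h) \<odot>[j'] i X)) (str ?p V Z (?st \<odot>[k] h) \<odot>[j'] i X)"
    by (rule nat_unit_cell[OF V Z X ghF sth pk])
  have Hi: "?H' \<triangleleft>[j'] i X \<in> cells C (str ?p V Z (?st \<odot>[k] h) \<odot>[j'] i X) ((?st \<odot>[k] ?ht) \<odot>[j'] i X)"
    by (rule whisker_right_cell[OF H' unit_pcomp_cong[OF X str_hom_at_other[OF V Z ghF sth pk]] iX(1)])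
  \<comment> \<open>The unit \<open>i X\<close> is unary, so substituting it leaves position
    \<open>k\<close> in place; the substitution of \<open>h\<close> at \<open>k\<close> may move
    position \<open>j\<close> to \<open>j'\<close>.\<close>
  have so: "(?u \<triangleleft>[k] ?ht) \<cdot> hat k l V Y Z (?s \<odot>[j] i X) h
      = (?H' \<triangleleft>[j'] i X) \<cdot> nat_iso ?p V Z j' (?st \<odot>[k] h) (i X) \<cdot> str2 ?p V Z (?u \<triangleleft>[k] h)"
    using hat_subst_outer[OF V Y Z s(2) h _ jk, of "i X" "[JO X]"] hom_atD[OF s(1)] unit_hom[OF X] iX j' by simp
  have hn: "hat k l V Y Z (?s \<odot>[j] i X) h \<cdot> str2 ?p V Z (str2 k Y Z ?x \<triangleleft>[k] h) = (str2 k Y Z ?x \<triangleleft>[k] ?ht) \<cdot> ?H"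
    using hat_natural[OF V Y Z f(2) h x cide_cell[OF h'(1)]] str2_cide[OF V Y h] by simp
  note ty = cellsD(1-3)[OF H] cellsD(1-3)[OF H'] cellsD(1-3)[OF Hi] cellsD(1-3)[OF P] cellsD(1-3)[OF sugh, unfolded par]
    cellsD(1-3)[OF sxgh] cellsD(1-3)[OF Hu] cellsD(1-3)[OF xg] cellsD(1-3)[OF ug, unfolded par2]
  have "restr j' X Z (str ?p V Z ?F) ((?g \<triangleleft>[k] ?ht) \<cdot> ?M \<cdot> str2 j' X Z ?H)
      = restr j' X Z (?t \<odot>[k] ?ht) ((?g \<triangleleft>[k] ?ht) \<cdot> ?M) \<cdot> ?H"
    by (rule restr_str2[OF X Z tF H vcomp_cell[OF M ghht]])
  also have "restr j' X Z (?t \<odot>[k] ?ht) ((?g \<triangleleft>[k] ?ht) \<cdot> ?M) = restr j X Z ?t ?g \<triangleleft>[k] ?ht"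
    using restr_nat[OF X Z t(2) cht[OF t(1)] kj ht(1) c] j' aht by simp
  also have "\<dots> = (?u \<triangleleft>[k] ?ht) \<cdot> (str2 k Y Z ?x \<triangleleft>[k] ?ht)"
    unfolding restr_gam[OF X Y Z f jk] by (rule whisker_right_vcomp[OF xt u cht[OF t(1)] ht(1)])
  also have "\<dots> \<cdot> ?H = (?u \<triangleleft>[k] ?ht) \<cdot> hat k l V Y Z (?s \<odot>[j] i X) h \<cdot> str2 ?p V Z (str2 k Y Z ?x \<triangleleft>[k] h)"
    unfolding vcomp_assoc[OF H xg ug, symmetric] hn[symmetric] by (rule vcomp_assoc[OF sxgh Hu ug])
  also have "\<dots> = (?H' \<triangleleft>[j'] i X) \<cdot> (nat_iso ?p V Z j' (?st \<odot>[k] h) (i X)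
      \<cdot> (str2 ?p V Z (?u \<triangleleft>[k] h) \<cdot> str2 ?p V Z (str2 k Y Z ?x \<triangleleft>[k] h)))"
    unfolding so using ty by (simp add: vcomp_assoc' vcomp_Cell)
  also have "str2 ?p V Z (?u \<triangleleft>[k] h) \<cdot> str2 ?p V Z (str2 k Y Z ?x \<triangleleft>[k] h)
      = str2 ?p V Z ((?u \<triangleleft>[k] h) \<cdot> (str2 k Y Z ?x \<triangleleft>[k] h))"
    by (rule str2_vcomp[OF V Z F(2) xgh ugh, symmetric])
  \<comment> \<open>The transpose of gamma was whiskered by the strengthening of \<open>h\<close>;
    now it is whiskered by \<open>h\<close> and sits under the outer strengthening, where it can be
    folded back into a transpose.\<close>
  also have "(?u \<triangleleft>[k] h) \<cdot> (str2 k Y Z ?x \<triangleleft>[k] h) = restr j X Z ?t ?g \<triangleleft>[k] h"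
    unfolding restr_gam[OF X Y Z f jk] by (rule whisker_right_vcomp[OF xt u ch[OF t(1)] h'(1), symmetric])
  also have "\<dots> = restr j' X Z ?F ?A"
    using restr_nat[OF X Z t(2) ch[OF t(1)] kj h'(1) c] j' by simp
  also have "nat_iso ?p V Z j' (?st \<odot>[k] h) (i X) \<cdot> str2 ?p V Z (restr j' X Z ?F ?A)
      = restr j' X Z (str ?p V Z ?F) (str2 ?p V Z ?A \<cdot> ?G)"
    by (rule restr_str2_gam[OF X V Z F pk A, symmetric])
  also have "(?H' \<triangleleft>[j'] i X) \<cdot> \<dots> = restr j' X Z (str ?p V Z ?F) (?H' \<cdot> (str2 ?p V Z ?A \<cdot> ?G))"
    by (rule restr_vcomp[OF X Z tF vcomp_cell[OF G AA] H', symmetric])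
  finally have "(?g \<triangleleft>[k] ?ht) \<cdot> ?M \<cdot> str2 j' X Z ?H = ?H' \<cdot> (str2 ?p V Z ?A \<cdot> ?G)"
    by (rule str_ext[OF X Z tF vcomp_cell[OF sH vcomp_cell[OF M ghht]] vcomp_cell[OF vcomp_cell[OF G AA] H']])
  then show ?thesis
    unfolding sA using vcomp_assoc[OF G AA H'] vcomp_assoc[OF a2 a1 H'] sA by simp
qed

text \<open>Transposing in position \<open>j\<close> turns every gamma that involves
  \<open>j\<close> into pseudonaturality and t-tilde. Only gamma for \<open>k\<close> and
  \<open>l\<close> survives, at \<open>f\<close> on one side and at its strengthening
  \<open>?s\<close> on the other; naturality along t-tilde and substitution of the unit
  \<open>i W\<close> connect the two.\<close>

lemma gam_braid:
  assumes W: "W \<in> Obj D" and X: "X \<in> Obj D" and Y: "Y \<in> Obj D" and Z: "Z \<in> Obj D"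
    and f: "f \<in> hom_at C j (JO W) (TO Z)" "f \<in> hom_at C k (JO X) (TO Z)" "f \<in> hom_at C l (JO Y) (TO Z)"
    and n: "j \<noteq> k" "j \<noteq> l" "k \<noteq> l"
  shows "str2 l Y Z (gam j k W X Z f) \<cdot> gam j l W Y Z (str k X Z f) \<cdot> str2 j W Z (gam k l X Y Z f)
    = gam k l X Y Z (str j W Z f) \<cdot> str2 k X Z (gam j l W Y Z f) \<cdot> gam j k W X Z (str l Y Z f)"
proof -
  let ?s = "str j W Z f" and ?t = "str k X Z f" and ?u = "str l Y Z f" and ?i = "i W" and ?x = "tilde j W Z f"
  let ?tu = "str l Y Z ?t" and ?ut = "str k X Z ?u" and ?st = "str k X Z ?s" and ?su = "str l Y Z ?s"
  let ?K = "gam k l X Y Z f" and ?Ks = "gam k l X Y Z ?s"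
  note n' = n[symmetric] and iW = unit_type[OF W]
  note s = str_type(4)[OF W Z f(1)] str_hom_at_other[OF W Z f(1,2) n'(1)] str_hom_at_other[OF W Z f(1,3) n'(2)]
  note t = str_hom_at_other[OF X Z f(2,1) n(1)] str_type(4)[OF X Z f(2)] str_hom_at_other[OF X Z f(2,3) n'(3)]
  note u = str_hom_at_other[OF Y Z f(3,1) n(2)] str_hom_at_other[OF Y Z f(3,2) n(3)] str_type(4)[OF Y Z f(3)]
  have ut: "?ut \<in> hom_at C j (JO W) (TO Z)" by (rule str_hom_at_other[OF X Z u(2,1) n(1)])
  have st: "?st \<in> hom_at C j (TO W) (TO Z)" "?st \<in> hom_at C l (JO Y) (TO Z)"
    using str_hom_at_other[OF X Z s(2,1) n(1)] str_hom_at_other[OF X Z s(2,3) n'(3)] by auto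
  have su: "?su \<in> hom_at C j (TO W) (TO Z)" "?su \<in> hom_at C k (JO X) (TO Z)"
    using str_hom_at_other[OF Y Z s(3,1) n(2)] str_hom_at_other[OF Y Z s(3,2) n(3)] by auto
  note K = gam_cell[OF X Y Z f(2,3) n(3)] and Ks = gam_cell[OF X Y Z s(2,3) n(3)]
  note a = gam_cell[OF W X Z f(1,2) n(1)] and b = gam_cell[OF W Y Z t(1,3) n(2)]
  note a' = gam_cell[OF W Y Z f(1,3) n(2)] and b' = gam_cell[OF W X Z u(1,2) n(1)]
  have ts: "str j W Z ?t \<in> hom_at C l (JO Y) (TO Z)" by (rule str_hom_at_other[OF W Z t(1,3) n'(2)])
  have us: "str j W Z ?u \<in> hom_at C k (JO X) (TO Z)" by (rule str_hom_at_other[OF W Z u(1,2) n'(1)])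
  note sa = str2_cell[OF Y Z ts a] and sa' = str2_cell[OF X Z us a'] and sK = str2_cell[OF W Z ut K]
  note x = tilde_cell'[OF W Z f(1)]
  note xt = str2_cell[OF X Z f(2) x] and xu = str2_cell[OF Y Z f(3) x]
  note xtu = str2_cell[OF Y Z t(3) xt] and xut = str2_cell[OF X Z u(2) xu]
  note si = hom_at_unit_other[OF W s(1,2) n(1)] hom_at_unit_other[OF W s(1,3) n(2)]
  let ?p = "nat_iso k X Z j ?s ?i" and ?q = "nat_iso l Y Z j ?s ?i"
  let ?P = "nat_iso l Y Z j ?st ?i" and ?Q = "nat_iso k X Z j ?su ?i"
  note p = nat_unit_cell[OF X Z W s(2,1) n(1)] and q = nat_unit_cell[OF Y Z W s(3,1) n(2)]
  note P = nat_unit_cell[OF Y Z W st(2,1) n(2)] and Q = nat_unit_cell[OF X Z W su(2,1) n(1)]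
  have ti: "str k X Z (?s \<odot>[j] ?i) \<in> hom_at C l (JO Y) (TO Z)" by (rule str_hom_at_other[OF X Z si n'(3)])
  have ui: "str l Y Z (?s \<odot>[j] ?i) \<in> hom_at C k (JO X) (TO Z)" by (rule str_hom_at_other[OF Y Z si(2,1) n(3)])
  note sp = str2_cell[OF Y Z ti p] and sq = str2_cell[OF X Z ui q]
  note G = gam_cell[OF X Y Z si n(3)]
  have sut: "str k X Z ?su \<in> hom_at C j (TO W) (TO Z)" by (rule str_hom_at_other[OF X Z su(2,1) n(1)])
  note Ki = whisker_right_cell[OF Ks unit_pcomp_cong[OF W sut] iW(1)]
  note ty = cellsD(1-3)[OF K] cellsD(1-3)[OF xtu] cellsD(1-3)[OF xut] cellsD(1-3)[OF P] cellsD(1-3)[OF Q]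
    cellsD(1-3)[OF sp] cellsD(1-3)[OF sq] cellsD(1-3)[OF G] cellsD(1-3)[OF Ki]
  have "restr j W Z ?ut (str2 l Y Z (gam j k W X Z f) \<cdot> gam j l W Y Z ?t \<cdot> str2 j W Z ?K)
      = ?P \<cdot> str2 l Y Z (?p \<cdot> str2 k X Z ?x) \<cdot> ?K"
    unfolding restr_str2[OF W Z ut K vcomp_cell[OF b sa]] restr_str2_gam[OF W Y Z t(1,3) n(2) a]
      restr_gam[OF W X Z f(1,2) n(1)] ..
  also have "\<dots> = ?P \<cdot> str2 l Y Z ?p \<cdot> (str2 l Y Z (str2 k X Z ?x) \<cdot> ?K)"
    unfolding str2_vcomp[OF Y Z t(3) xt p] using ty by (simp add: vcomp_assoc' vcomp_Cell)
  also have "str2 l Y Z (str2 k X Z ?x) \<cdot> ?K = gam k l X Y Z (?s \<odot>[j] ?i) \<cdot> str2 k X Z (str2 l Y Z ?x)"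
    by (rule gam_natural[OF X Y Z f(2,3) n(3) x, symmetric])
  also have "?P \<cdot> str2 l Y Z ?p \<cdot> \<dots> = (?P \<cdot> str2 l Y Z ?p \<cdot> gam k l X Y Z (?s \<odot>[j] ?i)) \<cdot> str2 k X Z (str2 l Y Z ?x)"
    using ty by (simp add: vcomp_assoc' vcomp_Cell)
  also have "?P \<cdot> str2 l Y Z ?p \<cdot> gam k l X Y Z (?s \<odot>[j] ?i) = (?Ks \<triangleleft>[j] ?i) \<cdot> ?Q \<cdot> str2 k X Z ?q"
    using gam_subst[OF X Y Z s(2,3) n(3) unit_pcomp_cong[OF W s(1)] n(1,2) iW(1)] iW by simp
  also have "\<dots> \<cdot> str2 k X Z (str2 l Y Z ?x) = (?Ks \<triangleleft>[j] ?i) \<cdot> (?Q \<cdot> str2 k X Z (?q \<cdot> str2 l Y Z ?x))"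
    unfolding str2_vcomp[OF X Z u(2) xu q] using ty by (simp add: vcomp_assoc' vcomp_Cell)
  also have "\<dots> = restr j W Z ?ut (?Ks \<cdot> (str2 k X Z (gam j l W Y Z f) \<cdot> gam j k W X Z ?u))"
    unfolding restr_vcomp[OF W Z ut vcomp_cell[OF b' sa'] Ks] restr_str2_gam[OF W X Z u(1,2) n(1) a']
      restr_gam[OF W Y Z f(1,3) n(2)] ..
  finally show ?thesis
    using str_ext[OF W Z ut vcomp_cell[OF sK vcomp_cell[OF b sa]] vcomp_cell[OF vcomp_cell[OF b' sa'] Ks]]
      vcomp_assoc[OF b' sa' Ks] by simp
qed

section \<open>Pseudonaturality of gamma in the objects of \<open>D\<close>\<close>

text \<open>The transpose of \<open>str_nat_arg\<close> consists of two unit 2-cells, t-tilde at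
  \<open>f\<close> whiskered by \<open>J u\<close> and t-tilde at the map whose strengthening is
  \<open>T u\<close>. The second is carried past gamma by interchange, the first is absorbed into
  the transpose of gamma.\<close>

lemma gam_nat_X:
  assumes X: "X \<in> Obj D" and Y: "Y \<in> Obj D" and Z: "Z \<in> Obj D"
    and f: "f \<in> hom_at C j (JO X) (TO Z)" "f \<in> hom_at C k (JO Y) (TO Z)" and jk: "j \<noteq> k"
    and u: "u \<in> hom D [X'] X"
  shows "nat_iso k Y Z j (str j X Z f) (T_map X' X u) \<cdot> str2 k Y Z (str_nat_arg j X' X Z f u)
              \<cdot> gam j k X' Y Z (f \<odot>[j] on_mor J u)
            = (gam j k X Y Z f \<triangleleft>[j] T_map X' X u)
              \<cdot> str_nat_arg j X' X Z (str k Y Z f) u \<cdot> str2 j X' Z (nat_iso k Y Z j f (on_mor J u))"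
proof -
  let ?s = "str j X Z f" and ?t = "str k Y Z f" and ?g = "gam j k X Y Z f" and ?v = "on_mor J u"
  let ?a = "i X \<odot>[0] ?v" and ?T = "T_map X' X u" and ?fv = "f \<odot>[j] ?v"
  let ?st = "str k Y Z ?s" and ?ts = "str j X Z ?t" and ?x = "tilde j X Z f" and ?z = "tilde 0 X' X ?a"
  let ?G = "gam j k X' Y Z ?fv" and ?N = "nat_iso k Y Z j ?s ?T" and ?m = "nat_iso k Y Z j f ?v"
  let ?S = "str_nat_arg j X' X Z f u" and ?S' = "str_nat_arg j X' X Z ?t u"
  let ?h = "hat j 0 X' X Z f ?a" and ?h' = "hat j 0 X' X Z ?t ?a"
  note kj = jk[symmetric] and iX = unit_type[OF X]
  note v = J_hom[OF u] and a = unit_J[OF u]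
  note X' = v(1) note iX' = unit_type[OF X']
  have one: "arity ?v = Suc 0" "arity ?a = Suc 0" "arity ?T = Suc 0" using v a by simp_all
  note s = str_type(4)[OF X Z f(1)] str_hom_at_other[OF X Z f kj]
  note t = str_type(4)[OF Y Z f(2)] str_hom_at_other[OF Y Z f(2,1) jk]
  have st: "?st \<in> hom_at C j (TO X) (TO Z)" by (rule str_hom_at_other[OF Y Z s(2,1) jk])
  note ts = str_type(4)[OF X Z t(2)]
  have cv: "q \<in> hom_at C j (Cod C ?v) (TO Z)" if "q \<in> hom_at C j (JO X) (TO Z)" for q using that v by simp
  have ca: "q \<in> hom_at C j (Cod C ?a) (TO Z)" if "q \<in> hom_at C j (TO X) (TO Z)" for q using that a by simp
  have cT: "q \<in> hom_at C j (Cod C ?T) (TO Z)" if "q \<in> hom_at C j (TO X) (TO Z)" for q using that a by simp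
  have fv: "?fv \<in> hom_at C j (JO X') (TO Z)" "?fv \<in> hom_at C k (JO Y) (TO Z)"
    using pcomp_hom_at_inner[OF f(1) v(6)] pcomp_hom_at_outer[OF cv[OF f(1)] f(2) jk v(3)] one by simp_all
  have sa: "?s \<odot>[j] ?a \<in> hom_at C j (JO X') (TO Z)" "?s \<odot>[j] ?a \<in> hom_at C k (JO Y) (TO Z)"
    using pcomp_hom_at_inner[OF s(1) a(1)] pcomp_hom_at_outer[OF ca[OF s(1)] s(2) jk a(2)] one by simp_all
  have sT: "?s \<odot>[j] ?T \<in> hom_at C j (TO X') (TO Z)" "?s \<odot>[j] ?T \<in> hom_at C k (JO Y) (TO Z)"
    using pcomp_hom_at_inner[OF s(1) a(5)] pcomp_hom_at_outer[OF cT[OF s(1)] s(2) jk a(6)] one by simp_all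
  have tv: "?t \<odot>[j] ?v \<in> hom_at C j (JO X') (TO Z)"
    using pcomp_hom_at_inner[OF t(2) v(6)] by simp
  note tfv = str_hom_at_other[OF Y Z fv(2,1) jk] and sfv = str_hom_at_other[OF X' Z fv kj]
  note x = tilde_cell'[OF X Z f(1)] and z = tilde_cell'[OF X' X a(1)] and xt = tilde_cell'[OF X Z t(2)]
  have nest: "(q \<odot>[j] i X) \<odot>[j] ?v = q \<odot>[j] ?a" if "q \<in> hom_at C j (TO X) (TO Z)" for q
    using pcomp_nested[OF that, of "i X" 0 ?v] iX v by simp
  have nestT: "q \<odot>[j] (?T \<odot>[0] i X') = (q \<odot>[j] ?T) \<odot>[j] i X'" if "q \<in> hom_at C j (TO X) (TO Z)" for q
    using pcomp_nested[OF that, of ?T 0 "i X'"] iX' a by simp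
  have xv: "?x \<triangleleft>[j] ?v \<in> cells C ?fv (?s \<odot>[j] ?a)"
    using whisker_right_cell[OF x cv[OF f(1)] v(3)] nest[OF s(1)] by simp
  have xtv: "tilde j X Z ?t \<triangleleft>[j] ?v \<in> cells C (?t \<odot>[j] ?v) (?ts \<odot>[j] ?a)"
    using whisker_right_cell[OF xt cv[OF t(2)] v(3)] nest[OF ts] by simp
  have h: "?h \<in> cells C (str j X' Z (?s \<odot>[j] ?a)) (?s \<odot>[j] ?T)"
    using hat_cell'[OF X' X Z f(1) a(1)] by simp
  have h': "?h' \<in> cells C (str j X' Z (?ts \<odot>[j] ?a)) (?ts \<odot>[j] ?T)"
    using hat_cell'[OF X' X Z t(2) a(1)] by simp
  have S: "?S \<in> cells C (str j X' Z ?fv) (?s \<odot>[j] ?T)"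
    by (rule vcomp_cell[OF str2_cell[OF X' Z fv(1) xv] h])
  have sxtv: "str2 j X' Z (tilde j X Z ?t \<triangleleft>[j] ?v) \<in> cells C (str j X' Z (?t \<odot>[j] ?v)) (str j X' Z (?ts \<odot>[j] ?a))"
    by (rule str2_cell[OF X' Z tv xtv])
  note S' = vcomp_cell[OF sxtv h']
  note g = gam_cell[OF X Y Z f jk] and G = gam_cell[OF X' Y Z fv jk]
  note gT = whisker_right_cell[OF g cT[OF ts] a(6)] and ga = whisker_right_cell[OF g ca[OF ts] a(2)]
  have m: "?m \<in> cells C (str k Y Z ?fv) (?t \<odot>[j] ?v)"
    using nat_cell[OF Y Z f(2) cv[OF f(1)] jk v(3)] one by simp
  have N: "?N \<in> cells C (str k Y Z (?s \<odot>[j] ?T)) (?st \<odot>[j] ?T)"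
    using nat_cell[OF Y Z s(2) cT[OF s(1)] jk a(6)] one by simp
  note sS = str2_cell[OF Y Z sfv S] and sm = str2_cell[OF X' Z tfv m]
  let ?sz = "?s \<triangleright>[j] ?z" and ?K = "nat_iso k Y Z j (?s \<odot>[j] ?T) (i X')"
  note K = nat_unit_cell[OF Y Z X' sT(2,1) jk]
  have sz: "?sz \<in> cells C (?s \<odot>[j] ?a) ((?s \<odot>[j] ?T) \<odot>[j] i X')"
    using whisker_left_cell[OF z ca[OF s(1)]] nestT[OF s(1)] by simp
  note ssz = str2_cell[OF Y Z sa(2) sz]
  note sxv = str2_cell[OF Y Z fv(2) xv]
  note Ni = whisker_right_cell[OF N unit_pcomp_cong[OF X' str_hom_at_other[OF Y Z sT(2,1) jk]] iX'(1)]
  note stz = whisker_left_cell[OF z ca[OF st]]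
  let ?q = "nat_iso k Y Z j ?s ?a" and ?w = "nat_iso k Y Z j ?s (i X)"
  have q: "?q \<in> cells C (str k Y Z (?s \<odot>[j] ?a)) (?st \<odot>[j] ?a)"
    using nat_cell[OF Y Z s(2) ca[OF s(1)] jk a(2)] one by simp
  note w = nat_unit_cell[OF Y Z X s(2,1) jk]
  note si = hom_at_unit[OF X s(1)] hom_at_unit_other[OF X s jk]
  have wv: "?w \<triangleleft>[j] ?v \<in> cells C (str k Y Z (?s \<odot>[j] i X) \<odot>[j] ?v) (?st \<odot>[j] ?a)"
    using whisker_right_cell[OF w cv[OF str_hom_at_other[OF Y Z si(2,1) jk]] v(3)] nest[OF st] by simp
  let ?r = "nat_iso k Y Z j (?s \<odot>[j] i X) ?v"
  have r: "?r \<in> cells C (str k Y Z (?s \<odot>[j] ?a)) (str k Y Z (?s \<odot>[j] i X) \<odot>[j] ?v)"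
    using nat_cell[OF Y Z si(2) cv[OF si(1)] jk v(3)] one nest[OF s(1)] by simp
  note tx = str2_cell[OF Y Z f(2) x]
  note txv = whisker_right_cell[OF tx cv[OF t(2)] v(3)]
  have Nn: "nat_iso k Y Z j ?s (?T \<odot>[0] i X') = (?N \<triangleleft>[j] i X') \<cdot> ?K"
    using nat_iso_nested'[OF Y Z s(2) cT[OF s(1)] jk _ iX'(1), of 0] a iX' one by simp
  have nz: "nat_iso k Y Z j ?s (?T \<odot>[0] i X') \<cdot> str2 k Y Z ?sz = (?st \<triangleright>[j] ?z) \<cdot> ?q"
    using nat_iso_natural'[OF Y Z s(2) ca[OF s(1)] jk cide_cell[OF hom_atD(1)[OF s(1)]] z]
      str2_cide[OF Y Z s(2)] one by simp
  \<comment> \<open>Substituting \<open>?a\<close> as the unit followed by \<open>J u\<close>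
    exposes pseudonaturality at the unit, a factor of the transpose of gamma.\<close>
  have qe: "?q = (?w \<triangleleft>[j] ?v) \<cdot> ?r"
    using nat_iso_nested'[OF Y Z s(2) unit_pcomp_cong[OF X s(1)] jk _ v(3), of 0] v iX by simp
  have re: "?r \<cdot> str2 k Y Z (?x \<triangleleft>[j] ?v) = (str2 k Y Z ?x \<triangleleft>[j] ?v) \<cdot> ?m"
    using nat_iso_natural'[OF Y Z f(2) cv[OF f(1)] jk x cide_cell[OF v(3)]] one by simp
  have ge: "?g \<triangleleft>[j] ?a = (?g \<triangleleft>[j] i X) \<triangleleft>[j] ?v"
    using pcell_nested[OF g cide_cell[OF iX(1)] cide_cell[OF v(3)] ts, of 0] iX v
      pcell_cide[of "i X" 0 ?v "TO X"] by simp
  have gv: "?g \<triangleleft>[j] i X \<in> cells C (?ts \<odot>[j] i X) (?st \<odot>[j] i X)"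
    by (rule whisker_right_cell[OF g unit_pcomp_cong[OF X ts] iX(1)])
  have rS: "restr j X' Z ?fv ?S = ?sz \<cdot> (?x \<triangleleft>[j] ?v)"
    using restr_str2[OF X' Z fv(1) xv h] hat_tilde[OF X' X Z f(1) a(1)] by simp
  note ty = cellsD(1-3)[OF m] cellsD(1-3)[OF Ni] cellsD(1-3)[OF K] cellsD(1-3)[OF ssz] cellsD(1-3)[OF sxv]
     cellsD(1-3)[OF stz] cellsD(1-3)[OF wv] cellsD(1-3)[OF r] cellsD(1-3)[OF txv] cellsD(1-3)[OF ga]
     cellsD(1-3)[OF xtv] cellsD(1-3)[OF gT] cellsD(1-3)[OF h'] cellsD(1-3)[OF sxtv] cellsD(1-3)[OF sm]
  have "restr j X' Z (str k Y Z ?fv) (?N \<cdot> (str2 k Y Z ?S \<cdot> ?G))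
      = (?N \<triangleleft>[j] i X') \<cdot> (?K \<cdot> str2 k Y Z (?sz \<cdot> (?x \<triangleleft>[j] ?v)))"
    unfolding restr_vcomp[OF X' Z tfv vcomp_cell[OF G sS] N] restr_str2_gam[OF X' Y Z fv jk S] rS ..
  also have "\<dots> = ((?N \<triangleleft>[j] i X') \<cdot> ?K \<cdot> str2 k Y Z ?sz) \<cdot> str2 k Y Z (?x \<triangleleft>[j] ?v)"
    unfolding str2_vcomp[OF Y Z fv(2) xv sz] using ty by (simp add: vcomp_assoc' vcomp_Cell)
  also have "\<dots> = (?st \<triangleright>[j] ?z) \<cdot> ((?w \<triangleleft>[j] ?v) \<cdot> (?r \<cdot> str2 k Y Z (?x \<triangleleft>[j] ?v)))"
    unfolding Nn[symmetric] nz qe using ty by (simp add: vcomp_assoc' vcomp_Cell)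
  also have "\<dots> = (?st \<triangleright>[j] ?z) \<cdot> (((?w \<triangleleft>[j] ?v) \<cdot> (str2 k Y Z ?x \<triangleleft>[j] ?v)) \<cdot> ?m)"
    unfolding re using ty by (simp add: vcomp_assoc' vcomp_Cell)
  also have "(?w \<triangleleft>[j] ?v) \<cdot> (str2 k Y Z ?x \<triangleleft>[j] ?v) = restr j X Z ?t ?g \<triangleleft>[j] ?v"
    unfolding restr_gam[OF X Y Z f jk] by (rule whisker_right_vcomp[OF tx w cv[OF t(2)] v(3), symmetric])
  also have "\<dots> = (?g \<triangleleft>[j] ?a) \<cdot> (tilde j X Z ?t \<triangleleft>[j] ?v)"
    unfolding restr_def ge by (rule whisker_right_vcomp[OF xt gv cv[OF t(2)] v(3)])
  also have "(?st \<triangleright>[j] ?z) \<cdot> (\<dots> \<cdot> ?m) = ((?st \<triangleright>[j] ?z) \<cdot> (?g \<triangleleft>[j] ?a)) \<cdot> (tilde j X Z ?t \<triangleleft>[j] ?v) \<cdot> ?m"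
    using ty by (simp add: vcomp_assoc' vcomp_Cell)
  also have "(?st \<triangleright>[j] ?z) \<cdot> (?g \<triangleleft>[j] ?a) = restr j X' Z (?ts \<odot>[j] ?a) ((?g \<triangleleft>[j] ?T) \<cdot> ?h')"
    using whisker_exchange(2)[OF g z ca[OF ts]] restr_hat[OF X' X Z t(2) a(1) g cide_cell[OF a(6)]]
      restr_cide[OF X' X a(1)] by simp
  also have "\<dots> \<cdot> (tilde j X Z ?t \<triangleleft>[j] ?v) \<cdot> ?m
      = restr j X' Z (str k Y Z ?fv) ((?g \<triangleleft>[j] ?T) \<cdot> ?h' \<cdot> str2 j X' Z (tilde j X Z ?t \<triangleleft>[j] ?v) \<cdot> str2 j X' Z ?m)"
    unfolding restr_str2[OF X' Z tfv m vcomp_cell[OF sxtv vcomp_cell[OF h' gT]]]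
      restr_str2[OF X' Z tv xtv vcomp_cell[OF h' gT]] ..
  also have "(?g \<triangleleft>[j] ?T) \<cdot> ?h' \<cdot> str2 j X' Z (tilde j X Z ?t \<triangleleft>[j] ?v) \<cdot> str2 j X' Z ?m
      = (?g \<triangleleft>[j] ?T) \<cdot> ?S' \<cdot> str2 j X' Z ?m"
    using ty by (simp add: vcomp_assoc' vcomp_Cell)
  finally show ?thesis
    using str_ext[OF X' Z tfv vcomp_cell[OF vcomp_cell[OF G sS] N] vcomp_cell[OF sm vcomp_cell[OF S' gT]]]
      vcomp_assoc[OF G sS N] by simp
qed

text \<open>Since \<open>str_nat_arg\<close> is t-hat after a strengthened t-tilde, the condition is
  assembled from those already proved: \<open>gam_hat_t\<close> for \<open>?a\<close>, naturality of
  gamma along the whiskered t-tilde, and \<open>gam_tilde_t\<close> whiskered by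
  \<open>J u\<close>.\<close>

lemma gam_nat_Y:
  assumes X: "X \<in> Obj D" and Y: "Y \<in> Obj D" and Z: "Z \<in> Obj D"
    and f: "f \<in> hom_at C j (JO X) (TO Z)" "f \<in> hom_at C k (JO Y) (TO Z)" and jk: "j \<noteq> k"
    and u: "u \<in> hom D [Y'] Y"
  shows "str_nat_arg k Y' Y Z (str j X Z f) u \<cdot> str2 k Y' Z (nat_iso j X Z k f (on_mor J u))
              \<cdot> gam j k X Y' Z (f \<odot>[k] on_mor J u)
            = (gam j k X Y Z f \<triangleleft>[k] T_map Y' Y u)
              \<cdot> nat_iso j X Z k (str k Y Z f) (T_map Y' Y u) \<cdot> str2 j X Z (str_nat_arg k Y' Y Z f u)"
proof -
  let ?s = "str j X Z f" and ?t = "str k Y Z f" and ?g = "gam j k X Y Z f" and ?v = "on_mor J u"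
  let ?a = "i Y \<odot>[0] ?v" and ?T = "T_map Y' Y u" and ?fv = "f \<odot>[k] ?v"
  let ?st = "str k Y Z ?s" and ?ts = "str j X Z ?t" and ?y = "tilde k Y Z f" and ?ys = "tilde k Y Z ?s"
  let ?m = "nat_iso j X Z k f ?v" and ?N = "nat_iso j X Z k ?t ?T" and ?n = "nat_iso j X Z k ?t ?a"
  let ?h = "hat k 0 Y' Y Z f ?a" and ?h' = "hat k 0 Y' Y Z ?s ?a" and ?\<psi> = "tilde k Y Z f \<triangleleft>[k] on_mor J u"
  note kj = jk[symmetric] and iY = unit_type[OF Y]
  note v = J_hom[OF u] and a = unit_J[OF u]
  note Y' = v(1)
  have one: "arity ?v = Suc 0" "arity ?a = Suc 0" "arity ?T = Suc 0" using v a by simp_all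
  note s = str_type(4)[OF X Z f(1)] str_hom_at_other[OF X Z f kj]
  note t = str_type(4)[OF Y Z f(2)] str_hom_at_other[OF Y Z f(2,1) jk]
  have ts: "?ts \<in> hom_at C k (TO Y) (TO Z)" by (rule str_hom_at_other[OF X Z t(2,1) kj])
  note st = str_type(4)[OF Y Z s(2)]
  have cv: "q \<in> hom_at C k (Cod C ?v) (TO Z)" if "q \<in> hom_at C k (JO Y) (TO Z)" for q using that v by simp
  have ca: "q \<in> hom_at C k (Cod C ?a) (TO Z)" if "q \<in> hom_at C k (TO Y) (TO Z)" for q using that a by simp
  have cT: "q \<in> hom_at C k (Cod C ?T) (TO Z)" if "q \<in> hom_at C k (TO Y) (TO Z)" for q using that a by simp
  have fv: "?fv \<in> hom_at C j (JO X) (TO Z)" "?fv \<in> hom_at C k (JO Y') (TO Z)"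
    using pcomp_hom_at_inner[OF f(2) v(6)] pcomp_hom_at_outer[OF cv[OF f(2)] f(1) kj v(3)] one by simp_all
  have ta: "?t \<odot>[k] ?a \<in> hom_at C j (JO X) (TO Z)" "?t \<odot>[k] ?a \<in> hom_at C k (JO Y') (TO Z)"
    using pcomp_hom_at_inner[OF t(1) a(1)] pcomp_hom_at_outer[OF ca[OF t(1)] t(2) kj a(2)] one by simp_all
  note tfv = str_hom_at_other[OF Y' Z fv(2,1) jk] and sfv = str_hom_at_other[OF X Z fv kj]
  note tta = str_hom_at_other[OF Y' Z ta(2,1) jk] and sta = str_hom_at_other[OF X Z ta kj]
  have nest: "(q \<odot>[k] i Y) \<odot>[k] ?v = q \<odot>[k] ?a" if "q \<in> hom_at C k (TO Y) (TO Z)" for q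
    using pcomp_nested[OF that, of "i Y" 0 ?v] iY v by simp
  note y = tilde_cell'[OF Y Z f(2)] and ys = tilde_cell'[OF Y Z s(2)]
  have \<psi>: "?\<psi> \<in> cells C ?fv (?t \<odot>[k] ?a)"
    using whisker_right_cell[OF y cv[OF f(2)] v(3)] nest[OF t(1)] by simp
  have ysv: "?ys \<triangleleft>[k] ?v \<in> cells C (?s \<odot>[k] ?v) (?st \<odot>[k] ?a)"
    using whisker_right_cell[OF ys cv[OF s(2)] v(3)] nest[OF st] by simp
  have sv: "?s \<odot>[k] ?v \<in> hom_at C k (JO Y') (TO Z)" using pcomp_hom_at_inner[OF s(2) v(6)] by simp
  have h: "?h \<in> cells C (str k Y' Z (?t \<odot>[k] ?a)) (?t \<odot>[k] ?T)"
    using hat_cell'[OF Y' Y Z f(2) a(1)] by simp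
  have h': "?h' \<in> cells C (str k Y' Z (?st \<odot>[k] ?a)) (?st \<odot>[k] ?T)"
    using hat_cell'[OF Y' Y Z s(2) a(1)] by simp
  note t\<psi> = str2_cell[OF Y' Z fv(2) \<psi>] and tysv = str2_cell[OF Y' Z sv ysv]
  have m: "?m \<in> cells C (str j X Z ?fv) (?s \<odot>[k] ?v)"
    using nat_cell[OF X Z f(1) cv[OF f(2)] kj v(3)] one by simp
  have n: "?n \<in> cells C (str j X Z (?t \<odot>[k] ?a)) (?ts \<odot>[k] ?a)"
    using nat_cell[OF X Z t(2) ca[OF t(1)] kj a(2)] one by simp
  have N: "?N \<in> cells C (str j X Z (?t \<odot>[k] ?T)) (?ts \<odot>[k] ?T)"
    using nat_cell[OF X Z t(2) cT[OF t(1)] kj a(6)] one by simp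
  note tm = str2_cell[OF Y' Z sfv m] and tn = str2_cell[OF Y' Z sta n]
  note sh = str2_cell[OF X Z tta h] and st\<psi> = str2_cell[OF X Z tfv t\<psi>]
  note s\<psi> = str2_cell[OF X Z fv(1) \<psi>]
  note ts\<psi> = str2_cell[OF Y' Z sfv s\<psi>]
  note g = gam_cell[OF X Y Z f jk] and G = gam_cell[OF X Y' Z fv jk] and Ga = gam_cell[OF X Y' Z ta jk]
  note gT = whisker_right_cell[OF g cT[OF ts] a(6)] and ga = whisker_right_cell[OF g ca[OF ts] a(2)]
  have tsa: "?ts \<odot>[k] ?a \<in> hom_at C k (JO Y') (TO Z)" using pcomp_hom_at_inner[OF ts a(1)] by simp
  note tga = str2_cell[OF Y' Z tsa ga]
  let ?ti = "?t \<odot>[k] i Y" and ?w = "nat_iso j X Z k ?t (i Y)"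
  note ti = hom_at_unit[OF Y t(1)] hom_at_unit_other[OF Y t(1,2) kj]
  let ?r = "nat_iso j X Z k ?ti ?v"
  have r: "?r \<in> cells C (str j X Z (?t \<odot>[k] ?a)) (str j X Z ?ti \<odot>[k] ?v)"
    using nat_cell[OF X Z ti(2) cv[OF ti(1)] kj v(3)] one nest[OF t(1)] by simp
  note w = nat_unit_cell[OF X Z Y t(2,1) kj]
  have sti: "str j X Z ?ti \<in> hom_at C k (JO Y) (TO Z)" by (rule str_hom_at_other[OF X Z ti(2,1) kj])
  have wv: "?w \<triangleleft>[k] ?v \<in> cells C (str j X Z ?ti \<odot>[k] ?v) (?ts \<odot>[k] ?a)"
    using whisker_right_cell[OF w cv[OF sti] v(3)] nest[OF ts] by simp
  have gi: "?g \<triangleleft>[k] i Y \<in> cells C (?ts \<odot>[k] i Y) (?st \<odot>[k] i Y)"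
    by (rule whisker_right_cell[OF g unit_pcomp_cong[OF Y ts] iY(1)])
  note sy = str2_cell[OF X Z f(1) y]
  note syv = whisker_right_cell[OF sy cv[OF s(2)] v(3)]
  have ne: "?n = (?w \<triangleleft>[k] ?v) \<cdot> ?r"
    using nat_iso_nested'[OF X Z t(2) unit_pcomp_cong[OF Y t(1)] kj _ v(3), of 0] v iY by simp
  have re: "?r \<cdot> str2 j X Z ?\<psi> = (str2 j X Z ?y \<triangleleft>[k] ?v) \<cdot> ?m"
    using nat_iso_natural'[OF X Z f(1) cv[OF f(2)] kj y cide_cell[OF v(3)]] one by simp
  have ge: "?g \<triangleleft>[k] ?a = (?g \<triangleleft>[k] i Y) \<triangleleft>[k] ?v"
    using pcell_nested[OF g cide_cell[OF iY(1)] cide_cell[OF v(3)] ts, of 0] iY v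
      pcell_cide[of "i Y" 0 ?v "TO Y"] by simp
  note ty = cellsD(1-3)[OF m] cellsD(1-3)[OF ga] cellsD(1-3)[OF wv] cellsD(1-3)[OF r] cellsD(1-3)[OF s\<psi>]
    cellsD(1-3)[OF syv] cellsD(1-3)[OF ysv] cellsD(1-3)[OF tm] cellsD(1-3)[OF tn] cellsD(1-3)[OF sh]
    cellsD(1-3)[OF st\<psi>] cellsD(1-3)[OF ts\<psi>] cellsD(1-3)[OF G] cellsD(1-3)[OF Ga] cellsD(1-3)[OF gT]
    cellsD(1-3)[OF N] cellsD(1-3)[OF h'] cellsD(1-3)[OF tga] cellsD(1-3)[OF tysv] cellsD(1-3)[OF n]
  \<comment> \<open>All three factors are rewritten as 2-cells whiskered by \<open>J u\<close>, up
    to one pseudonaturality 2-cell on the right; under the whiskering stands the left-hand side of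
    \<open>gam_tilde_t\<close>.\<close>
  have "(?g \<triangleleft>[k] ?a) \<cdot> ?n \<cdot> str2 j X Z ?\<psi> = (?g \<triangleleft>[k] ?a) \<cdot> ((?w \<triangleleft>[k] ?v) \<cdot> (?r \<cdot> str2 j X Z ?\<psi>))"
    unfolding ne using ty by (simp add: vcomp_assoc' vcomp_Cell)
  also have "\<dots> = ((?g \<triangleleft>[k] ?a) \<cdot> (?w \<triangleleft>[k] ?v) \<cdot> (str2 j X Z ?y \<triangleleft>[k] ?v)) \<cdot> ?m"
    unfolding re using ty by (simp add: vcomp_assoc' vcomp_Cell)
  also have "(?g \<triangleleft>[k] ?a) \<cdot> (?w \<triangleleft>[k] ?v) \<cdot> (str2 j X Z ?y \<triangleleft>[k] ?v)
      = ((?g \<triangleleft>[k] i Y) \<cdot> ?w \<cdot> str2 j X Z ?y) \<triangleleft>[k] ?v"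
    unfolding ge whisker_right_vcomp[OF sy vcomp_cell[OF w gi] cv[OF s(2)] v(3)]
      whisker_right_vcomp[OF w gi cv[OF sti] v(3)] ..
  also have "(?g \<triangleleft>[k] i Y) \<cdot> ?w \<cdot> str2 j X Z ?y = ?ys"
    by (rule gam_tilde_t[OF X Y Z f jk])
  finally have key: "(?g \<triangleleft>[k] ?a) \<cdot> ?n \<cdot> str2 j X Z ?\<psi> = (?ys \<triangleleft>[k] ?v) \<cdot> ?m" .
  have "(?g \<triangleleft>[k] ?T) \<cdot> ?N \<cdot> str2 j X Z (str_nat_arg k Y' Y Z f u)
      = ((?g \<triangleleft>[k] ?T) \<cdot> ?N \<cdot> str2 j X Z ?h) \<cdot> str2 j X Z (str2 k Y' Z ?\<psi>)"
    unfolding str2_vcomp[OF X Z tfv t\<psi> h] using ty by (simp add: vcomp_assoc' vcomp_Cell)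
  also have "(?g \<triangleleft>[k] ?T) \<cdot> ?N \<cdot> str2 j X Z ?h
      = ?h' \<cdot> str2 k Y' Z (?g \<triangleleft>[k] ?a) \<cdot> str2 k Y' Z ?n \<cdot> gam j k X Y' Z (?t \<odot>[k] ?a)"
    using gam_hat_t[OF Y' X Y Z f jk a(1)] one by simp
  also have "\<dots> \<cdot> str2 j X Z (str2 k Y' Z ?\<psi>)
      = ?h' \<cdot> str2 k Y' Z (?g \<triangleleft>[k] ?a) \<cdot> str2 k Y' Z ?n
        \<cdot> (gam j k X Y' Z (?t \<odot>[k] ?a) \<cdot> str2 j X Z (str2 k Y' Z ?\<psi>))"
    using ty by (simp add: vcomp_assoc' vcomp_Cell)
  also have "\<dots> = ?h' \<cdot> (str2 k Y' Z (?g \<triangleleft>[k] ?a) \<cdot> str2 k Y' Z ?n \<cdot> str2 k Y' Z (str2 j X Z ?\<psi>))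
        \<cdot> gam j k X Y' Z ?fv"
    unfolding gam_natural[OF X Y' Z fv jk \<psi>] using ty by (simp add: vcomp_assoc' vcomp_Cell)
  also have "str2 k Y' Z (?g \<triangleleft>[k] ?a) \<cdot> str2 k Y' Z ?n \<cdot> str2 k Y' Z (str2 j X Z ?\<psi>)
      = str2 k Y' Z ((?ys \<triangleleft>[k] ?v) \<cdot> ?m)"
    unfolding key[symmetric] str2_vcomp[OF Y' Z sfv s\<psi> vcomp_cell[OF n ga]] str2_vcomp[OF Y' Z sta n ga] ..
  finally show ?thesis
    unfolding str2_vcomp[OF Y' Z sfv m ysv] using ty by (simp add: vcomp_assoc' vcomp_Cell)
qed

text \<open>\<open>T v\<close> is itself a strengthening, so \<open>f\<close> is the inner map of
  t-hat. The transpose of t-hat at the inner map then contains the transpose of gamma, and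
  \<open>hat_subst_inner\<close> at the unit \<open>i X\<close> matches the two sides.\<close>

lemma gam_nat_Z:
  assumes X: "X \<in> Obj D" and Y: "Y \<in> Obj D" and Z: "Z \<in> Obj D"
    and f: "f \<in> hom_at C j (JO X) (TO Z)" "f \<in> hom_at C k (JO Y) (TO Z)" and jk: "j \<noteq> k"
    and v: "v \<in> hom D [Z] Z'"
  shows "str_nat_val k Y Z Z' v (str j X Z f) \<cdot> str2 k Y Z' (str_nat_val j X Z Z' v f)
              \<cdot> gam j k X Y Z' (T_map Z Z' v \<odot>[0] f)
            = (T_map Z Z' v \<triangleright>[0] gam j k X Y Z f)
              \<cdot> str_nat_val j X Z Z' v (str k Y Z f) \<cdot> str2 j X Z' (str_nat_val k Y Z Z' v f)"
proof -
  let ?s = "str j X Z f" and ?t = "str k Y Z f" and ?g = "gam j k X Y Z f" and ?a = "i Z' \<odot>[0] on_mor J v"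
  let ?T = "T_map Z Z' v" and ?x = "tilde j X Z f" and ?u = "nat_iso k Y Z j (str j X Z f) (i X)"
  let ?Tf = "?T \<odot>[0] f" and ?Ts = "?T \<odot>[0] ?s" and ?Tt = "?T \<odot>[0] ?t" and ?st = "str k Y Z ?s"
  let ?G = "gam j k X Y Z' ?Tf"
  let ?hs = "hat 0 k Y Z Z' ?a ?s" and ?hj = "hat 0 j X Z Z' ?a f" and ?ht = "hat 0 j X Z Z' ?a ?t"
    and ?hk = "hat 0 k Y Z Z' ?a f" and ?hu = "hat 0 k Y Z Z' ?a (?s \<odot>[j] i X)"
  note kj = jk[symmetric] and iX = unit_type[OF X]
  note Z' = J_hom(2)[OF v] note a = unit_J[OF v]
  note s = str_type(4)[OF X Z f(1)] str_hom_at_other[OF X Z f kj]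
  note t = str_type(4)[OF Y Z f(2)] str_hom_at_other[OF Y Z f(2,1) jk]
  have st: "?st \<in> hom_at C j (TO X) (TO Z)" by (rule str_hom_at_other[OF Y Z s(2,1) jk])
  have cT: "?T \<in> hom_at C 0 (Cod C q) (TO Z')" if "Cod C q = TO Z" for q using a that by simp
  have T: "?T \<odot>[0] q \<in> hom_at C m B (TO Z')" if "q \<in> hom_at C m B (TO Z)" for q m B
    using pcomp_hom_at_inner[OF a(5) that] by simp
  have TD: "?T \<in> hom_at C 0 (Cod C q) (TO Z')" if "q \<in> hom_at C m B (TO Z)" for q m B
    using cT hom_atD(4)[OF that] by simp
  note tTf = str_hom_at_other[OF Y Z' T[OF f(2)] T[OF f(1)] jk]
  note sTf = str_hom_at_other[OF X Z' T[OF f(1)] T[OF f(2)] kj]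
  note g = gam_cell[OF X Y Z f jk] and G = gam_cell[OF X Y Z' T[OF f(1)] T[OF f(2)] jk]
  have hs: "?hs \<in> cells C (str k Y Z' ?Ts) (?T \<odot>[0] ?st)" using hat_cell'[OF Y Z Z' a(1) s(2)] by simp
  have hj: "?hj \<in> cells C (str j X Z' ?Tf) ?Ts" using hat_cell'[OF X Z Z' a(1) f(1)] by simp
  have ht: "?ht \<in> cells C (str j X Z' ?Tt) (?T \<odot>[0] str j X Z ?t)" using hat_cell'[OF X Z Z' a(1) t(2)] by simp
  have hk: "?hk \<in> cells C (str k Y Z' ?Tf) ?Tt" using hat_cell'[OF Y Z Z' a(1) f(2)] by simp
  note su = hom_at_unit_other[OF X s jk]
  have hu: "?hu \<in> cells C (str k Y Z' (?T \<odot>[0] (?s \<odot>[j] i X))) (?T \<odot>[0] str k Y Z (?s \<odot>[j] i X))"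
    using hat_cell'[OF Y Z Z' a(1) su] by simp
  note shj = str2_cell[OF Y Z' sTf hj] and shk = str2_cell[OF X Z' tTf hk]
  note Tg = whisker_left_cell[OF g TD[OF str_type(4)[OF X Z t(2)]]]
  note x = tilde_cell'[OF X Z f(1)] note tx = str2_cell[OF Y Z f(2) x]
  note u = nat_unit_cell[OF Y Z X s(2,1) jk]
  note Tx = whisker_left_cell[OF x TD[OF f(1)]]
  note sTx = str2_cell[OF Y Z' T[OF f(2)] Tx]
  note Ttx = whisker_left_cell[OF tx TD[OF t(1)]]
  note Tu = whisker_left_cell[OF u TD[OF str_type(4)[OF Y Z su]]]
  let ?n = "nat_iso k Y Z' j ?Ts (i X)"
  have nest: "?T \<odot>[0] (q \<odot>[j] i X) = (?T \<odot>[0] q) \<odot>[j] i X" if "q \<in> hom_at C j (TO X) (TO Z)" for q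
    using pcomp_nested[OF a(5) unit_pcomp_cong[OF X that] iX(1)] by simp
  have n: "?n \<in> cells C (str k Y Z' (?T \<odot>[0] (?s \<odot>[j] i X))) (str k Y Z' ?Ts \<odot>[j] i X)"
    using nat_unit_cell[OF Y Z' X T[OF s(2)] T[OF s(1)] jk] nest[OF s(1)] by simp
  have hsi: "?hs \<triangleleft>[j] i X \<in> cells C (str k Y Z' ?Ts \<odot>[j] i X) (?T \<odot>[0] (?st \<odot>[j] i X))"
    using whisker_right_cell[OF hs unit_pcomp_cong[OF X str_hom_at_other[OF Y Z' T[OF s(2)] T[OF s(1)] jk]] iX(1)]
      nest[OF st] by simp
  have sub: "(?T \<triangleright>[0] ?u) \<cdot> ?hu = (?hs \<triangleleft>[j] i X) \<cdot> ?n"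
    using hat_subst_inner[OF Y Z Z' a(1) s(2) _ jk, of "i X" "[JO X]"] hom_atD[OF s(1)] unit_hom[OF X] iX by simp
  have hn: "?hu \<cdot> str2 k Y Z' (?T \<triangleright>[0] ?x) = (?T \<triangleright>[0] str2 k Y Z ?x) \<cdot> ?hk"
    using hat_natural[OF Y Z Z' a(1) f(2) cide_cell[OF a(2)] x] str2_cide[OF J_hom(1,2)[OF v] a(1)] by simp
  have "restr j X Z' (str k Y Z' ?Tf) (?hs \<cdot> (str2 k Y Z' ?hj \<cdot> ?G))
      = (?hs \<triangleleft>[j] i X) \<cdot> (?n \<cdot> str2 k Y Z' (?T \<triangleright>[0] ?x))"
    unfolding restr_vcomp[OF X Z' tTf vcomp_cell[OF G shj] hs]
      restr_str2_gam[OF X Y Z' T[OF f(1)] T[OF f(2)] jk hj]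
    using hat_tilde[OF X Z Z' a(1) f(1)] by simp
  also have "\<dots> = (?T \<triangleright>[0] ?u) \<cdot> (?hu \<cdot> str2 k Y Z' (?T \<triangleright>[0] ?x))"
    unfolding vcomp_assoc[OF sTx n hsi] vcomp_assoc[OF sTx hu Tu] sub ..
  also have "\<dots> = ((?T \<triangleright>[0] ?u) \<cdot> (?T \<triangleright>[0] str2 k Y Z ?x)) \<cdot> ?hk"
    unfolding hn by (rule vcomp_assoc[OF hk Ttx Tu])
  also have "(?T \<triangleright>[0] ?u) \<cdot> (?T \<triangleright>[0] str2 k Y Z ?x) = ?T \<triangleright>[0] restr j X Z ?t ?g"
    unfolding restr_gam[OF X Y Z f jk] by (rule whisker_left_vcomp[OF tx u TD[OF t(1)], symmetric])
  also have "\<dots> = restr j X Z' ?Tt ((?T \<triangleright>[0] ?g) \<cdot> ?ht)"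
    using restr_hat[OF X Z Z' a(1) t(2) cide_cell[OF a(6)] g] by simp
  also have "\<dots> \<cdot> ?hk = restr j X Z' (str k Y Z' ?Tf) ((?T \<triangleright>[0] ?g) \<cdot> ?ht \<cdot> str2 j X Z' ?hk)"
    by (rule restr_str2[OF X Z' tTf hk vcomp_cell[OF ht Tg], symmetric])
  finally show ?thesis
    using str_ext[OF X Z' tTf vcomp_cell[OF vcomp_cell[OF G shj] hs] vcomp_cell[OF shk vcomp_cell[OF ht Tg]]]
      vcomp_assoc[OF G shj hs] by simp
qed

section \<open>Verification of the axioms for ordered positions\<close>

lemma bihomD:
  assumes "f \<in> bihom C j A k B Y"
  shows "f \<in> hom_at C j A Y" "f \<in> hom_at C k B Y" "j \<noteq> k" "j < k"
  using assms by (auto simp: bihom_def split: if_splits)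

lemma pseudocommutativity_gam: "pseudocommutativity D C J T gam"
proof (unfold_locales, goal_cases)
  case (1 X Y Z f j k)
  show ?case by (rule gam_iso[OF 1(1-3) bihomD(1-3)[OF 1(4)]])
next
  case (2 X Y Z f j k \<alpha> f')
  show ?case by (rule gam_natural[OF 2(1-3) bihomD(1-3)[OF 2(4)] 2(5)])
next
  case (3 X Y Z f j k l g Cs j' k')
  note b = bihomD[OF 3(4)]
  show ?case
    by (rule gam_subst[OF 3(1-3) b(1-3) _ 3(6,7)])
      (use 3 b(1) in \<open>auto simp: hom_def hom_at_def\<close>)
next
  case (4 X Y Z f j k u X')
  show ?case by (rule gam_nat_X[OF 4(1-3) bihomD(1-3)[OF 4(4)] 4(5)])
next
  case (5 X Y Z f j k u Y')
  show ?case by (rule gam_nat_Y[OF 5(1-3) bihomD(1-3)[OF 5(4)] 5(5)])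
next
  case (6 X Y Z f j k v Z')
  show ?case by (rule gam_nat_Z[OF 6(1-3) bihomD(1-3)[OF 6(4)] 6(5)])
next
  case (7 X Y Z f j k)
  show ?case by (rule gam_tilde_s[OF 7(1-3) bihomD(1-3)[OF 7(4)]])
next
  case (8 X Y Z f j k)
  show ?case by (rule gam_tilde_t[OF 8(1-3) bihomD(1-3)[OF 8(4)]])
next
  case (9 W X Y Z f j k g l k')
  show ?case by (rule gam_hat_s[OF 9(1-4) bihomD(1-3)[OF 9(5)] 9(6,7)])
next
  case (10 V X Y Z f j k h l)
  note b = bihomD[OF 10(5)]
  show ?case
    \<comment> \<open>For \<open>j < k\<close> a substitution at \<open>k\<close> leaves position
      \<open>j\<close> in place, so the general position is the one named in the axiom.\<close>
    using gam_hat_t[OF 10(1-4) b(1-3) 10(6) refl] b(4) by (simp add: shift_def)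
next
  case (11 W X Y Z f j k l)
  note b = bihomD[OF 11(5)] bihomD[OF 11(6)]
  show ?case
    using gam_braid[OF 11(1-4) b(1,2,6,3)] b(4,7,8) by simp
qed

end

theorem theorem5p4:
  fixes C :: "('o, 'm, 'c) two_multicat"
    and D :: "('p, 'n, 'd) two_multicat"
    and J :: "('p, 'n, 'd, 'o, 'm, 'c) pseudo_multifun"
    and T :: "('p, 'o, 'm, 'c) strong_data"
    and \<tau> :: "nat \<Rightarrow> 'p \<Rightarrow> 'p \<Rightarrow> 'm \<Rightarrow> 'c"
  assumes "two_multicategory C" and "two_multicategory D"
    and "pseudo_multifunctor D C J" and "restricts_to_two_functor D C J"
    and "lax_idempotent_strong_relative_pseudomonad D C J T \<tau>"
  shows "\<exists>\<gamma>. pseudocommutativity D C J T \<gamma> \<and>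
    (\<forall>X \<in> Obj D. \<forall>Y \<in> Obj D. \<forall>Z \<in> Obj D. \<forall>j k.
      \<forall>g \<in> bihom C j (on_obj J X) k (on_obj J Y) (on_ob T Z).
        \<gamma> j k X Y Z g =
          \<tau> j X Z (strength T k Y Z (strength T j X Z g))
          \<cdot>\<^bsub>C\<^esub> strength2 T j X Z (str_nat T k Y Z j (strength T j X Z g) (unit T X))
          \<cdot>\<^bsub>C\<^esub> strength2 T j X Z (strength2 T k Y Z (t_tilde T j X Z g)))"
proof -
  interpret lax_idempotent_strong_relative_pseudomonad D C J T \<tau> by fact
  show ?thesis
    using pseudocommutativity_gam by (intro exI[of _ gam]) (simp add: gam_def)
qed

end
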